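(* Let $p>0$ and $\tau\in(0,1)$, and for each $n$ let $k=[pn]$ and $\ell=[\tau n]$ (integer parts). Then $$\lim_{n\to\infty}\left(\frac{e\sin(\pi\ell/n)}{\pi}\right)^{-nk}k^{nk}\,\mathrm{Vol}^{(n)}_{k,\ell}=\frac{e^{p\pi^2/6}}{\sqrt{2\pi p}}\;\mathcal{P}\big(e^{-pq_\tau^+}\big)\,\mathcal{P}\big(e^{-pq_\tau^-}\big),$$ where $q_\tau^{\pm}=2\pi^2\pm2\pi^2\iota\,\frac{\cos(\pi\tau)}{\sin(\pi\tau)}$ and $\mathcal{P}(s):=\sum_{m\ge0}p(m)s^m$ (for $|s|<1$) is the generating function of the integer partitions, $p(m)$ being the number of partitions of the integer $m$.
   Context: $\iota=\sqrt{-1}$. $\mathbb{Z}_n=\mathbb{Z}/n\mathbb{Z}=\{0,\ldots,n-1\}$ and $\mathbb{T}_n=[0,1)\times\mathbb{Z}_n$ (string $h$ is $[0,1)\times\{h\}$); arithmetic on string labels is mod $n$. Bead configuration: for $k\ge1$, a collection of $nk$ distinct points of $\mathbb{T}_n$ with exactly $k$ points on each string such that for every $h\in\mathbb{Z}_n$, if $t_1<\cdots<t_k$ and $t_1'<\cdots<t_k'$ are the horizontal coordinates of the points on strings $h$ and $h+1$, then either $t_1\le t_1'<t_2\le t_2'<\cdots<t_k\le t_k'$ or $t_1'<t_1\le t_2'<t_2\le\cdots\le t_k'<t_k$. Occupation number: $\ell:=\#\{h\in\mathbb{Z}_n:\ \text{the smallest horizontal coordinate on string }h\text{ is strictly less than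 that on string }h-1\}$. Volumes: identify a bead configuration with the array $(t_{h,j})_{0\le h\le n-1,1\le j\le k}\in[0,1)^{nk}$, where $t_{h,j}$ is the horizontal coordinate of the $j$-th bead (in increasing order) on string $h$; $\mathrm{Vol}^{(n)}_{k,\ell}$ is the $nk$-dimensional Lebesgue measure of the set of arrays of bead configurations with $k$ beads per string and occupation number $\ell$. *)

theory Defs
  imports "HOL-Analysis.Analysis" "HOL-Library.Multiset"
begin

text \<open>
  The space \<open>[0,1) \<times> \<int>\<^sub>n\<close>, with string labels represented by the residues \<open>0, \<dots>, n - 1\<close>.
\<close>

definition cylinder :: "nat \<Rightarrow> (real \<times> nat) set" where
  "cylinder n = {0..<1} \<times> {..<n}"

definition on_string :: "(real \<times> nat) set \<Rightarrow> nat \<Rightarrow> real set" where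
  "on_string B h = {t. (t, h) \<in> B}"

text \<open>Beads on a string are numbered from 1, in increasing order.\<close>

definition bead :: "(real \<times> nat) set \<Rightarrow> nat \<Rightarrow> nat \<Rightarrow> real" where
  "bead B h j = sorted_list_of_set (on_string B h) ! (j - 1)"

text \<open>
  The two disjuncts are the chains
  \<open>t\<^sub>1 \<le> t'\<^sub>1 < t\<^sub>2 \<le> t'\<^sub>2 < \<dots> < t\<^sub>k \<le> t'\<^sub>k\<close> and
  \<open>t'\<^sub>1 < t\<^sub>1 \<le> t'\<^sub>2 < t\<^sub>2 \<le> \<dots> \<le> t'\<^sub>k < t\<^sub>k\<close>.
\<close>

definition interlaced :: "nat \<Rightarrow> (nat \<Rightarrow> real) \<Rightarrow> (nat \<Rightarrow> real) \<Rightarrow> bool" where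
  "interlaced k t t' \<longleftrightarrow>
     ((\<forall>j\<in>{1..k}. t j \<le> t' j) \<and> (\<forall>j\<in>{1..<k}. t' j < t (j + 1))) \<or>
     ((\<forall>j\<in>{1..k}. t' j < t j) \<and> (\<forall>j\<in>{1..<k}. t j \<le> t' (j + 1)))"

definition bead_config :: "nat \<Rightarrow> nat \<Rightarrow> (real \<times> nat) set \<Rightarrow> bool" where
  "bead_config n k B \<longleftrightarrow>
     B \<subseteq> cylinder n \<and>
     (\<forall>h<n. finite (on_string B h) \<and> card (on_string B h) = k) \<and>
     (\<forall>h<n. interlaced k (bead B h) (bead B ((h + 1) mod n)))"

text \<open>The label \<open>(h + n - 1) mod n\<close> is \<open>h - 1\<close> in \<open>\<int>\<^sub>n\<close>.\<close>

definition occupation_number :: "nat \<Rightarrow> (real \<times> nat) set \<Rightarrow> nat" where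
  "occupation_number n B =
     card {h. h < n \<and> Min (on_string B h) < Min (on_string B ((h + n - 1) mod n))}"

definition bead_array :: "nat \<Rightarrow> nat \<Rightarrow> (real \<times> nat) set \<Rightarrow> nat \<times> nat \<Rightarrow> real" where
  "bead_array n k B = (\<lambda>(h, j)\<in>{..<n} \<times> {1..k}. bead B h j)"

definition bead_vol :: "nat \<Rightarrow> nat \<Rightarrow> nat \<Rightarrow> real" where
  "bead_vol n k l =
     measure (\<Pi>\<^sub>M i\<in>{..<n} \<times> {1..k}. lborel)
       (bead_array n k ` {B. bead_config n k B \<and> occupation_number n B = l})"

text \<open>A partition of \<open>m\<close> is a multiset of positive integers with sum \<open>m\<close>.\<close>

definition num_partitions :: "nat \<Rightarrow> nat" where
  "num_partitions m = card {M :: nat multiset. 0 \<notin># M \<and> sum_mset M = m}"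

definition partition_gf :: "complex \<Rightarrow> complex" where
  "partition_gf s = (\<Sum>m. of_nat (num_partitions m) * s ^ m)"

definition q_plus :: "real \<Rightarrow> complex" where
  "q_plus \<tau> = of_real (2 * pi\<^sup>2) + of_real (2 * pi\<^sup>2) * \<i> * of_real (cos (pi * \<tau>) / sin (pi * \<tau>))"

definition q_minus :: "real \<Rightarrow> complex" where
  "q_minus \<tau> = of_real (2 * pi\<^sup>2) - of_real (2 * pi\<^sup>2) * \<i> * of_real (cos (pi * \<tau>) / sin (pi * \<tau>))"

end

theory Submission
  imports Defs "HOL-Combinatorics.Permutations" "HOL-Real_Asymp.Real_Asymp"
begin

text \<open>
  Read the horizontal coordinate as time and a bead on string \<open>h\<close> as the jump
  of a particle from site \<open>h\<close> to site \<open>h + 1\<close> of the cycle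
  \<open>\<int>\<^sub>n\<close>. Interlacing of consecutive strings then says exactly that
  every site holds at most one particle at every time, and the occupation number is the
  number of particles. A bead configuration is therefore a closed walk of \<open>l\<close>
  particles with exclusion, together with the times of its \<open>n * k\<close> jumps. For
  each order of the jumps these times fill a volume \<open>1 / fact (n * k)\<close>, so the
  volume is a number of closed walks divided by a factorial
  (\<open>bead_vol_eq_card_closed_walks\<close>).

  The particles cannot pass each other, so the walk is one of free fermions: the Slater
  determinants built from the solutions of \<open>z ^ n = (- 1) ^ (l + 1)\<close>
  diagonalise the hopping operator, and the trace of its power is the sum of
  \<open>(\<Sum>j\<in>I. node n l j) ^ (n * k)\<close> over the \<open>l\<close>-element
  sets \<open>I\<close> of these roots (\<open>card_closed_walks\<close>).

  The sum of a set of roots is largest in modulus for an arc of consecutive roots, where it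
  equals \<open>sin (\<pi> l / n) / sin (\<pi> / n)\<close>. Rotating a set multiplies its
  sum by an \<open>n\<close>-th root of unity, which the exponent \<open>n * k\<close> does
  not see; so it suffices to take the sets whose sum points within \<open>\<pi> / n\<close>
  of the positive real axis, and to multiply by \<open>n\<close>
  (\<open>sum_powers_eq_sector_sum\<close>). Such a set is described by the particles and
  holes near the two ends of the arc around 1. If particles and holes balance at each end,
  the quotient of its sum and that of the arc is \<open>1 - c / n\<^sup>2\<close> up to
  smaller terms, and its power tends to a product of one power of \<open>exp (- p * q_minus
  \<tau>)\<close> and one of \<open>exp (- p * q_plus \<tau>)\<close>. If they do not
  balance, the sum has left the sector. The contributions of all sets are dominated by a
  convergent series, because every displaced root costs a fixed factor per step
  (\<open>mode_weight_bound\<close>), so the limit may be taken term by term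
  (\<open>closed_walks_lim\<close>).

  A balanced family of particles and holes at one end is a pair of finite sets of the same
  size, that is, the Frobenius coordinates of a partition, and the exponent is the size of
  this partition (\<open>card_frobenius_pairs\<close>); this produces the two generating
  functions. The constant comes from Stirling's formula for \<open>fact (n * k)\<close> and
  from the power of \<open>(\<pi> / n) / sin (\<pi> / n)\<close>.
\<close>

section \<open>Volumes of sets defined by an order\<close>

definition same_order :: "'a set \<Rightarrow> ('a \<Rightarrow> 'b::linorder) \<Rightarrow> ('a \<Rightarrow> 'c::linorder) \<Rightarrow> bool" where
  "same_order J x y \<longleftrightarrow> (\<forall>i\<in>J. \<forall>j\<in>J. x i < x j \<longleftrightarrow> y i < y j)"

definition rankings :: "'a set \<Rightarrow> ('a \<Rightarrow> nat) set" where
  "rankings J = {\<sigma> \<in> J \<rightarrow>\<^sub>E {..<card J}. inj_on \<sigma> J}"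

text \<open>
  Equal values receive equal ranks, so that every point has a rank function and not only the
  injective points.
\<close>

definition rank_in :: "'a set \<Rightarrow> ('a \<Rightarrow> 'b::linorder) \<Rightarrow> 'a \<Rightarrow> nat" where
  "rank_in J x = (\<lambda>i\<in>J. card {j\<in>J. x j < x i})"

definition order_cell :: "'a set \<Rightarrow> ('a \<Rightarrow> nat) \<Rightarrow> ('a \<Rightarrow> real) set" where
  "order_cell J \<sigma> = {x \<in> J \<rightarrow>\<^sub>E {0..<1}. same_order J x \<sigma>}"

lemma rankingsD:
  assumes "finite J" "\<sigma> \<in> rankings J"
  shows "bij_betw \<sigma> J {..<card J}"
proof -
  have "inj_on \<sigma> J" "\<sigma> ` J \<subseteq> {..<card J}" using assms by (auto simp: rankings_def)
  moreover from this have "\<sigma> ` J = {..<card J}" by (intro card_subset_eq) (auto simp: card_image)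
  ultimately show ?thesis by (simp add: bij_betw_def)
qed

lemma card_rankings: "finite J \<Longrightarrow> card (rankings J) = fact (card J)"
  using card_inj_on_subset_funcset[of J "{..<card J}" J]
  by (simp add: rankings_def fact_prod_rev)

lemma finite_rankings: "finite J \<Longrightarrow> finite (rankings J)"
  unfolding rankings_def by (rule finite_subset[of _ "J \<rightarrow>\<^sub>E {..<card J}"]) (auto intro: finite_PiE)

lemma rank_in_less:
  assumes "finite J" "i \<in> J"
  shows "rank_in J x i < card J"
proof -
  have "{j\<in>J. x j < x i} \<subset> J" using assms by auto
  thus ?thesis using assms by (simp add: rank_in_def psubset_card_mono)
qed

lemma same_order_rank_in:
  assumes "finite J"
  shows "same_order J x (rank_in J x)"
  unfolding same_order_def
proof (intro ballI iffI)
  fix i j assume ij: "i \<in> J" "j \<in> J"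
  show "rank_in J x i < rank_in J x j" if "x i < x j"
  proof -
    have "{a\<in>J. x a < x i} \<subset> {a\<in>J. x a < x j}" using that ij by auto
    thus ?thesis using assms ij by (simp add: rank_in_def psubset_card_mono)
  qed
  show "x i < x j" if "rank_in J x i < rank_in J x j"
  proof (rule ccontr)
    assume "\<not> x i < x j"
    hence "{a\<in>J. x a < x j} \<subseteq> {a\<in>J. x a < x i}" by auto
    hence "rank_in J x j \<le> rank_in J x i" using assms ij by (simp add: rank_in_def card_mono)
    thus False using that by simp
  qed
qed

lemma rank_in_ranking: "finite J \<Longrightarrow> \<sigma> \<in> rankings J \<Longrightarrow> rank_in J \<sigma> = \<sigma>"
proof
  fix i assume fin: "finite J" and s: "\<sigma> \<in> rankings J"
  have b: "bij_betw \<sigma> J {..<card J}" using rankingsD fin s by blast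
  show "rank_in J \<sigma> i = \<sigma> i"
  proof (cases "i \<in> J")
    case True
    have "\<sigma> ` {j\<in>J. \<sigma> j < \<sigma> i} = {..<\<sigma> i}"
    proof -
      have "\<sigma> ` J = {..<card J}" using b by (simp add: bij_betw_def)
      moreover have "\<sigma> i < card J" using b True by (auto simp: bij_betw_def)
      ultimately show ?thesis by (auto simp: image_iff set_eq_iff) (metis less_trans)
    qed
    moreover have "inj_on \<sigma> {j\<in>J. \<sigma> j < \<sigma> i}" using b by (auto simp: bij_betw_def inj_on_def)
    ultimately have "card {j\<in>J. \<sigma> j < \<sigma> i} = \<sigma> i" by (metis card_image card_lessThan)
    thus ?thesis using True by (simp add: rank_in_def)
  next
    case False thus ?thesis using s by (auto simp: rank_in_def rankings_def PiE_def extensional_def)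
  qed
qed

lemma rank_in_cong: "same_order J x y \<Longrightarrow> rank_in J x = rank_in J y"
  unfolding rank_in_def same_order_def by (intro restrict_ext arg_cong[where f=card]) auto

lemma disjoint_order_cells:
  "finite J \<Longrightarrow> disjoint_family_on (order_cell J) (rankings J)"
  unfolding disjoint_family_on_def order_cell_def
  by (auto dest!: rank_in_cong simp: rank_in_ranking)

interpretation lborel_product: product_sigma_finite "\<lambda>_. lborel :: real measure" ..

lemma sets_order_cell:
  assumes "finite J"
  shows "order_cell J \<sigma> \<in> sets (PiM J (\<lambda>_. lborel :: real measure))" (is "_ \<in> sets ?M")
proof -
  have *: "{x \<in> space ?M. \<forall>i\<in>J. \<forall>j\<in>J. x i < x j \<longleftrightarrow> \<sigma> i < \<sigma> j} \<in> sets ?M"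
    using assms by measurable
  have "order_cell J \<sigma> = (J \<rightarrow>\<^sub>E {0..<1}) \<inter> {x \<in> space ?M. \<forall>i\<in>J. \<forall>j\<in>J. x i < x j \<longleftrightarrow> \<sigma> i < \<sigma> j}"
    by (auto simp: order_cell_def same_order_def space_PiM PiE_def)
  moreover have "(J \<rightarrow>\<^sub>E {0..<1}) \<in> sets ?M" using assms by (intro sets_PiM_I_finite) auto
  ultimately show ?thesis using * by auto
qed

text \<open>
  Integration over the coordinate \<open>i\<close> alone leaves the measure of a single
  point.
\<close>

lemma null_sets_diagonal:
  assumes "finite J" "i \<in> J" "j \<in> J" "i \<noteq> j"
  shows "{x \<in> space (PiM J (\<lambda>_. lborel :: real measure)). x i = x j} \<in> null_sets (PiM J (\<lambda>_. lborel))"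
    (is "?D \<in> null_sets ?M")
proof -
  define K where "K = J - {i}"
  have J: "J = insert i K" "i \<notin> K" "finite K" "j \<in> K" using assms by (auto simp: K_def)
  have D: "?D \<in> sets ?M" using assms by measurable
  have "emeasure ?M ?D = (\<integral>\<^sup>+x. indicator ?D x \<partial>?M)" using D by simp
  also have "\<dots> = (\<integral>\<^sup>+ x. (\<integral>\<^sup>+ y. indicator ?D (x(i := y)) \<partial>lborel) \<partial>PiM K (\<lambda>_. lborel))"
    using D unfolding J(1) by (intro lborel_product.product_nn_integral_insert J borel_measurable_indicator)
  also have "\<dots> = (\<integral>\<^sup>+ x. 0 \<partial>PiM K (\<lambda>_. lborel :: real measure))"
  proof (rule nn_integral_cong)
    fix x assume "x \<in> space (PiM K (\<lambda>_. lborel :: real measure))"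
    have "(\<integral>\<^sup>+ y. indicator ?D (x(i := y)) \<partial>lborel) \<le> (\<integral>\<^sup>+ y. indicator {x j} y \<partial>lborel)"
      using J by (intro nn_integral_mono) (auto split: split_indicator)
    thus "(\<integral>\<^sup>+ y. indicator ?D (x(i := y)) \<partial>lborel) = 0" by simp
  qed
  finally show ?thesis using D by auto
qed

lemma null_sets_order_cell:
  assumes "finite J" "\<not> inj_on \<sigma> J"
  shows "order_cell J \<sigma> \<in> null_sets (PiM J (\<lambda>_. lborel))"
proof -
  obtain i j where ij: "i \<in> J" "j \<in> J" "i \<noteq> j" "\<sigma> i = \<sigma> j" using assms by (auto simp: inj_on_def)
  have "order_cell J \<sigma> \<subseteq> {x \<in> space (PiM J (\<lambda>_. lborel :: real measure)). x i = x j}"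
    using ij by (auto simp: order_cell_def same_order_def space_PiM PiE_def)
       (metis less_irrefl linorder_neqE)
  thus ?thesis using null_sets_diagonal[OF assms(1) ij(1-3)] sets_order_cell[OF assms(1)]
    by (meson null_sets_subset)
qed

text \<open>
  Every point lies in the cell of its rank function, and \<open>P\<close> depends on this
  function only. The second union collects the rank functions with ties; it is a null set.
\<close>

lemma order_invariant_decomp:
  assumes "finite J"
    and Q: "\<And>x (\<sigma> :: 'a \<Rightarrow> nat). same_order J x \<sigma> \<Longrightarrow> P x = Q \<sigma>"
  shows "{x \<in> J \<rightarrow>\<^sub>E {0..<1::real}. P x} =
     (\<Union>\<sigma>\<in>{\<sigma>\<in>rankings J. Q \<sigma>}. order_cell J \<sigma>) \<union>
     (\<Union>\<sigma>\<in>{\<sigma>\<in>J \<rightarrow>\<^sub>E {..<card J}. Q \<sigma> \<and> \<not> inj_on \<sigma> J}. order_cell J \<sigma>)"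
proof (intro set_eqI iffI)
  fix x assume x: "x \<in> {x \<in> J \<rightarrow>\<^sub>E {0..<1::real}. P x}"
  let ?r = "rank_in J x"
  have r: "same_order J x ?r" using same_order_rank_in assms by blast
  have "?r \<in> J \<rightarrow>\<^sub>E {..<card J}" using rank_in_less[OF assms(1)] by (auto simp: rank_in_def PiE_def)
  moreover have "x \<in> order_cell J ?r" using x r by (auto simp: order_cell_def)
  moreover have "Q ?r" using Q[OF r] x by auto
  ultimately show "x \<in> (\<Union>\<sigma>\<in>{\<sigma>\<in>rankings J. Q \<sigma>}. order_cell J \<sigma>) \<union>
     (\<Union>\<sigma>\<in>{\<sigma>\<in>J \<rightarrow>\<^sub>E {..<card J}. Q \<sigma> \<and> \<not> inj_on \<sigma> J}. order_cell J \<sigma>)"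
    by (auto simp: rankings_def)
qed (auto simp: order_cell_def Q)

text \<open>
  A permutation of the coordinates preserves the product measure and takes the one cell to
  the other.
\<close>

lemma emeasure_order_cell_eq:
  assumes fin: "finite J" and s: "\<sigma> \<in> rankings J" "\<sigma>' \<in> rankings J"
  shows "emeasure (PiM J (\<lambda>_. lborel)) (order_cell J \<sigma>) = emeasure (PiM J (\<lambda>_. lborel)) (order_cell J \<sigma>')"
    (is "emeasure ?M _ = _")
proof -
  define \<pi> where "\<pi> = inv_into J \<sigma> \<circ> \<sigma>'"
  have b: "bij_betw \<sigma> J {..<card J}" "bij_betw \<sigma>' J {..<card J}" using rankingsD fin s by blast+
  have \<pi>: "bij_betw \<pi> J J" unfolding \<pi>_def
    using b bij_betw_inv_into bij_betw_trans by blast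
  have \<sigma>\<pi>: "\<sigma> (\<pi> i) = \<sigma>' i" if "i \<in> J" for i
    using b that unfolding \<pi>_def by (metis bij_betw_def comp_apply f_inv_into_f imageI)
  define T where "T = (\<lambda>x::_ \<Rightarrow> real. \<lambda>i\<in>J. x (\<pi> i))"
  have Tm: "T \<in> measurable ?M ?M"
    unfolding T_def using \<pi> by (intro measurable_restrict measurable_component_singleton) (auto simp: bij_betw_def)
  have dist: "distr ?M ?M T = ?M"
  proof (rule lborel_product.PiM_eqI[OF fin])
    fix A :: "'a \<Rightarrow> real set" assume A: "\<And>i. i \<in> J \<Longrightarrow> A i \<in> sets lborel"
    have "emeasure (distr ?M ?M T) (Pi\<^sub>E J A) = emeasure ?M (T -` (Pi\<^sub>E J A) \<inter> space ?M)"
      using Tm A fin by (intro emeasure_distr sets_PiM_I_finite) auto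
    also have "T -` (Pi\<^sub>E J A) \<inter> space ?M = Pi\<^sub>E J (A \<circ> inv_into J \<pi>)"
    proof (intro set_eqI iffI)
      fix x assume "x \<in> T -` (Pi\<^sub>E J A) \<inter> space ?M"
      hence x: "\<And>i. i \<in> J \<Longrightarrow> x (\<pi> i) \<in> A i" "x \<in> extensional J" by (fastforce simp: T_def space_PiM PiE_def Pi_iff)+
      show "x \<in> Pi\<^sub>E J (A \<circ> inv_into J \<pi>)"
      proof (intro PiE_I)
        fix i assume "i \<in> J"
        thus "x i \<in> (A \<circ> inv_into J \<pi>) i" using x(1)[of "inv_into J \<pi> i"] \<pi>
          by (metis bij_betw_def comp_apply f_inv_into_f inv_into_into)
      qed (use x in \<open>auto simp: extensional_def\<close>)
    next
      fix x assume x: "x \<in> Pi\<^sub>E J (A \<circ> inv_into J \<pi>)"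
      hence "x (\<pi> i) \<in> A i" if "i \<in> J" for i
        using that \<pi> by (metis (no_types, lifting) PiE_mem bij_betw_def comp_apply imageI inv_into_f_f)
      thus "x \<in> T -` (Pi\<^sub>E J A) \<inter> space ?M" using x by (auto simp: T_def space_PiM PiE_def)
    qed
    also have "emeasure ?M \<dots> = (\<Prod>i\<in>J. emeasure lborel ((A \<circ> inv_into J \<pi>) i))"
    proof (intro lborel_product.emeasure_PiM fin)
      show "(A \<circ> inv_into J \<pi>) i \<in> sets lborel" if "i \<in> J" for i
        using A[of "inv_into J \<pi> i"] \<pi> that inv_into_into[of i \<pi> J] by (simp add: bij_betw_def)
    qed
    also have "\<dots> = (\<Prod>i\<in>J. emeasure lborel (A i))"
      using prod.reindex_bij_betw[OF bij_betw_inv_into[OF \<pi>], of "\<lambda>i. emeasure lborel (A i)"] by simp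
    finally show "emeasure (distr ?M ?M T) (Pi\<^sub>E J A) = (\<Prod>i\<in>J. emeasure lborel (A i))" .
  qed simp
  have "emeasure ?M (order_cell J \<sigma>') = emeasure (distr ?M ?M T) (order_cell J \<sigma>')" using dist by simp
  also have "\<dots> = emeasure ?M (T -` order_cell J \<sigma>' \<inter> space ?M)"
    using Tm sets_order_cell[OF fin] by (intro emeasure_distr) auto
  also have "T -` order_cell J \<sigma>' \<inter> space ?M = order_cell J \<sigma>"
  proof -
    have im: "\<pi> ` J = J" using \<pi> by (simp add: bij_betw_def)
    have "(\<forall>i\<in>J. \<forall>j\<in>J. x (\<pi> i) < x (\<pi> j) \<longleftrightarrow> \<sigma>' i < \<sigma>' j) \<longleftrightarrow> (\<forall>i\<in>\<pi> ` J. \<forall>j\<in>\<pi> ` J. x i < x j \<longleftrightarrow> \<sigma> i < \<sigma> j)"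
      for x :: "'a \<Rightarrow> real" by (auto simp: \<sigma>\<pi>)
    moreover have "(\<forall>i\<in>J. 0 \<le> x (\<pi> i) \<and> x (\<pi> i) < 1) \<longleftrightarrow> (\<forall>i\<in>\<pi> ` J. 0 \<le> x i \<and> x i < 1)" for x :: "'a \<Rightarrow> real"
      by auto
    moreover have "x \<in> order_cell J \<sigma> \<longleftrightarrow> x \<in> extensional J \<and>
        (\<forall>i\<in>J. 0 \<le> x i \<and> x i < 1) \<and> (\<forall>i\<in>J. \<forall>j\<in>J. x i < x j \<longleftrightarrow> \<sigma> i < \<sigma> j)" for x
      by (auto simp: order_cell_def same_order_def PiE_def Pi_def)
    moreover have "T x \<in> order_cell J \<sigma>' \<longleftrightarrow>
        (\<forall>i\<in>J. 0 \<le> x (\<pi> i) \<and> x (\<pi> i) < 1) \<and> (\<forall>i\<in>J. \<forall>j\<in>J. x (\<pi> i) < x (\<pi> j) \<longleftrightarrow> \<sigma>' i < \<sigma>' j)" for x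
      by (auto simp: T_def order_cell_def same_order_def PiE_def Pi_def)
    ultimately show ?thesis unfolding im
      by (intro set_eqI) (simp add: space_PiM PiE_def conj_ac)
  qed
  finally show ?thesis ..
qed

lemma emeasure_order_invariant:
  assumes fin: "finite J" and Q: "\<And>x \<sigma>. same_order J x \<sigma> \<Longrightarrow> P x = Q \<sigma>"
  shows "emeasure (PiM J (\<lambda>_. lborel)) {x \<in> J \<rightarrow>\<^sub>E {0..<1::real}. P x} =
    (\<Sum>\<sigma>\<in>{\<sigma> \<in> rankings J. Q \<sigma>}. emeasure (PiM J (\<lambda>_. lborel)) (order_cell J \<sigma>))"
proof -
  let ?M = "PiM J (\<lambda>_. lborel :: real measure)" and ?R = "{\<sigma> \<in> rankings J. Q \<sigma>}"
  let ?N = "(\<Union>\<sigma>\<in>{\<sigma>\<in>J \<rightarrow>\<^sub>E {..<card J}. Q \<sigma> \<and> \<not> inj_on \<sigma> J}. order_cell J \<sigma>)"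
  have finR: "finite ?R" using finite_rankings[OF fin] by auto
  have nullN: "?N \<in> null_sets ?M"
    using fin by (intro null_sets_UN' null_sets_order_cell countable_finite)
      (auto intro!: finite_subset[OF _ finite_PiE[of J "\<lambda>_. {..<card J}"]])
  have "emeasure ?M {x \<in> J \<rightarrow>\<^sub>E {0..<1}. P x} = emeasure ?M (\<Union>\<sigma>\<in>?R. order_cell J \<sigma>)"
    using nullN sets_order_cell[OF fin] finR
    by (subst order_invariant_decomp[where Q=Q, OF fin Q]; (intro emeasure_Un_null_set)?) auto
  also have "\<dots> = (\<Sum>\<sigma>\<in>?R. emeasure ?M (order_cell J \<sigma>))"
    using sets_order_cell[OF fin] finR disjoint_order_cells[OF fin]
    by (intro sum_emeasure[symmetric]) (auto intro: disjoint_family_on_mono[rotated])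
  finally show ?thesis .
qed

text \<open>
  The cells of the rankings have equal volumes and fill the unit cube up to a null set.
\<close>

lemma emeasure_order_cell:
  assumes fin: "finite J" and s: "\<sigma> \<in> rankings J"
  shows "emeasure (PiM J (\<lambda>_. lborel)) (order_cell J \<sigma>) = ennreal (1 / fact (card J))"
proof -
  let ?M = "PiM J (\<lambda>_. lborel :: real measure)"
  let ?c = "emeasure ?M (order_cell J \<sigma>)"
  have "1 = emeasure ?M (J \<rightarrow>\<^sub>E {0..<1})"
    using fin by (subst lborel_product.emeasure_PiM) auto
  also have "\<dots> = (\<Sum>\<rho>\<in>rankings J. emeasure ?M (order_cell J \<rho>))"
    using emeasure_order_invariant[OF fin, of "\<lambda>_. True" "\<lambda>_. True"] by simp
  also have "\<dots> = (\<Sum>\<rho>\<in>rankings J. ?c)"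
    using emeasure_order_cell_eq[OF fin _ s] by (intro sum.cong) auto
  also have "\<dots> = of_nat (fact (card J)) * ?c" using card_rankings[OF fin] by simp
  finally have *: "of_nat (fact (card J)) * ?c = 1" ..
  hence "?c \<noteq> top" by (auto simp: ennreal_mult_top)
  then obtain r where r: "?c = ennreal r" "r \<ge> 0" by (cases ?c) auto
  have "of_nat (fact (card J)) = ennreal (fact (card J))" by (metis ennreal_of_nat_eq_real_of_nat of_nat_fact)
  hence "ennreal (fact (card J) * r) = ennreal 1" using * r by (simp add: ennreal_mult)
  hence "fact (card J) * r = 1" using r by (subst (asm) ennreal_inj) auto
  hence "r = 1 / fact (card J)" by (simp add: field_simps)
  thus ?thesis using r by simp
qed

lemma measure_order_invariant:
  fixes P :: "('a \<Rightarrow> real) \<Rightarrow> bool" and Q :: "('a \<Rightarrow> nat) \<Rightarrow> bool"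
  assumes fin: "finite J" and Q: "\<And>x \<sigma>. same_order J x \<sigma> \<Longrightarrow> P x = Q \<sigma>"
  shows "measure (PiM J (\<lambda>_. lborel)) {x \<in> J \<rightarrow>\<^sub>E {0..<1}. P x} = card {\<sigma> \<in> rankings J. Q \<sigma>} / fact (card J)"
proof -
  let ?R = "{\<sigma> \<in> rankings J. Q \<sigma>}"
  have "emeasure (PiM J (\<lambda>_. lborel)) {x \<in> J \<rightarrow>\<^sub>E {0..<1::real}. P x} =
      (\<Sum>\<sigma>\<in>?R. emeasure (PiM J (\<lambda>_. lborel)) (order_cell J \<sigma>))"
    by (rule emeasure_order_invariant[OF fin Q])
  also have "\<dots> = (\<Sum>\<sigma>\<in>?R. ennreal (1 / fact (card J)))"
    using emeasure_order_cell[OF fin] by (intro sum.cong) auto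
  also have "\<dots> = ennreal (card ?R / fact (card J))"
    by (simp add: ennreal_of_nat_eq_real_of_nat flip: ennreal_mult)
  finally show ?thesis by (simp add: measure_def)
qed

section \<open>Bead configurations as interlaced arrays\<close>

text \<open>
  Values in an arbitrary linear order are allowed, because the conditions are needed both
  for the coordinates of the beads and for their ranks among all beads.
\<close>

definition interlaced_array :: "nat \<Rightarrow> nat \<Rightarrow> nat \<Rightarrow> (nat \<times> nat \<Rightarrow> 'b::linorder) \<Rightarrow> bool" where
  "interlaced_array n k l x \<longleftrightarrow>
     (\<forall>h<n. \<forall>i\<in>{1..k}. \<forall>j\<in>{1..k}. i < j \<longrightarrow> x (h, i) < x (h, j)) \<and>
     (\<forall>h<n. let g = (h + 1) mod n in
        ((\<forall>j\<in>{1..k}. x (h, j) \<le> x (g, j)) \<and> (\<forall>j\<in>{1..<k}. x (g, j) < x (h, j + 1))) \<or>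
        ((\<forall>j\<in>{1..k}. x (g, j) < x (h, j)) \<and> (\<forall>j\<in>{1..<k}. x (h, j) \<le> x (g, j + 1)))) \<and>
     card {h. h < n \<and> x (h, 1) < x ((h + n - 1) mod n, 1)} = l"

lemma interlaced_array_cong:
  assumes "same_order ({..<n} \<times> {1..k}) x y" "n \<ge> 1" "k \<ge> 1"
  shows "interlaced_array n k l x \<longleftrightarrow> interlaced_array n k l y"
proof -
  have lt: "x (h, i) < x (g, j) \<longleftrightarrow> y (h, i) < y (g, j)" if "h < n" "g < n" "i \<in> {1..k}" "j \<in> {1..k}" for h g i j
    using assms(1) that by (auto simp: same_order_def)
  hence le: "x (h, i) \<le> x (g, j) \<longleftrightarrow> y (h, i) \<le> y (g, j)" if "h < n" "g < n" "i \<in> {1..k}" "j \<in> {1..k}" for h g i j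
    using that by (auto simp flip: not_less)
  have 1: "(\<forall>h<n. \<forall>i\<in>{1..k}. \<forall>j\<in>{1..k}. i < j \<longrightarrow> x (h, i) < x (h, j)) \<longleftrightarrow>
        (\<forall>h<n. \<forall>i\<in>{1..k}. \<forall>j\<in>{1..k}. i < j \<longrightarrow> y (h, i) < y (h, j))"
    using lt by auto
  have 2: "{h. h < n \<and> x (h, 1) < x ((h + n - 1) mod n, 1)} = {h. h < n \<and> y (h, 1) < y ((h + n - 1) mod n, 1)}"
    using assms by (intro Collect_cong conj_cong lt) auto
  have 3: "(\<forall>j\<in>{1..k}. x (h, j) \<le> x (g, j)) \<longleftrightarrow> (\<forall>j\<in>{1..k}. y (h, j) \<le> y (g, j))"
    "(\<forall>j\<in>{1..k}. x (g, j) < x (h, j)) \<longleftrightarrow> (\<forall>j\<in>{1..k}. y (g, j) < y (h, j))"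
    "(\<forall>j\<in>{1..<k}. x (g, j) < x (h, j + 1)) \<longleftrightarrow> (\<forall>j\<in>{1..<k}. y (g, j) < y (h, j + 1))"
    "(\<forall>j\<in>{1..<k}. x (h, j) \<le> x (g, j + 1)) \<longleftrightarrow> (\<forall>j\<in>{1..<k}. y (h, j) \<le> y (g, j + 1))"
    if "h < n" "g < n" for h g using that by (auto simp: lt le)
  have 4: "h < n \<Longrightarrow> (h + 1) mod n < n" for h using assms by auto
  show ?thesis
    unfolding interlaced_array_def Let_def 1 2
    using 3[OF _ 4] by (intro conj_cong refl all_cong) auto
qed

lemma sorted_list_of_strict_mono_image:
  assumes "\<And>i j. i \<in> {1..k} \<Longrightarrow> j \<in> {1..k} \<Longrightarrow> i < j \<Longrightarrow> (t i :: 'b :: linorder) < t j"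
  shows "sorted_list_of_set (t ` {1..k}) = map t [1..<Suc k]" "card (t ` {1..k}) = k"
proof -
  have inj: "inj_on t {1..k}" using assms unfolding inj_on_def by (metis less_irrefl linorder_neqE)
  show c: "card (t ` {1..k}) = k" using inj by (simp add: card_image)
  have "sorted_wrt (<) (map t [1..<Suc k])"
    unfolding sorted_wrt_map by (rule sorted_wrt_mono_rel[OF _ sorted_wrt_upt]) (use assms in \<open>auto simp del: upt_Suc\<close>)
  hence "sorted (map t [1..<Suc k])" "distinct (map t [1..<Suc k])"
    using strict_sorted_iff by blast+
  thus "sorted_list_of_set (t ` {1..k}) = map t [1..<Suc k]"
    by (metis (no_types, lifting) atLeastLessThanSuc_atLeastAtMost list.set_map
      set_upt sorted_list_of_set.idem_if_sorted_distinct)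
qed

text \<open>
  Passing from a set of beads to its array loses nothing: each row is increasing, hence it
  is the sorted list of its own entries.
\<close>

lemma bead_array_image:
  assumes "n \<ge> 1" "k \<ge> 1"
  shows "bead_array n k ` {B. bead_config n k B \<and> occupation_number n B = l} =
         {x \<in> ({..<n} \<times> {1..k}) \<rightarrow>\<^sub>E {0..<1}. interlaced_array n k l x}" (is "?L = ?R")
proof (intro set_eqI iffI)
  fix x assume "x \<in> ?L"
  then obtain B where B: "bead_config n k B" "occupation_number n B = l" "x = bead_array n k B" by auto
  have fin: "finite (on_string B h)" "card (on_string B h) = k" if "h < n" for h
    using B that by (auto simp: bead_config_def)
  have x: "x (h, j) = bead B h j" if "h < n" "j \<in> {1..k}" for h j
    using that B by (auto simp: bead_array_def)
  have len: "length (sorted_list_of_set (on_string B h)) = k" if "h < n" for h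
    using fin that by simp
  have in01: "bead B h j \<in> {0..<1}" if "h < n" "j \<in> {1..k}" for h j
  proof -
    have "bead B h j \<in> set (sorted_list_of_set (on_string B h))"
      unfolding bead_def using that len by (intro nth_mem) auto
    hence "(bead B h j, h) \<in> B" using fin that by (auto simp: on_string_def)
    thus ?thesis using B by (auto simp: bead_config_def cylinder_def)
  qed
  have mono: "bead B h i < bead B h j" if "h < n" "i \<in> {1..k}" "j \<in> {1..k}" "i < j" for h i j
    using sorted_wrt_nth_less[OF strict_sorted_list_of_set[of "on_string B h"], of "i - 1" "j - 1"] that len
    by (auto simp: bead_def)
  have Min: "Min (on_string B h) = x (h, 1)" if "h < n" for h
  proof -
    have "on_string B h \<noteq> {}" using fin(2)[OF that] assms by (metis card.empty not_one_le_zero)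
    thus ?thesis using fin[OF that] that x[OF that, of 1] assms
      by (simp add: bead_def sorted_list_of_set_nonempty)
  qed
  have occ: "{h. h < n \<and> x (h, 1) < x ((h + n - 1) mod n, 1)} =
     {h. h < n \<and> Min (on_string B h) < Min (on_string B ((h + n - 1) mod n))}"
    using assms by (auto simp: Min)
  have il: "interlaced k (bead B h) (bead B ((h + 1) mod n))" if "h < n" for h
    using B that by (simp add: bead_config_def)
  have "interlaced_array n k l x"
    unfolding interlaced_array_def occ Let_def
  proof (intro conjI allI impI)
    show "card {h. h < n \<and> Min (on_string B h) < Min (on_string B ((h + n - 1) mod n))} = l"
      using B by (simp add: occupation_number_def)
    fix h assume h: "h < n"
    have g: "(h + 1) mod n < n" using assms by simp
    show "((\<forall>j\<in>{1..k}. x (h, j) \<le> x ((h + 1) mod n, j)) \<and> (\<forall>j\<in>{1..<k}. x ((h + 1) mod n, j) < x (h, j + 1))) \<or>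
        ((\<forall>j\<in>{1..k}. x ((h + 1) mod n, j) < x (h, j)) \<and> (\<forall>j\<in>{1..<k}. x (h, j) \<le> x ((h + 1) mod n, j + 1)))"
      using il[OF h] h g by (auto simp: interlaced_def x)
  qed (use mono x in auto)
  moreover have "x \<in> ({..<n} \<times> {1..k}) \<rightarrow>\<^sub>E {0..<1}"
    using in01 B(3) by (auto simp: bead_array_def PiE_def extensional_def)
  ultimately show "x \<in> ?R" by blast
next
  fix x assume x: "x \<in> ?R"
  hence mono: "x (h, i) < x (h, j)" if "h < n" "i \<in> {1..k}" "j \<in> {1..k}" "i < j" for h i j
    using that by (auto simp: interlaced_array_def)
  define B where "B = {(x (h, j), h) | h j. h < n \<and> j \<in> {1..k}}"
  have os: "on_string B h = (\<lambda>j. x (h, j)) ` {1..k}" if "h < n" for h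
    using that by (auto simp: on_string_def B_def)
  have sl: "sorted_list_of_set (on_string B h) = map (\<lambda>j. x (h, j)) [1..<Suc k]" "card (on_string B h) = k"
    if "h < n" for h
    unfolding os[OF that] using mono[OF that] by (intro sorted_list_of_strict_mono_image; simp)+
  have bead: "bead B h j = x (h, j)" if "h < n" "j \<in> {1..k}" for h j
    unfolding bead_def sl[OF that(1)] using that by (subst nth_map) (auto simp del: upt_Suc)
  have arr: "bead_array n k B = x"
    using x by (auto simp: bead_array_def bead fun_eq_iff PiE_def extensional_def)
  have fin: "finite (on_string B h)" if "h < n" for h using os that by auto
  have Min: "Min (on_string B h) = x (h, 1)" if "h < n" for h
  proof -
    have "on_string B h \<noteq> {}" using os that assms by auto
    thus ?thesis using fin[OF that] that bead[OF that, of 1] assms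
      by (simp add: bead_def sorted_list_of_set_nonempty)
  qed
  have occ: "{h. h < n \<and> x (h, 1) < x ((h + n - 1) mod n, 1)} =
     {h. h < n \<and> Min (on_string B h) < Min (on_string B ((h + n - 1) mod n))}"
    using assms by (auto simp: Min)
  have "occupation_number n B = l"
    unfolding occupation_number_def using x occ by (simp add: interlaced_array_def)
  moreover have "bead_config n k B"
    unfolding bead_config_def
  proof (intro conjI allI impI)
    show "B \<subseteq> cylinder n" using x by (auto simp: B_def cylinder_def PiE_def Pi_def)
    fix h assume h: "h < n"
    have g: "(h + 1) mod n < n" using assms by simp
    show "interlaced k (bead B h) (bead B ((h + 1) mod n))"
      using x h g unfolding interlaced_array_def interlaced_def Let_def
      by (auto simp: bead)
  qed (use fin sl in auto)
  ultimately show "x \<in> ?L" using arr by (auto simp: image_iff)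
qed

lemma bead_vol_eq_card_rankings:
  assumes "n \<ge> 1" "k \<ge> 1"
  shows "bead_vol n k l =
    card {\<sigma> \<in> rankings ({..<n} \<times> {1..k}). interlaced_array n k l \<sigma>} / fact (n * k)"
proof -
  have "bead_vol n k l = card {\<sigma> \<in> rankings ({..<n} \<times> {1..k}). interlaced_array n k l \<sigma>}
      / fact (card ({..<n} \<times> {1..k}))"
    unfolding bead_vol_def bead_array_image[OF assms]
    using assms by (intro measure_order_invariant interlaced_array_cong) auto
  thus ?thesis by (simp add: card_cartesian_product)
qed

section \<open>Interlaced arrays as closed walks\<close>

text \<open>
  The sites that are occupied at time 0: on such a site the first event is the departure
  along string \<open>h\<close> and not the arrival along string \<open>h - 1\<close>.
\<close>

definition start_set :: "nat \<Rightarrow> (nat \<times> nat \<Rightarrow> nat) \<Rightarrow> nat set" where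
  "start_set n \<sigma> = {h. h < n \<and> \<sigma> (h, 1) < \<sigma> ((h + n - 1) mod n, 1)}"

text \<open>
  The strings of all beads, read in the order of the horizontal coordinates.
\<close>

definition string_word :: "nat \<Rightarrow> nat \<Rightarrow> (nat \<times> nat \<Rightarrow> nat) \<Rightarrow> nat list" where
  "string_word n k \<sigma> = map (\<lambda>i. fst (inv_into ({..<n} \<times> {1..k}) \<sigma> i)) [0..<n * k]"

text \<open>
  A bead on string \<open>h - 1\<close> brings a particle to site \<open>h\<close> and a
  bead on string \<open>h\<close> takes one away, so this is the number of particles on site
  \<open>h\<close> after the first \<open>i\<close> beads.
\<close>

definition occupancy :: "nat \<Rightarrow> nat set \<Rightarrow> nat list \<Rightarrow> nat \<Rightarrow> nat \<Rightarrow> int" where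
  "occupancy n S w i h = of_bool (h \<in> S) + int (card {m. m < i \<and> w ! m = (h + n - 1) mod n})
     - int (card {m. m < i \<and> w ! m = h})"

definition closed_walks :: "nat \<Rightarrow> nat \<Rightarrow> nat \<Rightarrow> (nat set \<times> nat list) set" where
  "closed_walks n l N = {(S, w). S \<subseteq> {..<n} \<and> card S = l \<and> length w = N \<and> set w \<subseteq> {..<n} \<and>
     (\<forall>i\<le>N. \<forall>h<n. occupancy n S w i h \<in> {0, 1}) \<and> (\<forall>h<n. occupancy n S w N h = of_bool (h \<in> S))}"

text \<open>
  Through this equivalence inequalities between the entries of two increasing sequences
  become inequalities between their counting functions, which are what occupancies are made
  of.
\<close>

lemma le_count_iff:
  fixes t :: "nat \<Rightarrow> nat"
  assumes "\<And>i j. i \<in> {1..k} \<Longrightarrow> j \<in> {1..k} \<Longrightarrow> i < j \<Longrightarrow> t i < t j" "j \<in> {1..k}"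
  shows "j \<le> card {a \<in> {1..k}. t a < i} \<longleftrightarrow> t j < i"
proof
  assume lt: "t j < i"
  have "t a < i" if "a \<in> {1..j}" for a
    using assms(1)[of a j] assms(2) that lt by (cases "a = j") auto
  hence "{1..j} \<subseteq> {a \<in> {1..k}. t a < i}" using assms(2) by auto
  from card_mono[OF _ this] show "j \<le> card {a \<in> {1..k}. t a < i}" by simp
next
  assume le: "j \<le> card {a \<in> {1..k}. t a < i}"
  show "t j < i"
  proof (rule ccontr)
    assume ge: "\<not> t j < i"
    have "a < j" if "a \<in> {1..k}" "t a < i" for a
      using assms(1)[of j a] assms(2) that ge by (cases a j rule: linorder_cases) auto
    hence "{a \<in> {1..k}. t a < i} \<subseteq> {1..<j}" by auto
    from card_mono[OF _ this] le have "j \<le> j - 1" by simp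
    thus False using assms(2) by (cases j) auto
  qed
qed

lemma count_mono_iff:
  fixes t t' :: "nat \<Rightarrow> nat"
  assumes t: "\<And>i j. i \<in> {1..k} \<Longrightarrow> j \<in> {1..k} \<Longrightarrow> i < j \<Longrightarrow> t i < t j"
    and t': "\<And>i j. i \<in> {1..k} \<Longrightarrow> j \<in> {1..k} \<Longrightarrow> i < j \<Longrightarrow> t' i < t' j"
    and N: "\<And>j. j \<in> {1..k} \<Longrightarrow> t' j < N"
  shows "(\<forall>j\<in>{1..k}. t j \<le> t' j) \<longleftrightarrow>
     (\<forall>i\<le>N. card {a \<in> {1..k}. t' a < i} \<le> card {a \<in> {1..k}. t a < i})"
proof
  assume L: "\<forall>j\<in>{1..k}. t j \<le> t' j"
  show "\<forall>i\<le>N. card {a \<in> {1..k}. t' a < i} \<le> card {a \<in> {1..k}. t a < i}"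
    using L by (intro allI impI card_mono) (auto intro: le_less_trans)
next
  assume R: "\<forall>i\<le>N. card {a \<in> {1..k}. t' a < i} \<le> card {a \<in> {1..k}. t a < i}"
  show "\<forall>j\<in>{1..k}. t j \<le> t' j"
  proof
    fix j assume j: "j \<in> {1..k}"
    have "j \<le> card {a \<in> {1..k}. t' a < Suc (t' j)}" using le_count_iff[OF t' j] by simp
    also have "\<dots> \<le> card {a \<in> {1..k}. t a < Suc (t' j)}" using R N[OF j] by auto
    finally show "t j \<le> t' j" using le_count_iff[OF t j] by simp
  qed
qed

lemma count_shift_iff:
  fixes t t' :: "nat \<Rightarrow> nat"
  assumes t: "\<And>i j. i \<in> {1..k} \<Longrightarrow> j \<in> {1..k} \<Longrightarrow> i < j \<Longrightarrow> t i < t j"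
    and t': "\<And>i j. i \<in> {1..k} \<Longrightarrow> j \<in> {1..k} \<Longrightarrow> i < j \<Longrightarrow> t' i < t' j"
    and N: "\<And>j. j \<in> {1..k} \<Longrightarrow> t j < N"
  shows "(\<forall>j\<in>{1..<k}. t' j \<le> t (j + 1)) \<longleftrightarrow>
     (\<forall>i\<le>N. card {a \<in> {1..k}. t a < i} \<le> card {a \<in> {1..k}. t' a < i} + 1)"
proof
  assume L: "\<forall>j\<in>{1..<k}. t' j \<le> t (j + 1)"
  show "\<forall>i\<le>N. card {a \<in> {1..k}. t a < i} \<le> card {a \<in> {1..k}. t' a < i} + 1"
  proof (intro allI impI)
    fix i
    define m where "m = card {a \<in> {1..k}. t a < i}"
    have mk: "m \<le> k"
    proof -
      have "m \<le> card {1..k}" unfolding m_def by (intro card_mono) auto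
      thus ?thesis by simp
    qed
    show "card {a \<in> {1..k}. t a < i} \<le> card {a \<in> {1..k}. t' a < i} + 1"
    proof (cases "m \<le> 1")
      case False
      have "t m < i" using le_count_iff[where t=t and j=m and i=i and k=k, OF t] False mk by (simp add: m_def)
      moreover have "t' (m - 1) \<le> t (m - 1 + 1)" using L[rule_format, of "m - 1"] False mk by fastforce
      ultimately have "t' (m - 1) < i" using False by simp
      moreover have "m - 1 \<in> {1..k}" using False mk by auto
      ultimately have "m - 1 \<le> card {a \<in> {1..k}. t' a < i}" using le_count_iff[where t=t' and j="m - 1" and i=i and k=k, OF t'] by simp
      thus ?thesis by (simp add: m_def)
    qed (simp add: m_def)
  qed
next
  assume R: "\<forall>i\<le>N. card {a \<in> {1..k}. t a < i} \<le> card {a \<in> {1..k}. t' a < i} + 1"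
  show "\<forall>j\<in>{1..<k}. t' j \<le> t (j + 1)"
  proof
    fix j assume j: "j \<in> {1..<k}"
    hence j': "j \<in> {1..k}" "j + 1 \<in> {1..k}" by auto
    have "j + 1 \<le> card {a \<in> {1..k}. t a < Suc (t (j + 1))}" using le_count_iff[OF t j'(2)] by simp
    also have "\<dots> \<le> card {a \<in> {1..k}. t' a < Suc (t (j + 1))} + 1" using R N[OF j'(2)] by auto
    finally have "j \<le> card {a \<in> {1..k}. t' a < Suc (t (j + 1))}" by simp
    thus "t' j \<le> t (j + 1)" using le_count_iff[OF t' j'(1)] by simp
  qed
qed

lemma card_string_word:
  assumes \<sigma>: "\<sigma> \<in> rankings ({..<n} \<times> {1..k})" and "i \<le> n * k" "h < n"
  shows "card {m. m < i \<and> string_word n k \<sigma> ! m = h} = card {j \<in> {1..k}. \<sigma> (h, j) < i}"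
proof -
  let ?J = "{..<n} \<times> {1..k}"
  have b: "bij_betw \<sigma> ?J {..<n * k}"
    using rankingsD[OF _ \<sigma>] by (simp add: card_cartesian_product)
  have w: "string_word n k \<sigma> ! m = fst (inv_into ?J \<sigma> m)" if "m < n * k" for m
    using that by (simp add: string_word_def)
  have inv: "inv_into ?J \<sigma> (\<sigma> p) = p" if "p \<in> ?J" for p
    using b that by (simp add: bij_betw_def inv_into_f_f)
  have "bij_betw (\<lambda>j. \<sigma> (h, j)) {j \<in> {1..k}. \<sigma> (h, j) < i} {m. m < i \<and> string_word n k \<sigma> ! m = h}"
    unfolding bij_betw_def
  proof
    show "inj_on (\<lambda>j. \<sigma> (h, j)) {j \<in> {1..k}. \<sigma> (h, j) < i}"
    proof (rule inj_onI)
      fix j j' assume jj: "j \<in> {j \<in> {1..k}. \<sigma> (h, j) < i}" "j' \<in> {j \<in> {1..k}. \<sigma> (h, j) < i}" "\<sigma> (h, j) = \<sigma> (h, j')"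
      have "(h, j) = (h, j')"
        by (rule inj_onD[OF bij_betw_imp_inj_on[OF b] jj(3)]) (use jj assms(3) in auto)
      thus "j = j'" by simp
    qed
    show "(\<lambda>j. \<sigma> (h, j)) ` {j \<in> {1..k}. \<sigma> (h, j) < i} = {m. m < i \<and> string_word n k \<sigma> ! m = h}"
    proof (intro set_eqI iffI)
      fix m assume "m \<in> (\<lambda>j. \<sigma> (h, j)) ` {j \<in> {1..k}. \<sigma> (h, j) < i}"
      then obtain j where j: "j \<in> {1..k}" "\<sigma> (h, j) < i" "m = \<sigma> (h, j)" by auto
      thus "m \<in> {m. m < i \<and> string_word n k \<sigma> ! m = h}"
        using inv[of "(h, j)"] w[of m] assms by auto
    next
      fix m assume m: "m \<in> {m. m < i \<and> string_word n k \<sigma> ! m = h}"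
      hence "m \<in> \<sigma> ` ?J" using b assms by (auto simp: bij_betw_def)
      then obtain h' j where hj: "h' < n" "j \<in> {1..k}" "m = \<sigma> (h', j)" by auto
      hence "h' = h" using inv[of "(h', j)"] w[of m] assms m by auto
      thus "m \<in> (\<lambda>j. \<sigma> (h, j)) ` {j \<in> {1..k}. \<sigma> (h, j) < i}" using hj m by auto
    qed
  qed
  from bij_betw_same_card[OF this] show ?thesis by simp
qed

lemma cyclic_pred:
  fixes n h :: nat
  assumes "h < n"
  shows "(h + n - 1) mod n = (if h = 0 then n - 1 else h - 1)"
proof (cases "h = 0")
  case False
  hence "h + n - 1 = (h - 1) + n" using assms by simp
  thus ?thesis using False assms by (simp only: mod_add_self2) simp
qed (use assms in auto)

lemma all_cyclic_pred:
  fixes n :: nat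
  assumes "n \<ge> 1"
  shows "(\<forall>h<n. Q h ((h + 1) mod n)) \<longleftrightarrow> (\<forall>h<n. Q ((h + n - 1) mod n) h)"
proof -
  have 1: "((h + 1) mod n + n - 1) mod n = h" if "h < n" for h
    using that by (subst cyclic_pred) (cases "h + 1 = n"; simp)+
  have 2: "((h + n - 1) mod n + 1) mod n = h" if "h < n" for h
    using that by (subst cyclic_pred) auto
  have 3: "(h + 1) mod n < n" "(h + n - 1) mod n < n" for h using assms by auto
  show ?thesis
  proof (intro iffI allI impI)
    fix h assume "\<forall>h<n. Q h ((h + 1) mod n)" "h < n"
    thus "Q ((h + n - 1) mod n) h" using 2[of h] 3(2)[of h] by fastforce
  next
    fix h assume "\<forall>h<n. Q ((h + n - 1) mod n) h" "h < n"
    thus "Q h ((h + 1) mod n)" using 1[of h] 3(1)[of h] by fastforce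
  qed
qed

lemma cyclic_pred_neq: "n \<ge> 2 \<Longrightarrow> h < n \<Longrightarrow> (h + n - 1) mod n \<noteq> (h::nat)"
  by (subst cyclic_pred) auto

text \<open>
  Consider a site \<open>g\<close> and the strings \<open>h = g - 1\<close> and
  \<open>g\<close>. If the site is empty at the start, the first chain of inequalities must
  hold, and it says that the number of beads passed on string \<open>h\<close> exceeds that
  on string \<open>g\<close> by 0 or 1 at all times. If the site is occupied at the start,
  the second chain must hold, and the excess is -1 or 0. In both cases this means that the
  occupancy is 0 or 1.
\<close>

lemma interlaced_array_iff_occupancy:
  assumes nk: "n \<ge> 2" "k \<ge> 1" and \<sigma>: "\<sigma> \<in> rankings ({..<n} \<times> {1..k})"
    and mono: "\<And>h i j. h < n \<Longrightarrow> i \<in> {1..k} \<Longrightarrow> j \<in> {1..k} \<Longrightarrow> i < j \<Longrightarrow> \<sigma> (h, i) < \<sigma> (h, j)"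
  shows "interlaced_array n k l \<sigma> \<longleftrightarrow> card (start_set n \<sigma>) = l \<and>
     (\<forall>i\<le>n*k. \<forall>h<n. occupancy n (start_set n \<sigma>) (string_word n k \<sigma>) i h \<in> {0, 1})"
proof -
  let ?J = "{..<n} \<times> {1..k}"
  define c where "c i h = card {j \<in> {1..k}. \<sigma> (h, j) < i}" for i h
  have b: "bij_betw \<sigma> ?J {..<n * k}"
    using rankingsD[OF _ \<sigma>] by (simp add: card_cartesian_product)
  have N: "\<sigma> (h, j) < n * k" if "h < n" "j \<in> {1..k}" for h j
    using b that by (auto simp: bij_betw_def)
  have dist: "\<sigma> (x, i) \<noteq> \<sigma> (g, j)" if "x < n" "g < n" "i \<in> {1..k}" "j \<in> {1..k}" "x \<noteq> g" for x g i j
    using inj_onD[OF bij_betw_imp_inj_on[OF b], of "(x, i)" "(g, j)"] that by auto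
  let ?C = "\<lambda>h g. ((\<forall>j\<in>{1..k}. \<sigma> (h, j) \<le> \<sigma> (g, j)) \<and> (\<forall>j\<in>{1..<k}. \<sigma> (g, j) < \<sigma> (h, j + 1))) \<or>
        ((\<forall>j\<in>{1..k}. \<sigma> (g, j) < \<sigma> (h, j)) \<and> (\<forall>j\<in>{1..<k}. \<sigma> (h, j) \<le> \<sigma> (g, j + 1)))"
  have key: "?C h g \<longleftrightarrow> (\<forall>i\<le>n*k. occupancy n (start_set n \<sigma>) (string_word n k \<sigma>) i g \<in> {0, 1})"
    if g: "g < n" and h: "h = (g + n - 1) mod n" for g h
  proof -
    have hn: "h < n" and hg: "h \<noteq> g" using h g cyclic_pred_neq nk by auto
    have occ: "occupancy n (start_set n \<sigma>) (string_word n k \<sigma>) i g =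
        of_bool (g \<in> start_set n \<sigma>) + int (c i h) - int (c i g)" if "i \<le> n * k" for i
      unfolding occupancy_def h[symmetric] using card_string_word[OF \<sigma> that] hn g by (simp add: c_def)
    have A: "(\<forall>j\<in>{1..k}. \<sigma> (h, j) \<le> \<sigma> (g, j)) \<longleftrightarrow> (\<forall>i\<le>n*k. c i g \<le> c i h)"
      unfolding c_def using mono[OF hn] mono[OF g] N[OF g] by (rule count_mono_iff)
    have B: "(\<forall>j\<in>{1..<k}. \<sigma> (g, j) \<le> \<sigma> (h, j + 1)) \<longleftrightarrow> (\<forall>i\<le>n*k. c i h \<le> c i g + 1)"
      unfolding c_def using mono[OF hn] mono[OF g] N[OF hn] by (rule count_shift_iff)
    have A': "(\<forall>j\<in>{1..k}. \<sigma> (g, j) \<le> \<sigma> (h, j)) \<longleftrightarrow> (\<forall>i\<le>n*k. c i h \<le> c i g)"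
      unfolding c_def using mono[OF g] mono[OF hn] N[OF hn] by (rule count_mono_iff)
    have B': "(\<forall>j\<in>{1..<k}. \<sigma> (h, j) \<le> \<sigma> (g, j + 1)) \<longleftrightarrow> (\<forall>i\<le>n*k. c i g \<le> c i h + 1)"
      unfolding c_def using mono[OF g] mono[OF hn] N[OF g] by (rule count_shift_iff)
    \<comment> \<open>Ranks on different strings are distinct, so strict and weak inequalities agree.\<close>
    have s1: "(\<forall>j\<in>{1..<k}. \<sigma> (g, j) < \<sigma> (h, j + 1)) \<longleftrightarrow> (\<forall>j\<in>{1..<k}. \<sigma> (g, j) \<le> \<sigma> (h, j + 1))"
      using dist[OF g hn] hg by (intro ball_cong refl) (metis One_nat_def Suc_eq_plus1 atLeastAtMost_iff atLeastLessThan_iff le_less less_imp_le_nat Suc_leI le_SucI)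
    have s2: "(\<forall>j\<in>{1..k}. \<sigma> (g, j) < \<sigma> (h, j)) \<longleftrightarrow> (\<forall>j\<in>{1..k}. \<sigma> (g, j) \<le> \<sigma> (h, j))"
      using dist[OF g hn] hg by (intro ball_cong refl) (auto simp: le_less)
    have gS: "g \<in> start_set n \<sigma> \<longleftrightarrow> \<sigma> (g, 1) < \<sigma> (h, 1)"
      using g h by (simp add: start_set_def)
    show ?thesis
    proof (cases "g \<in> start_set n \<sigma>")
      case True
      hence "\<not> (\<forall>j\<in>{1..k}. \<sigma> (h, j) \<le> \<sigma> (g, j))"
        using gS nk by (auto simp: not_le intro!: bexI[of _ 1])
      hence "?C h g \<longleftrightarrow> (\<forall>j\<in>{1..k}. \<sigma> (g, j) \<le> \<sigma> (h, j)) \<and> (\<forall>j\<in>{1..<k}. \<sigma> (h, j) \<le> \<sigma> (g, j + 1))"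
        unfolding s1 s2 by blast
      also have "\<dots> \<longleftrightarrow> (\<forall>i\<le>n*k. c i h \<le> c i g \<and> c i g \<le> c i h + 1)" unfolding A' B' by auto
      also have "\<dots> \<longleftrightarrow> (\<forall>i\<le>n*k. occupancy n (start_set n \<sigma>) (string_word n k \<sigma>) i g \<in> {0, 1})"
        using occ True by (intro all_cong) auto
      finally show ?thesis .
    next
      case False
      hence "\<not> (\<forall>j\<in>{1..k}. \<sigma> (g, j) < \<sigma> (h, j))"
        using gS nk by (auto simp: not_le not_less intro!: bexI[of _ 1])
      hence "?C h g \<longleftrightarrow> (\<forall>j\<in>{1..k}. \<sigma> (h, j) \<le> \<sigma> (g, j)) \<and> (\<forall>j\<in>{1..<k}. \<sigma> (g, j) \<le> \<sigma> (h, j + 1))"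
        unfolding s1 by blast
      also have "\<dots> \<longleftrightarrow> (\<forall>i\<le>n*k. c i g \<le> c i h \<and> c i h \<le> c i g + 1)" unfolding A B by auto
      also have "\<dots> \<longleftrightarrow> (\<forall>i\<le>n*k. occupancy n (start_set n \<sigma>) (string_word n k \<sigma>) i g \<in> {0, 1})"
        using occ False by (intro all_cong) auto
      finally show ?thesis .
    qed
  qed
  have n1: "n \<ge> 1" using nk by simp
  have "(\<forall>h<n. ?C h ((h + 1) mod n)) \<longleftrightarrow> (\<forall>h<n. ?C ((h + n - 1) mod n) h)"
    using n1 by (rule all_cyclic_pred)
  also have "\<dots> \<longleftrightarrow> (\<forall>h<n. \<forall>i\<le>n*k. occupancy n (start_set n \<sigma>) (string_word n k \<sigma>) i h \<in> {0, 1})"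
    by (rule all_cong) (rule key[OF _ refl])
  finally have occ: "(\<forall>h<n. ?C h ((h + 1) mod n)) \<longleftrightarrow>
      (\<forall>h<n. \<forall>i\<le>n*k. occupancy n (start_set n \<sigma>) (string_word n k \<sigma>) i h \<in> {0, 1})" .
  have rows: "(\<forall>h<n. \<forall>i\<in>{1..k}. \<forall>j\<in>{1..k}. i < j \<longrightarrow> \<sigma> (h, i) < \<sigma> (h, j)) = True"
    using mono by simp
  have "interlaced_array n k l \<sigma> \<longleftrightarrow> (\<forall>h<n. ?C h ((h + 1) mod n)) \<and> card (start_set n \<sigma>) = l"
    by (simp only: interlaced_array_def Let_def start_set_def rows simp_thms)
  hence *: "interlaced_array n k l \<sigma> \<longleftrightarrow> card (start_set n \<sigma>) = l \<and> (\<forall>h<n. ?C h ((h + 1) mod n))"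
    by (simp only: conj_commute)
  have comm: "(\<forall>h<n. \<forall>i\<le>n*k. P i h) \<longleftrightarrow> (\<forall>i\<le>n*k. \<forall>h<n. P i h)" for P :: "nat \<Rightarrow> nat \<Rightarrow> bool"
    by blast
  show ?thesis unfolding * occ
    by (subst comm) (rule refl)
qed

lemma rankings_less:
  assumes "\<sigma> \<in> rankings ({..<n} \<times> {1..k})" "h < n" "j \<in> {1..k}"
  shows "\<sigma> (h, j) < n * k"
  using assms by (auto simp: rankings_def PiE_def Pi_def card_cartesian_product)

text \<open>
  The word tells which ranks belong to each string, and within a string the ranks increase.
\<close>

lemma inj_on_string_word:
  assumes "n \<ge> 1"
  shows "inj_on (string_word n k) {\<sigma> \<in> rankings ({..<n} \<times> {1..k}). interlaced_array n k l \<sigma>}"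
proof (rule inj_onI)
  let ?J = "{..<n} \<times> {1..k}"
  have le: "\<sigma> (h, j) \<le> \<sigma>' (h, j)"
    if \<sigma>: "\<sigma> \<in> rankings ?J" "interlaced_array n k l \<sigma>" and \<sigma>': "\<sigma>' \<in> rankings ?J" "interlaced_array n k l \<sigma>'"
      and eq: "string_word n k \<sigma> = string_word n k \<sigma>'" and hj: "h < n" "j \<in> {1..k}" for \<sigma> \<sigma>' h j
  proof -
    have m: "\<sigma> (h, a) < \<sigma> (h, b)" "\<sigma>' (h, a) < \<sigma>' (h, b)" if "a \<in> {1..k}" "b \<in> {1..k}" "a < b" for a b
      using \<sigma>(2) \<sigma>'(2) that hj by (auto simp: interlaced_array_def)
    have N: "Suc (\<sigma>' (h, j)) \<le> n * k"
      using rankings_less[OF \<sigma>'(1) hj] by simp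
    have "j \<le> card {a \<in> {1..k}. \<sigma>' (h, a) < Suc (\<sigma>' (h, j))}"
      using le_count_iff[where t="\<lambda>a. \<sigma>' (h, a)", OF m(2) hj(2)] by simp
    also have "\<dots> = card {a \<in> {1..k}. \<sigma> (h, a) < Suc (\<sigma>' (h, j))}"
      using card_string_word[OF \<sigma>(1) N hj(1)] card_string_word[OF \<sigma>'(1) N hj(1)] eq by simp
    finally show ?thesis using le_count_iff[where t="\<lambda>a. \<sigma> (h, a)", OF m(1) hj(2)] by simp
  qed
  fix \<sigma> \<sigma>'
  assume *: "\<sigma> \<in> {\<sigma> \<in> rankings ?J. interlaced_array n k l \<sigma>}" "\<sigma>' \<in> {\<sigma> \<in> rankings ?J. interlaced_array n k l \<sigma>}"
    "string_word n k \<sigma> = string_word n k \<sigma>'"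
  show "\<sigma> = \<sigma>'"
  proof (rule PiE_ext)
    show "\<sigma> \<in> ?J \<rightarrow>\<^sub>E {..<card ?J}" "\<sigma>' \<in> ?J \<rightarrow>\<^sub>E {..<card ?J}" using * by (auto simp: rankings_def)
    fix p assume p: "p \<in> ?J"
    obtain h j where hj: "p = (h, j)" by fastforce
    show "\<sigma> p = \<sigma>' p"
      using le[of \<sigma> \<sigma>' h j] le[of \<sigma>' \<sigma> h j] * p hj by (intro order_antisym) auto
  qed
qed

lemma string_word_closed_walk:
  assumes nk: "n \<ge> 2" "k \<ge> 1" and \<sigma>: "\<sigma> \<in> rankings ({..<n} \<times> {1..k})" "interlaced_array n k l \<sigma>"
  shows "(start_set n \<sigma>, string_word n k \<sigma>) \<in> closed_walks n l (n * k)"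
proof -
  let ?J = "{..<n} \<times> {1..k}"
  have mono: "\<sigma> (h, i) < \<sigma> (h, j)" if "h < n" "i \<in> {1..k}" "j \<in> {1..k}" "i < j" for h i j
    using \<sigma>(2) that by (auto simp: interlaced_array_def)
  have b: "bij_betw \<sigma> ?J {..<n * k}"
    using rankingsD[OF _ \<sigma>(1)] by (simp add: card_cartesian_product)
  have *: "card (start_set n \<sigma>) = l"
     "\<forall>i\<le>n*k. \<forall>h<n. occupancy n (start_set n \<sigma>) (string_word n k \<sigma>) i h \<in> {0, 1}"
    using interlaced_array_iff_occupancy[OF nk \<sigma>(1) mono] \<sigma>(2) by blast+
  have "set (string_word n k \<sigma>) \<subseteq> {..<n}"
  proof
    fix x assume "x \<in> set (string_word n k \<sigma>)"
    then obtain i where i: "i < n * k" "x = fst (inv_into ?J \<sigma> i)" by (auto simp: string_word_def)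
    hence "inv_into ?J \<sigma> i \<in> ?J" using b by (intro inv_into_into) (auto simp: bij_betw_def)
    thus "x \<in> {..<n}" using i by (simp add: mem_Times_iff)
  qed
  moreover have "occupancy n (start_set n \<sigma>) (string_word n k \<sigma>) (n * k) h = of_bool (h \<in> start_set n \<sigma>)"
    if "h < n" for h
  proof -
    have full: "card {m. m < n * k \<and> string_word n k \<sigma> ! m = g} = k" if "g < n" for g
    proof -
      have "card {m. m < n * k \<and> string_word n k \<sigma> ! m = g} = card {j \<in> {1..k}. \<sigma> (g, j) < n * k}"
        using card_string_word[OF \<sigma>(1) order_refl that] .
      also have "{j \<in> {1..k}. \<sigma> (g, j) < n * k} = {1..k}" using rankings_less[OF \<sigma>(1)] that by auto
      finally show ?thesis by simp
    qed
    have "(h + n - 1) mod n < n" using nk by simp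
    thus ?thesis unfolding occupancy_def using full that by simp
  qed
  moreover have "start_set n \<sigma> \<subseteq> {..<n}" "length (string_word n k \<sigma>) = n * k"
    by (auto simp: start_set_def string_word_def)
  ultimately show ?thesis using * unfolding closed_walks_def by simp
qed

text \<open>
  A walk that returns to its start set has on each site as many arrivals as departures. So
  neighbouring strings, and hence all strings, carry the same number of beads.
\<close>

lemma closed_walk_letter_counts:
  assumes n: "n \<ge> 1" and w: "(S, w) \<in> closed_walks n l (n * k)" and h: "h < n"
  shows "card {m. m < n * k \<and> w ! m = h} = k"
proof -
  define c where "c h = card {m. m < n * k \<and> w ! m = h}" for h
  have step: "c h = c ((h + n - 1) mod n)" if "h < n" for h
    using w that unfolding closed_walks_def occupancy_def c_def by fastforce
  have const: "c h = c 0" if "h < n" for h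
    using that
  proof (induction h)
    case (Suc h)
    have "(Suc h + n - 1) mod n = h" using Suc.prems by (subst cyclic_pred) auto
    thus ?case using step[OF Suc.prems] Suc by simp
  qed simp
  have "n * k = card {..<n * k}" by simp
  also have "{..<n * k} = (\<Union>h<n. {m. m < n * k \<and> w ! m = h})"
  proof (intro set_eqI iffI)
    fix m assume "m \<in> {..<n * k}"
    moreover from this have "w ! m \<in> {..<n}"
      using w nth_mem[of m w] unfolding closed_walks_def by (auto simp del: nth_mem)
    ultimately show "m \<in> (\<Union>h<n. {m. m < n * k \<and> w ! m = h})" by auto
  qed auto
  also have "card \<dots> = (\<Sum>h<n. c h)"
    unfolding c_def by (intro card_UN_disjoint) auto
  also have "\<dots> = (\<Sum>h<n. c 0)" by (intro sum.cong refl const) simp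
  also have "\<dots> = n * c 0" by simp
  finally have "c 0 = k" using n by simp
  thus ?thesis using const[OF h] by (simp add: c_def)
qed

text \<open>
  The array is recovered from the word by taking the position of the \<open>j\<close>-th
  letter \<open>h\<close> as the rank of the \<open>j\<close>-th bead on string
  \<open>h\<close>.
\<close>

lemma closed_walk_is_string_word:
  assumes nk: "n \<ge> 2" "k \<ge> 1" and w: "(S, w) \<in> closed_walks n l (n * k)"
  obtains \<sigma> where "\<sigma> \<in> rankings ({..<n} \<times> {1..k})" "interlaced_array n k l \<sigma>"
    "start_set n \<sigma> = S" "string_word n k \<sigma> = w"
proof -
  let ?J = "{..<n} \<times> {1..k}"
  define A where "A h = {m. m < n * k \<and> w ! m = h}" for h
  define \<sigma> where "\<sigma> = (\<lambda>(h, j)\<in>?J. sorted_list_of_set (A h) ! (j - 1))"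
  have fin: "finite (A h)" for h by (simp add: A_def)
  have card: "card (A h) = k" if "h < n" for h
    using closed_walk_letter_counts[OF _ w that] nk by (simp add: A_def)
  have len: "length (sorted_list_of_set (A h)) = k" if "h < n" for h using card that by simp
  have \<sigma>A: "\<sigma> (h, j) \<in> A h" if "h < n" "j \<in> {1..k}" for h j
  proof -
    have "sorted_list_of_set (A h) ! (j - 1) \<in> set (sorted_list_of_set (A h))"
      using len that by (intro nth_mem) auto
    thus ?thesis using fin that by (simp add: \<sigma>_def)
  qed
  have mono: "\<sigma> (h, i) < \<sigma> (h, j)" if "h < n" "i \<in> {1..k}" "j \<in> {1..k}" "i < j" for h i j
    using sorted_wrt_nth_less[OF strict_sorted_list_of_set[of "A h"], of "i - 1" "j - 1"] that len
    by (auto simp: \<sigma>_def)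
  have inj: "inj_on \<sigma> ?J"
  proof (rule inj_onI)
    fix p q assume "p \<in> ?J" "q \<in> ?J" and eq: "\<sigma> p = \<sigma> q"
    then obtain h i g j where pq: "p = (h, i)" "q = (g, j)" "h < n" "g < n" "i \<in> {1..k}" "j \<in> {1..k}" by auto
    have "h = g" using \<sigma>A[of h i] \<sigma>A[of g j] pq eq by (auto simp: A_def)
    moreover have "i = j" using mono[of h i j] mono[of h j i] pq eq calculation
      by (cases i j rule: linorder_cases) auto
    ultimately show "p = q" using pq by simp
  qed
  have rank: "\<sigma> \<in> rankings ?J"
  proof -
    have "\<sigma> p < n * k" if "p \<in> ?J" for p using that \<sigma>A by (cases p) (auto simp: A_def)
    moreover have "\<sigma> \<in> extensional ?J" by (auto simp: \<sigma>_def)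
    ultimately show ?thesis using inj by (auto simp: rankings_def card_cartesian_product PiE_def)
  qed
  have b: "bij_betw \<sigma> ?J {..<n * k}"
    using rankingsD[OF _ rank] by (simp add: card_cartesian_product)
  have len_w: "length w = n * k" and S: "S \<subseteq> {..<n}" "card S = l"
    and occ: "\<And>i h. i \<le> n * k \<Longrightarrow> h < n \<Longrightarrow> occupancy n S w i h \<in> {0, 1}"
    using w unfolding closed_walks_def by auto
  have word: "string_word n k \<sigma> = w"
  proof (rule nth_equalityI)
    fix m assume "m < length (string_word n k \<sigma>)"
    hence m: "m < n * k" by (simp add: string_word_def)
    hence "m \<in> \<sigma> ` ?J" using b by (simp add: bij_betw_def)
    then obtain h j where hj: "h < n" "j \<in> {1..k}" "m = \<sigma> (h, j)" by auto
    have "inv_into ?J \<sigma> m = (h, j)" using hj inj by (simp add: inv_into_f_f)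
    thus "string_word n k \<sigma> ! m = w ! m" using m \<sigma>A[OF hj(1,2)] hj(3) by (simp add: string_word_def A_def)
  qed (simp add: string_word_def len_w)
  have start: "start_set n \<sigma> = S"
  proof -
    have "h \<in> S \<longleftrightarrow> \<sigma> (h, 1) < \<sigma> (g, 1)" if h: "h < n" and g: "g = (h + n - 1) mod n" for h g
    proof -
      have gn: "g < n" and gh: "g \<noteq> h" using g h nk cyclic_pred_neq by auto
      have ne: "\<sigma> (h, 1) \<noteq> \<sigma> (g, 1)" using inj_onD[OF inj, of "(h, 1)" "(g, 1)"] gn h gh nk by auto
      have cnt: "1 \<le> card {m. m < i \<and> w ! m = x} \<longleftrightarrow> \<sigma> (x, 1) < i" if "i \<le> n * k" "x < n" for i x
        using le_count_iff[where t="\<lambda>j. \<sigma> (x, j)" and j=1, OF mono[OF that(2)]] nk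
          card_string_word[OF rank that] by (simp add: word)
      have lt: "Suc (\<sigma> (x, 1)) \<le> n * k" if "x < n" for x
        using \<sigma>A[OF that, of 1] nk by (simp add: A_def)
      have occ': "of_bool (h \<in> S) + int (card {m. m < i \<and> w ! m = g}) - int (card {m. m < i \<and> w ! m = h}) \<in> {0, 1}"
        if "i \<le> n * k" for i
        using occ[OF that h] unfolding occupancy_def g .
      show ?thesis
      proof (cases "h \<in> S")
        case True
        \<comment> \<open>The site is occupied from the start, so at any time at least as many particles have left it as have arrived.\<close>
        have "card {m. m < Suc (\<sigma> (g, 1)) \<and> w ! m = g} \<le> card {m. m < Suc (\<sigma> (g, 1)) \<and> w ! m = h}"
          using occ'[OF lt[OF gn]] True by auto
        hence "1 \<le> card {m. m < Suc (\<sigma> (g, 1)) \<and> w ! m = h}"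
          using cnt[OF lt[OF gn] gn] by simp
        thus ?thesis using cnt[OF lt[OF gn] h] True ne by simp
      next
        case False
        have "card {m. m < Suc (\<sigma> (h, 1)) \<and> w ! m = h} \<le> card {m. m < Suc (\<sigma> (h, 1)) \<and> w ! m = g}"
          using occ'[OF lt[OF h]] False by auto
        hence "1 \<le> card {m. m < Suc (\<sigma> (h, 1)) \<and> w ! m = g}"
          using cnt[OF lt[OF h] h] by simp
        thus ?thesis using cnt[OF lt[OF h] gn] False by simp
      qed
    qed
    thus ?thesis using S by (auto simp: start_set_def)
  qed
  have "interlaced_array n k l \<sigma>"
    using interlaced_array_iff_occupancy[OF nk rank mono] occ S unfolding start word by blast
  thus ?thesis using that rank start word by blast
qed

lemma card_interlaced_rankings:
  assumes nk: "n \<ge> 2" "k \<ge> 1"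
  shows "card {\<sigma> \<in> rankings ({..<n} \<times> {1..k}). interlaced_array n k l \<sigma>} = card (closed_walks n l (n * k))"
proof (rule bij_betw_same_card)
  let ?R = "{\<sigma> \<in> rankings ({..<n} \<times> {1..k}). interlaced_array n k l \<sigma>}"
  show "bij_betw (\<lambda>\<sigma>. (start_set n \<sigma>, string_word n k \<sigma>)) ?R (closed_walks n l (n * k))"
    unfolding bij_betw_def
  proof
    show "inj_on (\<lambda>\<sigma>. (start_set n \<sigma>, string_word n k \<sigma>)) ?R"
      by (rule inj_onI) (use inj_onD[OF inj_on_string_word[of n k l]] nk in auto)
    show "(\<lambda>\<sigma>. (start_set n \<sigma>, string_word n k \<sigma>)) ` ?R = closed_walks n l (n * k)"
    proof
      show "(\<lambda>\<sigma>. (start_set n \<sigma>, string_word n k \<sigma>)) ` ?R \<subseteq> closed_walks n l (n * k)"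
        using string_word_closed_walk[OF nk] by auto
      show "closed_walks n l (n * k) \<subseteq> (\<lambda>\<sigma>. (start_set n \<sigma>, string_word n k \<sigma>)) ` ?R"
      proof
        fix p assume "p \<in> closed_walks n l (n * k)"
        then obtain S w where p: "p = (S, w)" "(S, w) \<in> closed_walks n l (n * k)" by (cases p) auto
        from closed_walk_is_string_word[OF nk p(2)] p(1)
        show "p \<in> (\<lambda>\<sigma>. (start_set n \<sigma>, string_word n k \<sigma>)) ` ?R" by (metis (mono_tags, lifting) image_eqI mem_Collect_eq)
      qed
    qed
  qed
qed

text \<open>
  For \<open>n = 1\<close> the two ends of a jump coincide; hence the bound on
  \<open>n\<close>.
\<close>

lemma bead_vol_eq_card_closed_walks:
  assumes "n \<ge> 2" "k \<ge> 1"
  shows "bead_vol n k l = card (closed_walks n l (n * k)) / fact (n * k)"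
  using bead_vol_eq_card_rankings[of n k l] card_interlaced_rankings[OF assms, of l] assms by simp

section \<open>Alternating sums over permutations\<close>

text \<open>
  The determinant of the matrix with entries \<open>u (z i) (x j)\<close>. The Leibniz sum
  is used because \<open>l\<close> is a variable and because the arguments are manipulated
  as functions.
\<close>

definition alternant :: "nat \<Rightarrow> ('a \<Rightarrow> 'b \<Rightarrow> complex) \<Rightarrow> (nat \<Rightarrow> 'a) \<Rightarrow> (nat \<Rightarrow> 'b) \<Rightarrow> complex" where
  "alternant l u z x = (\<Sum>\<pi> | \<pi> permutes {..<l}. of_int (sign \<pi>) * (\<Prod>i<l. u (z i) (x (\<pi> i))))"

lemma alternant_transpose: "alternant l u z x = alternant l (\<lambda>b a. u a b) x z"
proof -
  have "alternant l u z x = (\<Sum>\<pi> | \<pi> permutes {..<l}. of_int (sign (inv \<pi>)) * (\<Prod>i<l. u (z i) (x (inv \<pi> i))))"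
    unfolding alternant_def by (rule sum_permutations_inverse)
  also have "\<dots> = (\<Sum>\<pi> | \<pi> permutes {..<l}. of_int (sign \<pi>) * (\<Prod>i<l. u (z (\<pi> i)) (x i)))"
  proof (intro sum.cong refl)
    fix \<pi> assume "\<pi> \<in> {\<pi>. \<pi> permutes {..<l}}"
    hence p: "\<pi> permutes {..<l}" by simp
    have "(\<Prod>i<l. u (z i) (x (inv \<pi> i))) = (\<Prod>i<l. u (z (\<pi> i)) (x (inv \<pi> (\<pi> i))))"
      by (rule prod.permute[OF p, of "\<lambda>i. u (z i) (x (inv \<pi> i))", unfolded comp_def])
    also have "\<dots> = (\<Prod>i<l. u (z (\<pi> i)) (x i))" using permutes_inverses(2)[OF p] by simp
    finally show "of_int (sign (inv \<pi>)) * (\<Prod>i<l. u (z i) (x (inv \<pi> i))) = of_int (sign \<pi>) * (\<Prod>i<l. u (z (\<pi> i)) (x i))"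
      using p by (simp add: sign_inverse permutes_imp_permutation[OF finite_lessThan])
  qed
  finally show ?thesis by (simp add: alternant_def)
qed

lemma alternant_permute:
  assumes "\<sigma> permutes {..<l}"
  shows "alternant l u z (x \<circ> \<sigma>) = of_int (sign \<sigma>) * alternant l u z x"
proof -
  have "alternant l u z x = (\<Sum>\<pi> | \<pi> permutes {..<l}. of_int (sign (\<sigma> \<circ> \<pi>)) * (\<Prod>i<l. u (z i) (x ((\<sigma> \<circ> \<pi>) i))))"
    unfolding alternant_def by (rule setum_permutations_compose_left[OF assms])
  also have "\<dots> = (\<Sum>\<pi> | \<pi> permutes {..<l}. of_int (sign \<sigma>) * (of_int (sign \<pi>) * (\<Prod>i<l. u (z i) ((x \<circ> \<sigma>) (\<pi> i)))))"
    using assms by (intro sum.cong refl) (simp add: sign_compose permutes_imp_permutation[OF finite_lessThan])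
  also have "\<dots> = of_int (sign \<sigma>) * alternant l u z (x \<circ> \<sigma>)"
    by (simp add: alternant_def sum_distrib_left)
  finally have "of_int (sign \<sigma>) * alternant l u z x = of_int (sign \<sigma> * sign \<sigma>) * alternant l u z (x \<circ> \<sigma>)"
    by (simp only: of_int_mult mult.assoc)
  thus ?thesis by (simp only: sign_idempotent of_int_1 mult_1)
qed

lemma alternant_eq_0:
  assumes "a < l" "b < l" "a \<noteq> b" "x a = x b"
  shows "alternant l u z x = 0"
proof -
  let ?t = "Transposition.transpose a b"
  have x: "x \<circ> ?t = x" using assms by (auto simp: fun_eq_iff Transposition.transpose_def)
  have s: "sign ?t = -1" using assms by (simp add: sign_swap_id)
  have perm: "?t permutes {..<l}" using assms by (simp add: permutes_swap_id)
  have "alternant l u z x = of_int (-1) * alternant l u z x"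
    using alternant_permute[OF perm, of u z x] unfolding x s .
  moreover have "c = of_int (-1) * c \<Longrightarrow> c = 0" for c :: complex
    by (simp add: eq_neg_iff_add_eq_0 flip: mult_2)
  ultimately show ?thesis by blast
qed

lemma alternant_cong:
  assumes "\<And>i. i < l \<Longrightarrow> x i = y i"
  shows "alternant l u z x = alternant l u z y"
  unfolding alternant_def
proof (rule sum.cong[OF refl])
  fix \<pi> assume "\<pi> \<in> {\<pi>. \<pi> permutes {..<l}}"
  hence "\<pi> i < l" if "i < l" for i using permutes_in_image[of \<pi> "{..<l}" i] that by simp
  hence "(\<Prod>i<l. u (z i) (x (\<pi> i))) = (\<Prod>i<l. u (z i) (y (\<pi> i)))"
    using assms by (intro prod.cong refl) simp
  thus "of_int (sign \<pi>) * (\<Prod>i<l. u (z i) (x (\<pi> i))) = of_int (sign \<pi>) * (\<Prod>i<l. u (z i) (y (\<pi> i)))" by simp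
qed

text \<open>
  A form of the Cauchy-Binet identity: the sum over tuples factorises along the coordinates,
  and one of the two permutations can be absorbed into the other, which gives the factor
  \<open>fact l\<close>.
\<close>

lemma sum_alternant_mult_cnj:
  assumes X: "finite X"
  shows "(\<Sum>x\<in>{..<l} \<rightarrow>\<^sub>E X. alternant l u z x * cnj (alternant l u z' x)) =
    fact l * (\<Sum>\<pi> | \<pi> permutes {..<l}. of_int (sign \<pi>) * (\<Prod>i<l. \<Sum>t\<in>X. u (z i) t * cnj (u (z' (\<pi> i)) t)))"
proof -
  let ?P = "{\<pi>. \<pi> permutes {..<l}}"
  define G where "G a b = (\<Sum>t\<in>X. u a t * cnj (u b t))" for a b
  have fin: "finite ?P" by (simp add: finite_permutations)
  have alt: "alternant l u w x = (\<Sum>\<pi>\<in>?P. of_int (sign \<pi>) * (\<Prod>i<l. u (w (\<pi> i)) (x i)))" for w x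
    by (subst alternant_transpose) (simp add: alternant_def)
  have "(\<Sum>x\<in>{..<l} \<rightarrow>\<^sub>E X. alternant l u z x * cnj (alternant l u z' x)) =
     (\<Sum>x\<in>{..<l} \<rightarrow>\<^sub>E X. \<Sum>\<pi>\<in>?P. \<Sum>\<rho>\<in>?P. of_int (sign \<pi>) * of_int (sign \<rho>) *
        (\<Prod>i<l. u (z (\<pi> i)) (x i) * cnj (u (z' (\<rho> i)) (x i))))"
    unfolding alt by (simp add: sum_product cnj_sum cnj_prod prod.distrib mult_ac)
  also have "\<dots> = (\<Sum>\<pi>\<in>?P. \<Sum>\<rho>\<in>?P. of_int (sign \<pi>) * of_int (sign \<rho>) *
        (\<Sum>x\<in>{..<l} \<rightarrow>\<^sub>E X. \<Prod>i<l. u (z (\<pi> i)) (x i) * cnj (u (z' (\<rho> i)) (x i))))"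
    by (subst sum.swap, intro sum.cong refl, subst sum.swap) (simp add: sum_distrib_left)
  also have "\<dots> = (\<Sum>\<pi>\<in>?P. \<Sum>\<rho>\<in>?P. of_int (sign \<pi>) * of_int (sign \<rho>) * (\<Prod>i<l. G (z (\<pi> i)) (z' (\<rho> i))))"
    unfolding G_def using X by (simp add: prod_sum_PiE)
  also have "\<dots> = (\<Sum>\<pi>\<in>?P. \<Sum>\<rho>\<in>?P. of_int (sign \<rho>) * (\<Prod>i<l. G (z i) (z' (\<rho> i))))"
  proof (rule sum.cong[OF refl])
    fix \<pi> assume "\<pi> \<in> ?P"
    hence p: "\<pi> permutes {..<l}" by simp
    have "(\<Sum>\<rho>\<in>?P. of_int (sign \<pi>) * of_int (sign \<rho>) * (\<Prod>i<l. G (z (\<pi> i)) (z' (\<rho> i)))) =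
       (\<Sum>\<rho>\<in>?P. of_int (sign \<pi>) * of_int (sign (\<rho> \<circ> \<pi>)) * (\<Prod>i<l. G (z (\<pi> i)) (z' ((\<rho> \<circ> \<pi>) i))))"
      by (rule sum_permutations_compose_right[OF p])
    also have "\<dots> = (\<Sum>\<rho>\<in>?P. of_int (sign \<rho>) * (\<Prod>i<l. G (z i) (z' (\<rho> i))))"
    proof (intro sum.cong refl)
      fix \<rho> assume "\<rho> \<in> ?P"
      hence r: "\<rho> permutes {..<l}" by simp
      have "of_int (sign \<pi>) * of_int (sign (\<rho> \<circ> \<pi>)) = (of_int (sign \<rho>) :: complex)"
        using p r sign_idempotent[of \<pi>]
        by (simp add: sign_compose permutes_imp_permutation[OF finite_lessThan] mult.left_commute flip: of_int_mult)
      moreover have "(\<Prod>i<l. G (z (\<pi> i)) (z' ((\<rho> \<circ> \<pi>) i))) = (\<Prod>i<l. G (z i) (z' (\<rho> i)))"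
        using prod.permute[OF p, of "\<lambda>i. G (z i) (z' (\<rho> i))"] by (simp add: comp_def)
      ultimately show "of_int (sign \<pi>) * of_int (sign (\<rho> \<circ> \<pi>)) * (\<Prod>i<l. G (z (\<pi> i)) (z' ((\<rho> \<circ> \<pi>) i))) =
          of_int (sign \<rho>) * (\<Prod>i<l. G (z i) (z' (\<rho> i)))" by simp
    qed
    finally show "(\<Sum>\<rho>\<in>?P. of_int (sign \<pi>) * of_int (sign \<rho>) * (\<Prod>i<l. G (z (\<pi> i)) (z' (\<rho> i)))) =
      (\<Sum>\<rho>\<in>?P. of_int (sign \<rho>) * (\<Prod>i<l. G (z i) (z' (\<rho> i))))" .
  qed
  also have "\<dots> = fact l * (\<Sum>\<rho>\<in>?P. of_int (sign \<rho>) * (\<Prod>i<l. G (z i) (z' (\<rho> i))))"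
    by (simp add: card_permutations)
  finally show ?thesis unfolding G_def .
qed

text \<open>
  Each set with \<open>l\<close> elements is the range of \<open>fact l\<close> injective
  tuples.
\<close>

lemma sum_inj_tuples:
  fixes g :: "'a set \<Rightarrow> complex"
  assumes X: "finite X"
  shows "(\<Sum>x | x \<in> {..<l} \<rightarrow>\<^sub>E X \<and> inj_on x {..<l}. g (x ` {..<l})) = fact l * (\<Sum>S | S \<subseteq> X \<and> card S = l. g S)"
proof -
  let ?A = "{x. x \<in> {..<l} \<rightarrow>\<^sub>E X \<and> inj_on x {..<l}}" and ?B = "{S. S \<subseteq> X \<and> card S = l}"
  have finA: "finite ?A" using X by (intro finite_subset[of ?A "{..<l} \<rightarrow>\<^sub>E X"] finite_PiE) auto
  have finB: "finite ?B" using X by (intro finite_subset[of ?B "Pow X"]) auto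
  have "(\<Sum>x\<in>?A. g (x ` {..<l})) = (\<Sum>S\<in>?B. \<Sum>x\<in>{x\<in>?A. x ` {..<l} = S}. g (x ` {..<l}))"
  proof (rule sum.group[OF finA finB, symmetric])
    show "(\<lambda>x. x ` {..<l}) ` ?A \<subseteq> ?B" by (fastforce simp: card_image)
  qed
  also have "\<dots> = (\<Sum>S\<in>?B. fact l * g S)"
  proof (intro sum.cong refl)
    fix S assume S: "S \<in> ?B"
    have finS: "finite S" using S X finite_subset by blast
    have "{x\<in>?A. x ` {..<l} = S} = {x \<in> {..<l} \<rightarrow>\<^sub>E S. inj_on x {..<l}}"
    proof (intro set_eqI iffI)
      fix x assume "x \<in> {x\<in>?A. x ` {..<l} = S}"
      thus "x \<in> {x \<in> {..<l} \<rightarrow>\<^sub>E S. inj_on x {..<l}}" by (auto simp: PiE_def)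
    next
      fix x assume x: "x \<in> {x \<in> {..<l} \<rightarrow>\<^sub>E S. inj_on x {..<l}}"
      have "x ` {..<l} = S" using x S finS by (intro card_subset_eq) (auto simp: card_image)
      thus "x \<in> {x\<in>?A. x ` {..<l} = S}" using x S by (auto simp: PiE_def)
    qed
    moreover have "card {x \<in> {..<l} \<rightarrow>\<^sub>E S. inj_on x {..<l}} = fact l"
      using card_inj_on_subset_funcset[of "{..<l}" S "{..<l}"] finS S by (simp add: fact_prod_rev)
    moreover have "(\<Sum>x\<in>{x\<in>?A. x ` {..<l} = S}. g (x ` {..<l})) = (\<Sum>x\<in>{x\<in>?A. x ` {..<l} = S}. g S)"
      by (intro sum.cong) auto
    ultimately show "(\<Sum>x\<in>{x\<in>?A. x ` {..<l} = S}. g (x ` {..<l})) = fact l * g S" by simp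
  qed
  finally show ?thesis by (simp add: sum_distrib_left)
qed

section \<open>Walks of particles with exclusion\<close>

definition hop :: "nat \<Rightarrow> nat \<Rightarrow> nat set \<Rightarrow> nat set" where
  "hop n h S = insert (Suc h mod n) (S - {h})"

fun walks :: "nat \<Rightarrow> nat \<Rightarrow> nat set \<Rightarrow> nat set \<Rightarrow> nat" where
  "walks n 0 S T = of_bool (S = T)"
| "walks n (Suc N) S T = (\<Sum>h | h \<in> S \<and> Suc h mod n \<notin> S. walks n N (hop n h S) T)"

text \<open>
  The same walks as in \<open>closed_walks\<close>, but with an arbitrary final set, as
  needed for an induction on the number of jumps.
\<close>

definition walk_words :: "nat \<Rightarrow> nat \<Rightarrow> nat set \<Rightarrow> nat set \<Rightarrow> nat list set" where
  "walk_words n N S T = {w. length w = N \<and> set w \<subseteq> {..<n} \<and>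
     (\<forall>i\<le>N. \<forall>h<n. occupancy n S w i h \<in> {0, 1}) \<and> (\<forall>h<n. occupancy n S w N h = of_bool (h \<in> T))}"

lemma card_letter_Cons:
  "card {m. m < Suc i \<and> (a # w) ! m = h} = of_bool (a = h) + card {m. m < i \<and> w ! m = h}"
proof -
  have "{m. m < Suc i \<and> (a # w) ! m = h} = (if a = h then {0} else {}) \<union> Suc ` {m. m < i \<and> w ! m = h}"
  proof (intro set_eqI)
    fix m show "m \<in> {m. m < Suc i \<and> (a # w) ! m = h} \<longleftrightarrow>
        m \<in> (if a = h then {0} else {}) \<union> Suc ` {m. m < i \<and> w ! m = h}"
      by (cases m) auto
  qed
  moreover have "card \<dots> = card (if a = h then {0::nat} else {}) + card (Suc ` {m. m < i \<and> w ! m = h})"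
    by (intro card_Un_disjoint) auto
  ultimately show ?thesis by (simp add: card_image)
qed

lemma cyclic_pred_eq_iff:
  assumes "h < n" "a < n"
  shows "(h + n - 1) mod n = a \<longleftrightarrow> h = Suc a mod n"
  using assms by (subst cyclic_pred) (auto simp: mod_Suc)

lemma hop_subset: "n \<ge> 1 \<Longrightarrow> S \<subseteq> {..<n} \<Longrightarrow> hop n h S \<subseteq> {..<n}"
  by (auto simp: hop_def)

lemma card_hop: "finite S \<Longrightarrow> h \<in> S \<Longrightarrow> Suc h mod n \<notin> S \<Longrightarrow> card (hop n h S) = card S"
  unfolding hop_def by (subst card_insert_disjoint) (use card_Suc_Diff1[of S h] in auto)

lemma occupancy_Cons:
  assumes "n \<ge> 2" "a < n" "h < n" "a \<in> S" "Suc a mod n \<notin> S"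
  shows "occupancy n S (a # w) (Suc i) h = occupancy n (hop n a S) w i h"
proof -
  have "of_bool (h \<in> hop n a S) = (of_bool (h \<in> S) + of_bool (a = (h + n - 1) mod n) - of_bool (a = h) :: int)"
    using assms cyclic_pred_eq_iff[OF assms(3,2)] cyclic_pred_neq[OF assms(1,3)] by (auto simp: hop_def)
  thus ?thesis by (simp add: occupancy_def card_letter_Cons)
qed

text \<open>
  After the first jump the occupancies of its two ends are 0 or 1 only if the jump leads
  from an occupied site to an empty one. The remaining word is then a walk from the new set.
\<close>

lemma walk_words_Suc:
  assumes n: "n \<ge> 2" and S: "S \<subseteq> {..<n}"
  shows "walk_words n (Suc N) S T =
     (\<Union>a\<in>{h. h \<in> S \<and> Suc h mod n \<notin> S}. (#) a ` walk_words n N (hop n a S) T)"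
proof (intro set_eqI iffI)
  fix w assume w: "w \<in> walk_words n (Suc N) S T"
  then obtain a v where wv: "w = a # v" "length v = N" "a < n" "set v \<subseteq> {..<n}"
    by (cases w) (auto simp: walk_words_def)
  have occ: "occupancy n S (a # v) i h \<in> {0, 1}" if "i \<le> Suc N" "h < n" for i h
    using w that unfolding walk_words_def wv by blast
  have o1: "occupancy n S (a # v) (Suc 0) h = of_bool (h \<in> S) + of_bool (a = (h + n - 1) mod n) - of_bool (a = h)" for h
    unfolding occupancy_def card_letter_Cons by simp
  have "a \<in> S" using occ[of "Suc 0" a] cyclic_pred_neq[OF n wv(3)] wv(3)
    by (cases "a \<in> S") (auto simp: o1 split: if_splits)
  moreover have "Suc a mod n \<notin> S"
  proof -
    have lt: "Suc a mod n < n" using n by simp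
    have "(Suc a mod n + n - 1) mod n = a" using cyclic_pred_eq_iff[OF lt wv(3)] by simp
    moreover from this have "a \<noteq> Suc a mod n" using cyclic_pred_neq[OF n lt] by auto
    ultimately show ?thesis using occ[of "Suc 0" "Suc a mod n"] lt by (auto simp: o1 split: if_splits)
  qed
  moreover have "v \<in> walk_words n N (hop n a S) T"
  proof -
    have "occupancy n (hop n a S) v i h \<in> {0, 1}" if "i \<le> N" "h < n" for i h
      using occ[of "Suc i" h] that occupancy_Cons[OF n wv(3) that(2) calculation] by simp
    moreover have "occupancy n (hop n a S) v N h = of_bool (h \<in> T)" if "h < n" for h
    proof -
      have "occupancy n S w (Suc N) h = of_bool (h \<in> T)" using w that by (simp add: walk_words_def)
      thus ?thesis using occupancy_Cons[OF n wv(3) that \<open>a \<in> S\<close> \<open>Suc a mod n \<notin> S\<close>] wv(1) by simp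
    qed
    ultimately show ?thesis using wv unfolding walk_words_def by simp
  qed
  ultimately show "w \<in> (\<Union>a\<in>{h. h \<in> S \<and> Suc h mod n \<notin> S}. (#) a ` walk_words n N (hop n a S) T)"
    using wv(1) by blast
next
  fix w assume "w \<in> (\<Union>a\<in>{h. h \<in> S \<and> Suc h mod n \<notin> S}. (#) a ` walk_words n N (hop n a S) T)"
  then obtain a v where a: "a \<in> S" "Suc a mod n \<notin> S" and v: "v \<in> walk_words n N (hop n a S) T" "w = a # v" by auto
  have an: "a < n" using a S by auto
  have "occupancy n S (a # v) i h \<in> {0, 1}" if "i \<le> Suc N" "h < n" for i h
  proof (cases i)
    case 0 thus ?thesis by (simp add: occupancy_def)
  next
    case (Suc i')
    thus ?thesis using v(1) that occupancy_Cons[OF n an that(2) a] by (simp add: walk_words_def)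
  qed
  moreover have "occupancy n S (a # v) (Suc N) h = of_bool (h \<in> T)" if "h < n" for h
    using v(1) that occupancy_Cons[OF n an that a] by (simp add: walk_words_def)
  ultimately show "w \<in> walk_words n (Suc N) S T"
    using v an unfolding walk_words_def by simp
qed

lemma finite_walk_words: "finite (walk_words n N S T)"
  by (rule finite_subset[OF _ finite_lists_length_eq[of "{..<n}" N]]) (auto simp: walk_words_def)

lemma card_walk_words:
  assumes n: "n \<ge> 2" and "S \<subseteq> {..<n}" and T: "T \<subseteq> {..<n}"
  shows "card (walk_words n N S T) = walks n N S T"
  using assms(2)
proof (induction N arbitrary: S)
  case 0
  have "walk_words n 0 S T = (if S = T then {[]} else {})"
    using 0 T by (auto simp: walk_words_def occupancy_def)
  thus ?case by simp
next
  case (Suc N)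
  let ?A = "{h. h \<in> S \<and> Suc h mod n \<notin> S}"
  have finA: "finite ?A" using Suc.prems finite_subset by fastforce
  have "card (walk_words n (Suc N) S T) = card (\<Union>a\<in>?A. (#) a ` walk_words n N (hop n a S) T)"
    by (simp only: walk_words_Suc[OF n Suc.prems])
  also have "\<dots> = (\<Sum>a\<in>?A. card ((#) a ` walk_words n N (hop n a S) T))"
    using finA finite_walk_words by (intro card_UN_disjoint) auto
  also have "\<dots> = (\<Sum>a\<in>?A. walks n N (hop n a S) T)"
    using Suc.IH hop_subset[OF _ Suc.prems] n by (intro sum.cong refl) (simp add: card_image)
  finally show ?case by simp
qed

lemma card_closed_walks_eq_sum_walks:
  assumes "n \<ge> 2"
  shows "card (closed_walks n l N) = (\<Sum>S | S \<subseteq> {..<n} \<and> card S = l. walks n N S S)"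
proof -
  have "closed_walks n l N = (SIGMA S:{S. S \<subseteq> {..<n} \<and> card S = l}. walk_words n N S S)"
    unfolding closed_walks_def walk_words_def by blast
  moreover have "finite {S. S \<subseteq> {..<n} \<and> card S = l}" by (rule finite_subset[of _ "Pow {..<n}"]) auto
  ultimately show ?thesis using assms finite_walk_words
    by (simp add: card_walk_words)
qed

section \<open>Slater determinants and the number of closed walks\<close>

text \<open>
  The \<open>n\<close> solutions of \<open>z ^ n = (- 1) ^ (l + 1)\<close>. This boundary
  sign compensates for the cyclic permutation of the \<open>l\<close> particles that occurs
  when one of them passes from site \<open>n - 1\<close> to site 0. The numbering is such
  that the nodes with numbers below \<open>l\<close> form an arc symmetric about 1.
\<close>

definition node :: "nat \<Rightarrow> nat \<Rightarrow> nat \<Rightarrow> complex" where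
  "node n l j = cis (pi * (2 * real j - real l + 1) / real n)"

lemma node_power_n:
  assumes "n \<ge> 1"
  shows "node n l j ^ n = (- 1) ^ (l + 1)"
proof -
  have cn: "cis (real m * pi) = (- 1) ^ m" for m
    by (metis Complex.DeMoivre cis_pi)
  have "node n l j ^ n = cis (real (2 * j + 1) * pi - real l * pi)"
    unfolding node_def Complex.DeMoivre using assms by (intro arg_cong[where f=cis]) (simp add: field_simps)
  also have "\<dots> = cis (real (2 * j + 1) * pi) / cis (real l * pi)" by (simp only: cis_divide)
  also have "\<dots> = (- 1) ^ (2 * j + 1) / (- 1) ^ l" unfolding cn ..
  also have "\<dots> = (- 1) ^ (l + 1)" by (cases "even l") auto
  finally show ?thesis .
qed

lemma sum_roots_of_unity:
  assumes "s < n" "t < n"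
  shows "(\<Sum>j<n. cis (2 * pi * (real s - real t) / real n) ^ j) = (if s = t then of_nat n else 0)"
proof (cases "s = t")
  case False
  let ?w = "cis (2 * pi * (real s - real t) / real n)"
  have w: "?w = cis (2 * pi * real s / n) / cis (2 * pi * real t / n)"
    unfolding cis_divide by (intro arg_cong[where f=cis]) (simp add: field_simps diff_divide_distrib)
  have "cis (2 * pi * real s / n) \<noteq> cis (2 * pi * real t / n)"
    using complex_root_unity_eq[of n s t] assms False by (simp add: cis_conv_exp mult_ac)
  hence "?w \<noteq> 1" using w by auto
  moreover have "?w ^ n = 1"
  proof -
    have c: "cis (2 * pi * real m) = 1" for m by (simp add: cis_multiple_2pi)
    have "?w ^ n = cis (2 * pi * real s - 2 * pi * real t)"
      unfolding Complex.DeMoivre using assms by (intro arg_cong[where f=cis]) (simp add: field_simps)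
    also have "\<dots> = cis (2 * pi * real s) / cis (2 * pi * real t)" by (simp only: cis_divide)
    finally show ?thesis by (simp add: c)
  qed
  ultimately show ?thesis using False by (simp add: geometric_sum)
qed simp

lemma node_mult_cnj: "node n l i * cnj (node n l j) = cis (2 * pi * (real i - real j) / real n)"
  unfolding node_def cis_cnj cis_mult
  by (intro arg_cong[where f=cis]) (simp add: field_simps add_divide_distrib diff_divide_distrib)

lemma sum_node_powers_exponent:
  assumes "i < n" "j < n"
  shows "(\<Sum>t<n. node n l i ^ t * cnj (node n l j ^ t)) = (if i = j then of_nat n else 0)"
proof -
  have "node n l i ^ t * cnj (node n l j ^ t) = cis (2 * pi * (real i - real j) / real n) ^ t" for t
    by (simp only: complex_cnj_power power_mult_distrib[symmetric] node_mult_cnj)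
  thus ?thesis using sum_roots_of_unity[OF assms] by simp
qed

lemma sum_node_powers_index:
  assumes "s < n" "t < n"
  shows "(\<Sum>j<n. node n l j ^ s * cnj (node n l j ^ t)) = (if s = t then of_nat n else 0)"
proof -
  define c where "c = cis (pi * (1 - real l) * (real s - real t) / n)"
  have "node n l j ^ s * cnj (node n l j ^ t) = c * cis (2 * pi * (real s - real t) / real n) ^ j" for j
    unfolding node_def c_def Complex.DeMoivre cis_cnj cis_mult
    by (intro arg_cong[where f=cis]) (simp add: field_simps add_divide_distrib diff_divide_distrib)
  hence "(\<Sum>j<n. node n l j ^ s * cnj (node n l j ^ t)) = c * (\<Sum>j<n. cis (2 * pi * (real s - real t) / real n) ^ j)"
    by (simp add: sum_distrib_left)
  thus ?thesis using sum_roots_of_unity[OF assms] by (simp add: c_def)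
qed

definition slater :: "nat \<Rightarrow> nat \<Rightarrow> (nat \<Rightarrow> nat) \<Rightarrow> (nat \<Rightarrow> nat) \<Rightarrow> complex" where
  "slater n l z x = alternant l (\<lambda>j t. node n l j ^ t) z x"

definition elem :: "nat set \<Rightarrow> nat \<Rightarrow> nat" where
  "elem S i = sorted_list_of_set S ! i"

lemma elem_eqI:
  assumes "\<And>i j. i < j \<Longrightarrow> j < l \<Longrightarrow> y i < y j" "y ` {..<l} = S" "i < l"
  shows "elem S i = y i"
proof -
  have "sorted_wrt (<) (map y [0..<l])"
    unfolding sorted_wrt_map by (rule sorted_wrt_mono_rel[OF _ sorted_wrt_upt]) (use assms(1) in auto)
  hence "sorted (map y [0..<l])" "distinct (map y [0..<l])" using strict_sorted_iff by blast+
  moreover have "set (map y [0..<l]) = S" using assms(2) by (simp add: atLeast0LessThan)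
  ultimately have "sorted_list_of_set S = map y [0..<l]"
    using sorted_list_of_set.idem_if_sorted_distinct by blast
  thus ?thesis using assms(3) by (simp add: elem_def)
qed

lemma
  assumes "finite S" "card S = l"
  shows elem_less: "i < j \<Longrightarrow> j < l \<Longrightarrow> elem S i < elem S j" and elem_image: "elem S ` {..<l} = S"
proof -
  show "i < j \<Longrightarrow> j < l \<Longrightarrow> elem S i < elem S j"
    using sorted_wrt_nth_less[OF strict_sorted_list_of_set[of S]] assms by (simp add: elem_def)
  have "elem S ` {..<l} = set (sorted_list_of_set S)"
    unfolding elem_def set_conv_nth using assms by auto
  thus "elem S ` {..<l} = S" using assms by simp
qed

lemma inj_on_elem: "finite S \<Longrightarrow> card S = l \<Longrightarrow> inj_on (elem S) {..<l}"
  by (metis card_lessThan elem_image eq_card_imp_inj_on finite_lessThan)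

text \<open>
  In the Leibniz sum, raising the exponent at the place \<open>a\<close> yields the power of
  the node that the permutation pairs with \<open>a\<close>.
\<close>

lemma prod_power_update:
  fixes v :: "nat \<Rightarrow> complex"
  assumes p: "\<pi> permutes {..<l}" and a: "a < l"
  shows "(\<Prod>i<l. v i ^ ((x(a := x a + d)) (\<pi> i))) = v (inv \<pi> a) ^ d * (\<Prod>i<l. v i ^ x (\<pi> i))"
proof -
  have eq: "\<pi> i = a \<longleftrightarrow> i = inv \<pi> a" for i using permutes_inv_eq[OF p, of a i] by auto
  have "(\<Prod>i<l. v i ^ ((x(a := x a + d)) (\<pi> i))) = (\<Prod>i<l. (if i = inv \<pi> a then v i ^ d else 1) * v i ^ x (\<pi> i))"
    by (intro prod.cong refl) (auto simp: power_add eq[symmetric])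
  also have "\<dots> = (\<Prod>i<l. if i = inv \<pi> a then v i ^ d else 1) * (\<Prod>i<l. v i ^ x (\<pi> i))"
    by (rule prod.distrib)
  also have "(\<Prod>i<l. if i = inv \<pi> a then v i ^ d else 1) = v (inv \<pi> a) ^ d"
    using permutes_in_image[OF permutes_inv[OF p], of a] a by simp
  finally show ?thesis .
qed

lemma slater_wrap:
  assumes "n \<ge> 1" "a < l"
  shows "slater n l z (x(a := x a + n)) = (- 1) ^ (l + 1) * slater n l z x"
  unfolding slater_def alternant_def sum_distrib_left
proof (rule sum.cong[OF refl])
  fix \<pi> assume "\<pi> \<in> {\<pi>. \<pi> permutes {..<l}}"
  hence p: "\<pi> permutes {..<l}" by simp
  show "of_int (sign \<pi>) * (\<Prod>i<l. node n l (z i) ^ ((x(a := x a + n)) (\<pi> i))) =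
      (- 1) ^ (l + 1) * (of_int (sign \<pi>) * (\<Prod>i<l. node n l (z i) ^ x (\<pi> i)))"
    unfolding prod_power_update[OF p assms(2), of "\<lambda>i. node n l (z i)"] node_power_n[OF assms(1)]
    by (simp only: mult_ac)
qed

text \<open>
  In each term of the Leibniz sum the node that is multiplied in runs through all
  \<open>l\<close> nodes as \<open>a\<close> varies, so the factor is the same for all
  terms.
\<close>

lemma sum_slater_shift:
  "(\<Sum>a<l. slater n l z (x(a := Suc (x a)))) = (\<Sum>i<l. node n l (z i)) * slater n l z x"
proof -
  let ?v = "\<lambda>i. node n l (z i)"
  have "(\<Sum>a<l. slater n l z (x(a := Suc (x a)))) =
     (\<Sum>\<pi> | \<pi> permutes {..<l}. \<Sum>a<l. of_int (sign \<pi>) * (\<Prod>i<l. ?v i ^ ((x(a := x a + 1)) (\<pi> i))))"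
    unfolding slater_def alternant_def by (subst sum.swap) simp
  also have "\<dots> = (\<Sum>\<pi> | \<pi> permutes {..<l}. (\<Sum>i<l. ?v i) * (of_int (sign \<pi>) * (\<Prod>i<l. ?v i ^ x (\<pi> i))))"
  proof (rule sum.cong[OF refl])
    fix \<pi> assume "\<pi> \<in> {\<pi>. \<pi> permutes {..<l}}"
    hence p: "\<pi> permutes {..<l}" by simp
    have "(\<Sum>a<l. of_int (sign \<pi>) * (\<Prod>i<l. ?v i ^ ((x(a := x a + 1)) (\<pi> i)))) =
        (\<Sum>a<l. ?v (inv \<pi> a) * (of_int (sign \<pi>) * (\<Prod>i<l. ?v i ^ x (\<pi> i))))"
    proof (rule sum.cong[OF refl])
      fix a assume "a \<in> {..<l}"
      thus "of_int (sign \<pi>) * (\<Prod>i<l. ?v i ^ ((x(a := x a + 1)) (\<pi> i))) =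
          ?v (inv \<pi> a) * (of_int (sign \<pi>) * (\<Prod>i<l. ?v i ^ x (\<pi> i)))"
        using prod_power_update[OF p, of a ?v x 1] by (simp del: fun_upd_apply)
    qed
    also have "\<dots> = (\<Sum>a<l. ?v (inv \<pi> a)) * (of_int (sign \<pi>) * (\<Prod>i<l. ?v i ^ x (\<pi> i)))"
      by (rule sum_distrib_right[symmetric])
    also have "(\<Sum>a<l. ?v (inv \<pi> a)) = (\<Sum>i<l. ?v i)"
      using sum.permute[OF permutes_inv[OF p], of ?v] by (simp add: comp_def)
    finally show "(\<Sum>a<l. of_int (sign \<pi>) * (\<Prod>i<l. ?v i ^ ((x(a := x a + 1)) (\<pi> i)))) =
      (\<Sum>i<l. ?v i) * (of_int (sign \<pi>) * (\<Prod>i<l. ?v i ^ x (\<pi> i)))" .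
  qed
  also have "\<dots> = (\<Sum>i<l. ?v i) * slater n l z x"
    by (simp add: slater_def alternant_def sum_distrib_left)
  finally show ?thesis .
qed

text \<open>
  The cyclic permutation \<open>0 \<rightarrow> 1 \<rightarrow> \<dots> \<rightarrow> m
  \<rightarrow> 0\<close>.
\<close>

definition rot :: "nat \<Rightarrow> nat \<Rightarrow> nat" where
  "rot m i = (if i < m then Suc i else if i = m then 0 else i)"

lemma rot_permutes_sign: "rot m permutes {..m} \<and> sign (rot m) = (- 1) ^ m"
proof (induction m)
  case 0
  have "rot 0 = id" by (auto simp: rot_def fun_eq_iff)
  thus ?case by (simp add: id_def[symmetric] permutes_id sign_id del: id_apply)
next
  case (Suc m)
  have eq: "rot (Suc m) = Transposition.transpose 0 (Suc m) \<circ> rot m"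
    by (auto simp: rot_def fun_eq_iff Transposition.transpose_def)
  have p: "rot m permutes {..Suc m}" using Suc by (auto intro: permutes_subset)
  have t: "Transposition.transpose 0 (Suc m) permutes {..Suc m}" by (rule permutes_swap_id) auto
  have "sign (rot (Suc m)) = - sign (rot m)"
    unfolding eq by (subst sign_compose)
      (use p t in \<open>auto simp: sign_swap_id intro: permutes_imp_permutation[OF finite_atMost]\<close>)
  moreover have "rot (Suc m) permutes {..Suc m}" using permutes_compose[OF p t] by (simp only: eq)
  ultimately show ?case using Suc by simp
qed

lemma slater_permute:
  "\<sigma> permutes {..<l} \<Longrightarrow> slater n l z (x \<circ> \<sigma>) = of_int (sign \<sigma>) * slater n l z x"
  unfolding slater_def by (rule alternant_permute)

lemma slater_eq_0: "a < l \<Longrightarrow> b < l \<Longrightarrow> a \<noteq> b \<Longrightarrow> x a = x b \<Longrightarrow> slater n l z x = 0"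
  unfolding slater_def by (rule alternant_eq_0)

lemma slater_cong: "(\<And>i. i < l \<Longrightarrow> x i = y i) \<Longrightarrow> slater n l z x = slater n l z y"
  unfolding slater_def by (rule alternant_cong)

text \<open>
  If the target site is occupied, the determinant has two equal arguments and vanishes:
  exclusion is automatic. If the target is empty and the jump does not cross the boundary,
  the arguments remain sorted. If the jump leads from \<open>n - 1\<close> to 0, sorting the
  arguments takes a cyclic permutation, and its sign cancels the boundary sign of the nodes.
\<close>

lemma slater_shift_eq_hop:
  assumes n: "n \<ge> 2" and S: "S \<subseteq> {..<n}" "card S = l" and a: "a < l"
  shows "slater n l z ((elem S)(a := Suc (elem S a))) =
    (if Suc (elem S a) mod n \<in> S then 0 else slater n l z (elem (hop n (elem S a) S)))"
proof -
  let ?x = "elem S"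
  have fin: "finite S" using S finite_subset by blast
  note less = elem_less[OF fin S(2)] and img = elem_image[OF fin S(2)]
  have xn: "?x i < n" if "i < l" for i using img S that by auto
  have inj: "?x i = ?x j \<longleftrightarrow> i = j" if "i < l" "j < l" for i j
    using inj_on_elem[OF fin S(2)] that by (auto simp: inj_on_def)
  show ?thesis
  proof (cases "Suc (?x a) < n")
    case True
    hence md: "Suc (?x a) mod n = Suc (?x a)" by simp
    show ?thesis
    proof (cases "Suc (?x a) \<in> S")
      case in_S: True
      then obtain b where b: "b < l" "Suc (?x a) = ?x b" using img by (metis imageE lessThan_iff)
      hence "b \<noteq> a" by auto
      hence "slater n l z (?x(a := Suc (?x a))) = 0" using slater_eq_0[OF a b(1), of "?x(a := Suc (?x a))"] b by simp
      thus ?thesis using in_S md by simp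
    next
      case False
      let ?y = "?x(a := Suc (?x a))"
      have "elem (hop n (?x a) S) i = ?y i" if "i < l" for i
      proof (rule elem_eqI[OF _ _ that])
        show "?y ` {..<l} = hop n (?x a) S"
        proof -
          have "?y ` {..<l} = insert (Suc (?x a)) (?x ` ({..<l} - {a}))" using a by auto
          also have "?x ` ({..<l} - {a}) = S - {?x a}"
            using img inj_on_image_set_diff[OF inj_on_elem[OF fin S(2)], of "{..<l}" "{a}"] a by simp
          finally show ?thesis by (simp add: hop_def md)
        qed
        fix i j assume ij: "i < j" "j < l"
        show "?y i < ?y j"
        proof (cases "i = a")
          case True
          have "?x i < ?x j" using less ij by blast
          moreover have "Suc (?x a) \<noteq> ?x j" using False img ij by auto
          ultimately show ?thesis using True ij by simp
        next
          case False thus ?thesis using less[OF ij] by auto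
        qed
      qed
      thus ?thesis using False md slater_cong by (metis (no_types, lifting))
    qed
  next
    case False
    hence top: "Suc (?x a) = n" using xn[OF a] by simp
    hence md: "Suc (?x a) mod n = 0" by simp
    have wrap: "slater n l z (?x(a := Suc (?x a))) = (- 1) ^ (l + 1) * slater n l z (?x(a := 0))"
      using slater_wrap[OF _ a, of n z "?x(a := 0)"] n top by simp
    show ?thesis
    proof (cases "0 \<in> S")
      case True
      then obtain b where b: "b < l" "0 = ?x b" using img by (metis imageE lessThan_iff)
      have "b \<noteq> a" using b top n by auto
      hence "slater n l z (?x(a := 0)) = 0" using slater_eq_0[OF a b(1), of "?x(a := 0)"] b by simp
      thus ?thesis using wrap md True by simp
    next
      case False
      have al: "a = l - 1"
      proof (rule ccontr)
        assume "a \<noteq> l - 1"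
        hence "?x a < ?x (l - 1)" "l - 1 < l" using less[of a "l - 1"] a by auto
        thus False using xn[of "l - 1"] top by simp
      qed
      let ?y = "\<lambda>i. if i = 0 then 0 else ?x (i - 1)"
      have hop: "elem (hop n (?x a) S) i = ?y i" if "i < l" for i
      proof (rule elem_eqI[OF _ _ that])
        show "?y ` {..<l} = hop n (?x a) S"
        proof -
          have "{..<l} = insert 0 (Suc ` {..<l - 1})" using a by (metis Suc_pred' gr_implies_not0 lessThan_Suc_eq_insert_0 not_gr_zero)
          hence "?y ` {..<l} = ?y ` insert 0 (Suc ` {..<l - 1})" by (rule arg_cong)
          also have "\<dots> = insert (?y 0) (?y ` Suc ` {..<l - 1})" by (rule image_insert)
          also have "?y ` Suc ` {..<l - 1} = ?x ` {..<l - 1}" unfolding image_image by simp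
          also have "?y 0 = 0" by simp
          also have "{..<l - 1} = {..<l} - {a}" using a al by auto
          also have "?x ` ({..<l} - {a}) = S - {?x a}"
            using img inj_on_image_set_diff[OF inj_on_elem[OF fin S(2)], of "{..<l}" "{a}"] a by simp
          finally show ?thesis by (simp add: hop_def md)
        qed
        fix i j assume ij: "i < j" "j < l"
        show "?y i < ?y j"
        proof (cases "i = 0")
          case True
          have "?x (j - 1) \<in> S" using img ij by auto
          hence "?x (j - 1) \<noteq> 0" using False by metis
          thus ?thesis using True ij by simp
        next
          case False thus ?thesis using less[of "i - 1" "j - 1"] ij by auto
        qed
      qed
      have perm: "rot (l - 1) permutes {..<l}" "sign (rot (l - 1)) = (- 1) ^ (l - 1)"
        using rot_permutes_sign[of "l - 1"] a by (auto simp: lessThan_Suc_atMost[symmetric])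
      have "slater n l z (?x(a := 0)) = slater n l z (?y \<circ> rot (l - 1))"
        by (rule slater_cong) (use al in \<open>auto simp: rot_def\<close>)
      also have "\<dots> = of_int (sign (rot (l - 1))) * slater n l z ?y" by (rule slater_permute[OF perm(1)])
      also have "slater n l z ?y = slater n l z (elem (hop n (?x a) S))"
        by (rule slater_cong) (simp add: hop)
      finally have f: "slater n l z (?x(a := 0)) =
          of_int (sign (rot (l - 1))) * slater n l z (elem (hop n (?x a) S))" .
      have "slater n l z (?x(a := Suc (?x a))) =
          ((- 1) ^ (l + 1) * (- 1) ^ (l - 1)) * slater n l z (elem (hop n (?x a) S))"
        by (simp only: wrap f perm(2) of_int_power of_int_minus of_int_1 mult.assoc)
      also have "(- 1) ^ (l + 1) * (- 1) ^ (l - 1) = (1 :: complex)"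
        using a by (cases l) (auto simp flip: power_add)
      finally show ?thesis using md False by (simp del: fun_upd_apply)
    qed
  qed
qed

text \<open>
  The eigenvalue equation for the hopping operator. The blocked jumps may be added to the
  sum because their determinants vanish.
\<close>

lemma sum_slater_hop:
  assumes n: "n \<ge> 2" and S: "S \<subseteq> {..<n}" "card S = l"
  shows "(\<Sum>h | h \<in> S \<and> Suc h mod n \<notin> S. slater n l z (elem (hop n h S))) =
     (\<Sum>i<l. node n l (z i)) * slater n l z (elem S)"
proof -
  have fin: "finite S" using S finite_subset by blast
  have bij: "bij_betw (elem S) {..<l} S"
    using inj_on_elem[OF fin S(2)] elem_image[OF fin S(2)] by (simp add: bij_betw_def)
  have "(\<Sum>i<l. node n l (z i)) * slater n l z (elem S) = (\<Sum>a<l. slater n l z ((elem S)(a := Suc (elem S a))))"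
    by (rule sum_slater_shift[symmetric])
  also have "\<dots> = (\<Sum>a<l. if Suc (elem S a) mod n \<in> S then 0 else slater n l z (elem (hop n (elem S a) S)))"
    using slater_shift_eq_hop[OF n S] by (intro sum.cong refl) simp
  also have "\<dots> = (\<Sum>h\<in>S. if Suc h mod n \<in> S then 0 else slater n l z (elem (hop n h S)))"
    by (rule sum.reindex_bij_betw[OF bij])
  also have "\<dots> = (\<Sum>h | h \<in> S \<and> Suc h mod n \<notin> S. slater n l z (elem (hop n h S)))"
    using fin by (intro sum.mono_neutral_cong_right) auto
  finally show ?thesis ..
qed

text \<open>
  Only the identity permutation contributes.
\<close>

lemma sum_sign_prod_delta:
  assumes "inj_on x {..<l}"
  shows "(\<Sum>\<pi> | \<pi> permutes {..<l}. of_int (sign \<pi>) * (\<Prod>i<l. if x i = x (\<pi> i) then c else 0)) = (c :: complex) ^ l"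
proof -
  have "(\<Sum>\<pi> | \<pi> permutes {..<l}. of_int (sign \<pi>) * (\<Prod>i<l. if x i = x (\<pi> i) then c else 0)) =
        (\<Sum>\<pi>\<in>{id}. of_int (sign \<pi>) * (\<Prod>i<l. if x i = x (\<pi> i) then c else 0))"
  proof (rule sum.mono_neutral_right)
    show "\<forall>\<pi>\<in>{\<pi>. \<pi> permutes {..<l}} - {id}. of_int (sign \<pi>) * (\<Prod>i<l. if x i = x (\<pi> i) then c else 0) = 0"
    proof
      fix \<pi> :: "nat \<Rightarrow> nat" assume "\<pi> \<in> {\<pi>. \<pi> permutes {..<l}} - {id}"
      hence p: "\<pi> permutes {..<l}" "\<pi> \<noteq> id" by auto
      then obtain i where i: "\<pi> i \<noteq> i" by (auto simp: fun_eq_iff)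
      hence il: "i < l" using p permutes_not_in by fastforce
      hence "\<pi> i < l" using permutes_in_image[OF p(1), of i] by simp
      hence "x i \<noteq> x (\<pi> i)" using assms il i by (auto simp: inj_on_def)
      hence "\<exists>i\<in>{..<l}. (if x i = x (\<pi> i) then c else 0) = 0" using il by auto
      thus "of_int (sign \<pi>) * (\<Prod>i<l. if x i = x (\<pi> i) then c else 0) = 0" by simp
    qed
  qed (auto simp: finite_permutations permutes_id)
  thus ?thesis by (simp add: sign_id)
qed

text \<open>
  Completeness of the Slater determinants, inherited from the orthogonality of the columns
  of the matrix of node powers.
\<close>

lemma sum_slater_index:
  assumes "S \<subseteq> {..<n}" "card S = l" "T \<subseteq> {..<n}" "card T = l"
  shows "(\<Sum>z\<in>{..<l} \<rightarrow>\<^sub>E {..<n}. slater n l z (elem S) * cnj (slater n l z (elem T))) =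
     of_nat n ^ l * fact l * of_bool (S = T)"
proof -
  have fin: "finite S" "finite T" using assms finite_subset by blast+
  note img = elem_image[OF fin(1) assms(2)] elem_image[OF fin(2) assms(4)]
  have lt: "elem S i < n" "elem T i < n" if "i < l" for i using img assms that by auto
  let ?d = "\<lambda>\<pi>. (\<Prod>i<l. if elem S i = elem T (\<pi> i) then of_nat n else 0 :: complex)"
  have "(\<Sum>z\<in>{..<l} \<rightarrow>\<^sub>E {..<n}. slater n l z (elem S) * cnj (slater n l z (elem T))) =
    fact l * (\<Sum>\<pi> | \<pi> permutes {..<l}. of_int (sign \<pi>) *
      (\<Prod>i<l. \<Sum>j<n. node n l j ^ elem S i * cnj (node n l j ^ elem T (\<pi> i))))"
    unfolding slater_def
    by (subst (1 2) alternant_transpose) (rule sum_alternant_mult_cnj[OF finite_lessThan])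
  also have "(\<Sum>\<pi> | \<pi> permutes {..<l}. of_int (sign \<pi>) *
      (\<Prod>i<l. \<Sum>j<n. node n l j ^ elem S i * cnj (node n l j ^ elem T (\<pi> i)))) =
      (\<Sum>\<pi> | \<pi> permutes {..<l}. of_int (sign \<pi>) * ?d \<pi>)"
  proof (rule sum.cong[OF refl])
    fix \<pi> assume "\<pi> \<in> {\<pi>. \<pi> permutes {..<l}}"
    hence "\<pi> i < l" if "i < l" for i using permutes_in_image[of \<pi> "{..<l}" i] that by simp
    hence "(\<Prod>i<l. \<Sum>j<n. node n l j ^ elem S i * cnj (node n l j ^ elem T (\<pi> i))) = ?d \<pi>"
      using lt sum_node_powers_index by (intro prod.cong refl) simp
    thus "of_int (sign \<pi>) * (\<Prod>i<l. \<Sum>j<n. node n l j ^ elem S i * cnj (node n l j ^ elem T (\<pi> i))) =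
       of_int (sign \<pi>) * ?d \<pi>" by simp
  qed
  also have "\<dots> = of_nat n ^ l * of_bool (S = T)"
  proof (cases "S = T")
    case True
    thus ?thesis using sum_sign_prod_delta[OF inj_on_elem[OF fin(1) assms(2)], of "of_nat n"] by simp
  next
    case False
    have "?d \<pi> = 0" if p: "\<pi> permutes {..<l}" for \<pi>
    proof (rule ccontr)
      assume "?d \<pi> \<noteq> 0"
      hence "elem S i = elem T (\<pi> i)" if "i < l" for i using that by (auto split: if_splits)
      hence "elem S ` {..<l} = elem T ` \<pi> ` {..<l}" unfolding image_image by (intro image_cong) auto
      thus False using False img permutes_image[OF p] by simp
    qed
    hence "(\<Sum>\<pi> | \<pi> permutes {..<l}. of_int (sign \<pi>) * ?d \<pi>) = 0"
      by (intro sum.neutral ballI) (simp only: mem_Collect_eq mult_zero_right)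
    thus ?thesis using False by (simp only: of_bool_eq if_False mult_zero_right)
  qed
  finally show ?thesis by simp
qed

text \<open>
  The spectral expansion of the \<open>N\<close>-th power of the hopping operator:
  completeness is the case \<open>N = 0\<close>, and each further jump contributes one
  factor of the eigenvalue.
\<close>

lemma walks_eq_sum_slater:
  assumes n: "n \<ge> 2" and "S \<subseteq> {..<n}" "card S = l" and T: "T \<subseteq> {..<n}" "card T = l"
  shows "of_nat n ^ l * fact l * of_nat (walks n N S T) =
    (\<Sum>z\<in>{..<l} \<rightarrow>\<^sub>E {..<n}. (\<Sum>i<l. node n l (z i)) ^ N * slater n l z (elem S) * cnj (slater n l z (elem T)))"
  using assms(2,3)
proof (induction N arbitrary: S)
  case 0
  thus ?case using sum_slater_index[OF _ _ T] by simp
next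
  case (Suc N)
  let ?A = "{h. h \<in> S \<and> Suc h mod n \<notin> S}" and ?Z = "{..<l} \<rightarrow>\<^sub>E {..<n}"
  let ?e = "\<lambda>z. \<Sum>i<l. node n l (z i)"
  have fin: "finite S" using Suc.prems finite_subset by blast
  have "of_nat n ^ l * fact l * of_nat (walks n (Suc N) S T) =
     (\<Sum>h\<in>?A. of_nat n ^ l * fact l * of_nat (walks n N (hop n h S) T))"
    by (simp add: sum_distrib_left)
  also have "\<dots> = (\<Sum>h\<in>?A. \<Sum>z\<in>?Z. ?e z ^ N * slater n l z (elem (hop n h S)) * cnj (slater n l z (elem T)))"
    using Suc.IH hop_subset[OF _ Suc.prems(1)] card_hop[OF fin] Suc.prems(2) n by (intro sum.cong refl) auto
  also have "\<dots> = (\<Sum>z\<in>?Z. \<Sum>h\<in>?A. ?e z ^ N * slater n l z (elem (hop n h S)) * cnj (slater n l z (elem T)))"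
    by (rule sum.swap)
  also have "\<dots> = (\<Sum>z\<in>?Z. ?e z ^ N * (\<Sum>h\<in>?A. slater n l z (elem (hop n h S))) * cnj (slater n l z (elem T)))"
    by (simp add: sum_distrib_left sum_distrib_right)
  also have "\<dots> = (\<Sum>z\<in>?Z. ?e z ^ Suc N * slater n l z (elem S) * cnj (slater n l z (elem T)))"
    unfolding sum_slater_hop[OF n Suc.prems] by (simp only: power_Suc mult_ac)
  finally show ?case .
qed

lemma inj_tuple_elem:
  assumes "inj_on x {..<l}"
  shows "\<exists>\<sigma>. \<sigma> permutes {..<l} \<and> (\<forall>i<l. x i = elem (x ` {..<l}) (\<sigma> i))"
proof -
  let ?S = "x ` {..<l}"
  have c: "finite ?S" "card ?S = l" using assms by (auto simp: card_image)
  have b: "bij_betw (elem ?S) {..<l} ?S" "bij_betw x {..<l} ?S"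
    using inj_on_elem[OF c] elem_image[OF c] assms by (auto simp: bij_betw_def)
  define \<sigma> where "\<sigma> i = (if i < l then inv_into {..<l} (elem ?S) (x i) else i)" for i
  have "bij_betw (inv_into {..<l} (elem ?S) \<circ> x) {..<l} {..<l}"
    using bij_betw_trans[OF b(2) bij_betw_inv_into[OF b(1)]] .
  hence "bij_betw \<sigma> {..<l} {..<l}" by (rule bij_betw_cong[THEN iffD1, rotated]) (auto simp: \<sigma>_def)
  hence "\<sigma> permutes {..<l}" by (rule bij_imp_permutes) (auto simp: \<sigma>_def)
  moreover have "x i = elem ?S (\<sigma> i)" if "i < l" for i
    using b(1) that by (simp add: \<sigma>_def f_inv_into_f bij_betw_def)
  ultimately show ?thesis by blast
qed

lemma slater_not_inj: "\<not> inj_on z {..<l} \<Longrightarrow> slater n l z x = 0"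
  unfolding slater_def
  by (subst alternant_transpose) (auto simp: inj_on_def intro: alternant_eq_0)

lemma slater_norm_image:
  assumes "inj_on x {..<l}"
  shows "slater n l z x * cnj (slater n l z x) =
    slater n l z (elem (x ` {..<l})) * cnj (slater n l z (elem (x ` {..<l})))"
proof -
  obtain \<sigma> where \<sigma>: "\<sigma> permutes {..<l}" "\<forall>i<l. x i = elem (x ` {..<l}) (\<sigma> i)"
    using inj_tuple_elem[OF assms] by blast
  have "slater n l z x = slater n l z (elem (x ` {..<l}) \<circ> \<sigma>)" using \<sigma>(2) by (intro slater_cong) simp
  hence "slater n l z x = of_int (sign \<sigma>) * slater n l z (elem (x ` {..<l}))" using slater_permute[OF \<sigma>(1)] by simp
  moreover have "of_int (sign \<sigma>) * of_int (sign \<sigma>) = (1 :: complex)"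
    by (simp only: of_int_mult[symmetric] sign_idempotent of_int_1)
  ultimately show ?thesis by (simp add: mult_ac)
qed

text \<open>
  The normalisation that is needed for the trace. It follows from the sum over all tuples,
  to which every set of sites contributes \<open>fact l\<close> equal terms.
\<close>

lemma sum_slater_norm:
  assumes z: "z \<in> {..<l} \<rightarrow>\<^sub>E {..<n}"
  shows "(\<Sum>S | S \<subseteq> {..<n} \<and> card S = l. slater n l z (elem S) * cnj (slater n l z (elem S))) =
    (if inj_on z {..<l} then of_nat n ^ l else 0)"
proof (cases "inj_on z {..<l}")
  case True
  have zn: "z i < n" if "i < l" for i using z that by (auto simp: PiE_def Pi_def)
  let ?g = "\<lambda>S. slater n l z (elem S) * cnj (slater n l z (elem S))"
  have fin: "finite ({..<l} \<rightarrow>\<^sub>E {..<n})" by (intro finite_PiE) auto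
  have "fact l * (\<Sum>S | S \<subseteq> {..<n} \<and> card S = l. ?g S) =
      (\<Sum>x | x \<in> {..<l} \<rightarrow>\<^sub>E {..<n} \<and> inj_on x {..<l}. ?g (x ` {..<l}))"
    by (rule sum_inj_tuples[symmetric]) simp
  also have "\<dots> = (\<Sum>x | x \<in> {..<l} \<rightarrow>\<^sub>E {..<n} \<and> inj_on x {..<l}. slater n l z x * cnj (slater n l z x))"
    using slater_norm_image by (intro sum.cong refl) simp
  also have "\<dots> = (\<Sum>x\<in>{..<l} \<rightarrow>\<^sub>E {..<n}. slater n l z x * cnj (slater n l z x))"
  proof (rule sum.mono_neutral_left[OF fin])
    have "slater n l z x = 0" if "\<not> inj_on x {..<l}" for x
      using that slater_eq_0[of _ l _ x n z] by (auto simp: inj_on_def)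
    thus "\<forall>x\<in>({..<l} \<rightarrow>\<^sub>E {..<n}) - {x. x \<in> {..<l} \<rightarrow>\<^sub>E {..<n} \<and> inj_on x {..<l}}.
        slater n l z x * cnj (slater n l z x) = 0" by simp
  qed auto
  also have "\<dots> = fact l * (\<Sum>\<pi> | \<pi> permutes {..<l}. of_int (sign \<pi>) *
      (\<Prod>i<l. \<Sum>t<n. node n l (z i) ^ t * cnj (node n l (z (\<pi> i)) ^ t)))"
    unfolding slater_def by (rule sum_alternant_mult_cnj) simp
  also have "(\<Sum>\<pi> | \<pi> permutes {..<l}. of_int (sign \<pi>) *
      (\<Prod>i<l. \<Sum>t<n. node n l (z i) ^ t * cnj (node n l (z (\<pi> i)) ^ t))) =
      (\<Sum>\<pi> | \<pi> permutes {..<l}. of_int (sign \<pi>) * (\<Prod>i<l. if z i = z (\<pi> i) then of_nat n else 0))"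
  proof (rule sum.cong[OF refl])
    fix \<pi> assume "\<pi> \<in> {\<pi>. \<pi> permutes {..<l}}"
    hence "\<pi> i < l" if "i < l" for i using permutes_in_image[of \<pi> "{..<l}" i] that by simp
    hence "(\<Prod>i<l. \<Sum>t<n. node n l (z i) ^ t * cnj (node n l (z (\<pi> i)) ^ t)) =
        (\<Prod>i<l. if z i = z (\<pi> i) then of_nat n else 0)"
      using zn sum_node_powers_exponent by (intro prod.cong refl) simp
    thus "of_int (sign \<pi>) * (\<Prod>i<l. \<Sum>t<n. node n l (z i) ^ t * cnj (node n l (z (\<pi> i)) ^ t)) =
       of_int (sign \<pi>) * (\<Prod>i<l. if z i = z (\<pi> i) then of_nat n else 0)" by simp
  qed
  also have "\<dots> = of_nat n ^ l" by (rule sum_sign_prod_delta[OF True])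
  finally show ?thesis using True by simp
qed (simp add: slater_not_inj)

text \<open>
  The left side is the trace of the \<open>N\<close>-th power of the hopping operator, the
  right side the sum of the powers of its eigenvalues. Tuples with a repeated node drop out,
  and each set of nodes stems from \<open>fact l\<close> tuples.
\<close>

theorem card_closed_walks:
  assumes n: "n \<ge> 2"
  shows "of_nat (card (closed_walks n l N)) = (\<Sum>I | I \<subseteq> {..<n} \<and> card I = l. (\<Sum>j\<in>I. node n l j) ^ N)"
proof -
  let ?L = "{S. S \<subseteq> {..<n} \<and> card S = l}" and ?Z = "{..<l} \<rightarrow>\<^sub>E {..<n}"
  let ?e = "\<lambda>z. \<Sum>i<l. node n l (z i)"
  have fin: "finite ?Z" by (intro finite_PiE) auto
  \<comment> \<open>A closed walk is counted at its start set, so the sum over the sets is a trace.\<close>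
  have "of_nat n ^ l * fact l * of_nat (card (closed_walks n l N)) =
      (\<Sum>S\<in>?L. of_nat n ^ l * fact l * of_nat (walks n N S S))"
    by (simp add: card_closed_walks_eq_sum_walks[OF n] sum_distrib_left)
  also have "\<dots> = (\<Sum>S\<in>?L. \<Sum>z\<in>?Z. ?e z ^ N * slater n l z (elem S) * cnj (slater n l z (elem S)))"
    using walks_eq_sum_slater[OF n] by (intro sum.cong refl) simp
  also have "\<dots> = (\<Sum>z\<in>?Z. \<Sum>S\<in>?L. ?e z ^ N * slater n l z (elem S) * cnj (slater n l z (elem S)))"
    by (rule sum.swap)
  also have "\<dots> = (\<Sum>z\<in>?Z. ?e z ^ N * (\<Sum>S\<in>?L. slater n l z (elem S) * cnj (slater n l z (elem S))))"
    by (simp add: sum_distrib_left mult.assoc)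
  also have "\<dots> = (\<Sum>z\<in>?Z. ?e z ^ N * (if inj_on z {..<l} then of_nat n ^ l else 0))"
    using sum_slater_norm by (intro sum.cong refl) simp
  also have "\<dots> = (\<Sum>z | z \<in> ?Z \<and> inj_on z {..<l}. of_nat n ^ l * (\<Sum>j\<in>z ` {..<l}. node n l j) ^ N)"
    using fin by (intro sum.mono_neutral_cong_right) (auto simp: sum.reindex)
  also have "\<dots> = of_nat n ^ l * (\<Sum>z | z \<in> ?Z \<and> inj_on z {..<l}. (\<Sum>j\<in>z ` {..<l}. node n l j) ^ N)"
    by (simp add: sum_distrib_left)
  also have "(\<Sum>z | z \<in> ?Z \<and> inj_on z {..<l}. (\<Sum>j\<in>z ` {..<l}. node n l j) ^ N) =
      fact l * (\<Sum>I\<in>?L. (\<Sum>j\<in>I. node n l j) ^ N)"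
    by (rule sum_inj_tuples) simp
  finally have "(of_nat n ^ l * fact l) * of_nat (card (closed_walks n l N)) =
      (of_nat n ^ l * fact l) * (\<Sum>I\<in>?L. (\<Sum>j\<in>I. node n l j) ^ N)" by (simp only: mult.assoc)
  moreover have "(of_nat n ^ l * fact l :: complex) \<noteq> 0" using n by simp
  ultimately show ?thesis by (simp only: mult_cancel_left) simp
qed

section \<open>Partitions and Frobenius coordinates\<close>

text \<open>
  The Frobenius coordinates of a partition: the arms and the legs of the cells on the
  diagonal of its diagram.
\<close>

definition frobenius_pairs :: "(nat set \<times> nat set) set" where
  "frobenius_pairs = {(A, B). finite A \<and> finite B \<and> card A = card B}"

text \<open>
  The hook of a diagonal cell with arm \<open>a\<close> and leg \<open>b\<close> has
  \<open>a + b + 1\<close> cells.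
\<close>

definition frobenius_size :: "nat set \<times> nat set \<Rightarrow> nat" where
  "frobenius_size = (\<lambda>(A, B). \<Sum>A + \<Sum>B + card A)"

text \<open>
  Partitions of \<open>m\<close> into at most \<open>L\<close> parts, filled up with zeros.
\<close>

definition weak_lists :: "nat \<Rightarrow> nat \<Rightarrow> nat list set" where
  "weak_lists L m = {xs. length xs = L \<and> sorted xs \<and> sum_list xs = m}"

lemma size_le_sum_mset: "0 \<notin># M \<Longrightarrow> size M \<le> sum_mset (M :: nat multiset)"
  by (induction M) (auto simp: Suc_le_eq)

lemma card_weak_lists:
  assumes "m \<le> L"
  shows "card (weak_lists L m) = num_partitions m"
proof -
  let ?P = "{M :: nat multiset. 0 \<notin># M \<and> sum_mset M = m}"
  let ?f = "\<lambda>xs. filter_mset (\<lambda>x. x \<noteq> 0) (mset xs)"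
  let ?g = "\<lambda>M. replicate (L - size M) 0 @ sorted_list_of_multiset M"
  have "bij_betw ?f (weak_lists L m) ?P"
  proof (rule bij_betw_byWitness[where f' = ?g])
    show "\<forall>xs\<in>weak_lists L m. ?g (?f xs) = xs"
    proof
      fix xs assume xs: "xs \<in> weak_lists L m"
      have sz: "size (?f xs) = L - count (mset xs) 0"
      proof -
        have "mset xs = ?f xs + replicate_mset (count (mset xs) 0) 0"
          by (rule multiset_eqI) auto
        hence "size (mset xs) = size (?f xs) + count (mset xs) 0" by (metis size_replicate_mset size_union)
        thus ?thesis using xs by (auto simp: weak_lists_def)
      qed
      have c: "count (mset xs) 0 \<le> L" using count_le_length[of xs 0] xs
        by (simp add: weak_lists_def count_mset)
      have "mset (?g (?f xs)) = mset xs"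
        unfolding sz using c by (intro multiset_eqI) auto
      moreover have "sorted (?g (?f xs))" by (auto simp: sorted_append)
      moreover have "sorted xs" using xs by (simp add: weak_lists_def)
      ultimately show "?g (?f xs) = xs" by (metis properties_for_sort)
    qed
    show "\<forall>M\<in>?P. ?f (?g M) = M"
      by (auto intro!: multiset_eqI simp: not_in_iff)
    show "?f ` weak_lists L m \<subseteq> ?P"
    proof
      fix M assume "M \<in> ?f ` weak_lists L m"
      then obtain xs where xs: "xs \<in> weak_lists L m" "M = ?f xs" by blast
      have "mset xs = ?f xs + replicate_mset (count (mset xs) 0) 0"
        by (rule multiset_eqI) auto
      hence "sum_mset (mset xs) = sum_mset (?f xs) + sum_mset (replicate_mset (count (mset xs) 0) 0)"
        by (metis sum_mset.union)
      thus "M \<in> ?P" using xs by (simp add: weak_lists_def sum_mset_sum_list)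
    qed
    show "?g ` ?P \<subseteq> weak_lists L m"
    proof
      fix xs assume "xs \<in> ?g ` ?P"
      then obtain M where M: "0 \<notin># M" "sum_mset M = m" "xs = ?g M" by blast
      have "size M \<le> L" using size_le_sum_mset[OF M(1)] M(2) assms by simp
      moreover have "sum_list (sorted_list_of_multiset M) = m"
        using M(2) by (metis mset_sorted_list_of_multiset sum_mset_sum_list)
      moreover have "length (sorted_list_of_multiset M) = size M"
        by (metis mset_sorted_list_of_multiset size_mset)
      ultimately show "xs \<in> weak_lists L m"
        using M(3) by (auto simp: weak_lists_def sorted_append sum_list_replicate)
    qed
  qed
  thus ?thesis by (simp add: num_partitions_def bij_betw_same_card)
qed

lemma elem_ge: 
  assumes "finite S" "card S = L" "i < L"
  shows "i \<le> elem S i"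
  using assms(3)
proof (induction i)
  case (Suc i)
  thus ?case using elem_less[OF assms(1,2), of i "Suc i"] by simp
qed simp

text \<open>
  Adding \<open>i\<close> to the \<open>i\<close>-th entry turns a weakly increasing list
  into a strictly increasing one, that is, into a set.
\<close>

lemma card_subsets_sum:
  "card {S. finite S \<and> card S = L \<and> \<Sum>S = m + \<Sum>{..<L}} = card (weak_lists L m)"
proof -
  let ?G = "{S. finite S \<and> card S = L \<and> \<Sum>S = m + \<Sum>{..<L}}"
  let ?f = "\<lambda>xs. (\<lambda>i. xs ! i + i) ` {..<L}"
  let ?g = "\<lambda>S. map (\<lambda>i. elem S i - i) [0..<L]"
  have less: "xs ! i + i < xs ! j + j" if "xs \<in> weak_lists L m" "i < j" "j < L" for xs i j
    using that sorted_nth_mono[of xs i j] by (fastforce simp: weak_lists_def)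
  have inj: "inj_on (\<lambda>i. xs ! i + i) {..<L}" if "xs \<in> weak_lists L m" for xs
    using less[OF that] by (intro inj_onI) (metis lessThan_iff less_irrefl linorder_neqE_nat)
  have "bij_betw ?f (weak_lists L m) ?G"
  proof (rule bij_betw_byWitness[where f' = ?g])
    show "\<forall>xs\<in>weak_lists L m. ?g (?f xs) = xs"
    proof
      fix xs assume xs: "xs \<in> weak_lists L m"
      show "?g (?f xs) = xs"
      proof (rule nth_equalityI)
        fix i assume "i < length (?g (?f xs))"
        hence i: "i < L" by simp
        have "elem (?f xs) i = xs ! i + i" using less[OF xs] i by (intro elem_eqI[where l=L]) auto
        thus "?g (?f xs) ! i = xs ! i" using i by simp
      qed (use xs in \<open>simp add: weak_lists_def\<close>)
    qed
    show "\<forall>S\<in>?G. ?f (?g S) = S"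
    proof
      fix S assume S: "S \<in> ?G"
      have "?f (?g S) = elem S ` {..<L}"
        using elem_ge S by (intro image_cong) auto
      thus "?f (?g S) = S" using elem_image S by simp
    qed
    show "?f ` weak_lists L m \<subseteq> ?G"
    proof
      fix S assume "S \<in> ?f ` weak_lists L m"
      then obtain xs where xs: "xs \<in> weak_lists L m" "S = ?f xs" by blast
      have "\<Sum>S = (\<Sum>i<L. xs ! i + i)" unfolding xs(2) using inj[OF xs(1)] by (simp add: sum.reindex)
      also have "\<dots> = m + \<Sum>{..<L}"
        using xs(1) by (auto simp: sum.distrib weak_lists_def sum_list_sum_nth atLeast0LessThan)
      finally show "S \<in> ?G" using xs(2) inj[OF xs(1)] by (simp add: card_image)
    qed
    show "?g ` ?G \<subseteq> weak_lists L m"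
    proof
      fix xs assume "xs \<in> ?g ` ?G"
      then obtain S where S: "finite S" "card S = L" "\<Sum>S = m + \<Sum>{..<L}" "xs = ?g S" by blast
      have "\<Sum>S = (\<Sum>i<L. elem S i)"
        using sum.reindex[OF inj_on_elem[OF S(1,2)], of "\<lambda>x. x"] elem_image[OF S(1,2)] by simp
      also have "\<dots> = (\<Sum>i<L. (elem S i - i) + i)" using elem_ge[OF S(1,2)] by (intro sum.cong) auto
      also have "\<dots> = (\<Sum>i<L. elem S i - i) + \<Sum>{..<L}" by (rule sum.distrib)
      finally have "(\<Sum>i<L. elem S i - i) = m" using S(3) by simp
      moreover have "sorted (?g S)"
        unfolding sorted_iff_nth_Suc
      proof (intro allI impI)
        fix i assume "Suc i < length (?g S)"
        thus "?g S ! i \<le> ?g S ! Suc i" using elem_less[OF S(1,2), of i "Suc i"] by simp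
      qed
      ultimately show "xs \<in> weak_lists L m"
        using S(4) by (simp add: weak_lists_def sum_list_sum_nth atLeast0LessThan)
    qed
  qed
  from bij_betw_same_card[OF this] show ?thesis by simp
qed

lemma frobenius_size_bound:
  assumes "(A, B) \<in> frobenius_pairs" "frobenius_size (A, B) = m"
  shows "A \<subseteq> {..<m}" "B \<subseteq> {..<m}"
proof -
  have fin: "finite A" "finite B" "card A = card B" using assms by (auto simp: frobenius_pairs_def)
  have m: "m = \<Sum>A + \<Sum>B + card A" using assms by (simp add: frobenius_size_def)
  show "A \<subseteq> {..<m}"
  proof
    fix a assume "a \<in> A"
    hence "a \<le> \<Sum>A" "card A > 0" using member_le_sum[of a A "\<lambda>x. x"] fin by (auto simp: card_gt_0_iff)
    thus "a \<in> {..<m}" using m by simp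
  qed
  show "B \<subseteq> {..<m}"
  proof
    fix b assume "b \<in> B"
    hence "b \<le> \<Sum>B" "card B > 0" using member_le_sum[of b B "\<lambda>x. x"] fin by (auto simp: card_gt_0_iff)
    thus "b \<in> {..<m}" using m fin by simp
  qed
qed

text \<open>
  Cut a set \<open>S\<close> of \<open>m\<close> natural numbers at \<open>m\<close>: the
  set \<open>A\<close> of the elements above the cut and the set \<open>B\<close> of the
  gaps below it, both measured from the cut, have the same size, and \<open>\<Sum>S\<close>
  exceeds its least possible value by \<open>frobenius_size (A, B)\<close>. A cut at
  \<open>m\<close> is high enough because a partition of \<open>m\<close> has at most
  \<open>m\<close> parts and a gap of depth \<open>m\<close> would cost more than
  \<open>m\<close>.
\<close>

lemma card_frobenius_pairs:
  "card {x \<in> frobenius_pairs. frobenius_size x = m} = num_partitions m"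
proof -
  let ?G = "{S. finite S \<and> card S = m \<and> \<Sum>S = m + \<Sum>{..<m}}"
  let ?X = "{x \<in> frobenius_pairs. frobenius_size x = m}"
  let ?f = "\<lambda>(A, B). ({..<m} - (\<lambda>b. m - 1 - b) ` B) \<union> (\<lambda>a. m + a) ` A"
  let ?g = "\<lambda>S. ({a. m + a \<in> S}, {b. b < m \<and> m - 1 - b \<notin> S})"
  have refl: "inj_on (\<lambda>b. m - 1 - b) {..<m}" by (rule inj_onI) auto
  have parts: "finite (?f (A, B)) \<and> card (?f (A, B)) + card B = m + card A \<and>
      \<Sum>(?f (A, B)) + (\<Sum>b\<in>B. m - 1 - b) = \<Sum>{..<m} + (\<Sum>a\<in>A. m + a)"
    if "finite A" "B \<subseteq> {..<m}" for A B
  proof -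
    let ?H = "(\<lambda>b. m - 1 - b) ` B"
    have H: "?H \<subseteq> {..<m}" using that by auto
    have finB: "finite B" using that finite_subset by blast
    have injB: "inj_on (\<lambda>b. m - 1 - b) B" using refl that inj_on_subset by blast
    have c: "card (?f (A, B)) = card ({..<m} - ?H) + card ((\<lambda>a. m + a) ` A)"
      unfolding prod.case using that by (intro card_Un_disjoint) auto
    have s: "\<Sum>(?f (A, B)) = \<Sum>({..<m} - ?H) + \<Sum>((\<lambda>a. m + a) ` A)"
      unfolding prod.case using that by (intro sum.union_disjoint) auto
    have "card ({..<m} - ?H) + card ?H = m"
      using card_Diff_subset[of ?H "{..<m}"] H finB card_mono[OF _ H] by simp
    moreover have "\<Sum>({..<m} - ?H) + \<Sum>?H = \<Sum>{..<m}"
      using sum.subset_diff[OF H, of "\<lambda>x. x"] by simp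
    moreover have "card ?H = card B" "\<Sum>?H = (\<Sum>b\<in>B. m - 1 - b)"
      using injB by (simp_all add: card_image sum.reindex)
    moreover have "card ((\<lambda>a. m + a) ` A) = card A" "\<Sum>((\<lambda>a. m + a) ` A) = (\<Sum>a\<in>A. m + a)"
      by (simp_all add: card_image sum.reindex)
    ultimately show ?thesis using c s that by simp
  qed
  have hole: "(\<Sum>b\<in>B. m - 1 - b) + (\<Sum>B + card B) = card B * m" if "B \<subseteq> {..<m}" for B
  proof -
    have "(\<Sum>b\<in>B. m - 1 - b) + (\<Sum>B + card B) = (\<Sum>b\<in>B. (m - 1 - b) + (b + 1))" by (simp only: sum.distrib card_eq_sum)
    also have "\<dots> = (\<Sum>b\<in>B. m)" using that by (intro sum.cong refl) auto
    finally show ?thesis by simp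
  qed
  have part: "(\<Sum>a\<in>A. m + a) = card A * m + \<Sum>A" for A by (simp add: sum.distrib)
  have fg: "?f (?g S) = S" if "finite S" for S
  proof (intro set_eqI)
    fix x show "x \<in> ?f (?g S) \<longleftrightarrow> x \<in> S"
    proof (cases "x < m")
      case True
      have "x \<in> (\<lambda>b. m - 1 - b) ` {b. b < m \<and> m - 1 - b \<notin> S} \<longleftrightarrow> x \<notin> S"
      proof
        assume "x \<notin> S"
        moreover have "x = m - 1 - (m - 1 - x)" "m - 1 - x < m" using True by auto
        ultimately show "x \<in> (\<lambda>b. m - 1 - b) ` {b. b < m \<and> m - 1 - b \<notin> S}" by (metis (mono_tags, lifting) image_eqI mem_Collect_eq)
      qed auto
      thus ?thesis using True by auto
    next
      case False
      then obtain a where "x = m + a" using le_Suc_ex not_less by blast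
      thus ?thesis by auto
    qed
  qed
  have gf: "?g (?f (A, B)) = (A, B)" if "B \<subseteq> {..<m}" for A B
  proof -
    have "m - 1 - b \<in> (\<lambda>b. m - 1 - b) ` B \<longleftrightarrow> b \<in> B" if "b < m" for b
      using inj_on_image_mem_iff[OF refl, of b B] that \<open>B \<subseteq> {..<m}\<close> by auto
    thus ?thesis using that by auto
  qed
  have "bij_betw ?f ?X ?G"
  proof (rule bij_betw_byWitness[where f' = ?g])
    show "\<forall>x\<in>?X. ?g (?f x) = x"
    proof
      fix x assume x: "x \<in> ?X"
      obtain A B where AB: "x = (A, B)" by fastforce
      have "B \<subseteq> {..<m}" using x frobenius_size_bound(2)[of A B m] unfolding AB by simp
      thus "?g (?f x) = x" unfolding AB by (rule gf)
    qed
    show "\<forall>S\<in>?G. ?f (?g S) = S"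
    proof
      fix S assume "S \<in> ?G"
      hence "finite S" by simp
      thus "?f (?g S) = S" by (rule fg)
    qed
    show "?f ` ?X \<subseteq> ?G"
    proof
      fix S assume "S \<in> ?f ` ?X"
      then obtain y where y: "y \<in> ?X" "S = ?f y" by (rule imageE)
      obtain A B where AB: "y = (A, B)" by fastforce
      have x: "(A, B) \<in> frobenius_pairs" "frobenius_size (A, B) = m" "S = ?f (A, B)"
        using y unfolding AB by simp_all
      have AB: "finite A" "card A = card B" "\<Sum>A + \<Sum>B + card A = m"
        using x by (auto simp: frobenius_pairs_def frobenius_size_def)
      have B: "B \<subseteq> {..<m}" using frobenius_size_bound[OF x(1,2)] by simp
      have "card B * m = card A * m" using AB(2) by simp
      thus "S \<in> ?G" unfolding x(3) mem_Collect_eq using parts[OF AB(1) B] hole[OF B] part[of A] AB(2,3) by (intro conjI) linarith+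
    qed
    show "?g ` ?G \<subseteq> ?X"
    proof
      fix x assume "x \<in> ?g ` ?G"
      then obtain S where S: "finite S" "card S = m" "\<Sum>S = m + \<Sum>{..<m}" "x = ?g S" by auto
      define A B where "A = {a. m + a \<in> S}" and "B = {b. b < m \<and> m - 1 - b \<notin> S}"
      have x: "x = (A, B)" using S(4) by (simp add: A_def B_def)
      have finA: "finite A"
        using finite_vimageI[OF S(1), of "\<lambda>a. m + a"] by (simp add: A_def vimage_def)
      have B: "B \<subseteq> {..<m}" by (auto simp: B_def)
      hence finB: "finite B" using finite_subset by blast
      have fS: "?f (A, B) = S" using fg[OF S(1)] by (simp add: A_def B_def)
      have "card A = card B" using parts[OF finA B, unfolded fS] S(2) by linarith
      moreover from this have "card B * m = card A * m" by simp
      ultimately show "x \<in> ?X"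
        using parts[OF finA B, unfolded fS] hole[OF B] part[of A] S(2,3) finA finB x
        by (auto simp: frobenius_pairs_def frobenius_size_def)
    qed
  qed
  from bij_betw_same_card[OF this] show ?thesis
    by (simp add: card_subsets_sum card_weak_lists)
qed

section \<open>Sums over pairs of finite sets\<close>

lemma summable_on_product_nonneg:
  fixes f :: "'a \<Rightarrow> real" and g :: "'b \<Rightarrow> real"
  assumes "f summable_on A" "g summable_on B" "\<And>x. x \<in> A \<Longrightarrow> f x \<ge> 0" "\<And>y. y \<in> B \<Longrightarrow> g y \<ge> 0"
  shows "(\<lambda>(x, y). f x * g y) summable_on A \<times> B"
proof (rule summable_on_SigmaI)
  show "((\<lambda>y. case (x, y) of (x, y) \<Rightarrow> f x * g y) has_sum f x * infsum g B) B" if "x \<in> A" for x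
    using has_sum_cmult_right[OF has_sum_infsum[OF assms(2)], of "f x"] by simp
  show "(\<lambda>x. f x * infsum g B) summable_on A" by (rule summable_on_cmult_left[OF assms(1)])
qed (use assms in auto)

lemma has_sum_product:
  fixes f :: "'a \<Rightarrow> complex" and g :: "'b \<Rightarrow> complex"
  assumes f: "(f has_sum a) A" "(\<lambda>x. norm (f x)) summable_on A" and g: "(g has_sum b) B" "(\<lambda>x. norm (g x)) summable_on B"
  shows "((\<lambda>(x, y). f x * g y) has_sum a * b) (A \<times> B)"
proof (rule has_sum_SigmaI)
  show "((\<lambda>y. case (x, y) of (x, y) \<Rightarrow> f x * g y) has_sum f x * b) B" for x
    using has_sum_cmult_right[OF g(1), of "f x"] by simp
  show "((\<lambda>x. f x * b) has_sum a * b) A" by (rule has_sum_cmult_left[OF f(1)])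
  have "(\<lambda>(x, y). norm (f x) * norm (g y)) summable_on A \<times> B"
    using f(2) g(2) by (intro summable_on_product_nonneg) auto
  hence "(\<lambda>x. norm (case x of (x, y) \<Rightarrow> f x * g y)) summable_on A \<times> B"
    by (simp add: case_prod_unfold norm_mult)
  thus "(\<lambda>(x, y). f x * g y) summable_on A \<times> B" by (rule abs_summable_summable)
qed

text \<open>
  The sum over the subsets of \<open>{..<m}\<close> is the product of the factors \<open>1 +
  r ^ a\<close>, which is at most the exponential of the geometric series.
\<close>

lemma summable_on_finite_subsets:
  fixes r :: real
  assumes "0 \<le> r" "r < 1"
  shows "(\<lambda>A. r ^ \<Sum>A) summable_on {A :: nat set. finite A}"
proof (rule nonneg_bounded_partial_sums_imp_summable_on)
  show "\<forall>\<^sub>F X in finite_subsets_at_top {A :: nat set. finite A}. (\<Sum>A\<in>X. r ^ \<Sum>A) \<le> exp (1 / (1 - r))"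
  proof (rule eventually_finite_subsets_at_top_weakI)
    fix X :: "nat set set" assume X: "finite X" "X \<subseteq> {A. finite A}"
    hence "finite (\<Union>X)" by auto
    then obtain m where m: "\<Union>X \<subseteq> {..<m}" using finite_nat_bounded by blast
    have "(\<Sum>A\<in>X. r ^ \<Sum>A) \<le> (\<Sum>A\<in>Pow {..<m}. r ^ \<Sum>A)"
      using m assms by (intro sum_mono2) auto
    also have "\<dots> = (\<Sum>A\<in>Pow {..<m}. (\<Prod>a\<in>A. r ^ a) * (\<Prod>a\<in>{..<m} - A. 1 :: real))"
      by (simp add: power_sum)
    also have "\<dots> = (\<Prod>a<m. r ^ a + 1)" by (rule prod_add[symmetric]) simp
    also have "\<dots> \<le> (\<Prod>a<m. exp (r ^ a))"
      using assms by (intro prod_mono) (auto intro: add_nonneg_nonneg exp_ge_add_one_self simp: add.commute)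
    also have "\<dots> = exp (\<Sum>a<m. r ^ a)" by (simp add: exp_sum)
    also have "(\<Sum>a<m. r ^ a) \<le> (\<Sum>a. r ^ a)" using assms by (intro sum_le_suminf summable_geometric) auto
    also have "(\<Sum>a. r ^ a) = 1 / (1 - r)" using assms by (intro suminf_geometric) auto
    finally show "(\<Sum>A\<in>X. r ^ \<Sum>A) \<le> exp (1 / (1 - r))" by simp
  qed
qed (use assms in auto)

lemma summable_on_finite_subset_pairs:
  fixes r :: real
  assumes "0 \<le> r" "r < 1"
  shows "(\<lambda>(A, B). r ^ (\<Sum>A + \<Sum>B)) summable_on {A :: nat set. finite A} \<times> {A :: nat set. finite A}"
  using summable_on_product_nonneg[OF summable_on_finite_subsets[OF assms] summable_on_finite_subsets[OF assms]] assms
  by (simp add: power_add)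

lemma abs_summable_frobenius:
  fixes s :: complex
  assumes "norm s < 1"
  shows "(\<lambda>x. norm (s ^ frobenius_size x)) summable_on frobenius_pairs"
proof -
  have "(\<lambda>x. norm s ^ frobenius_size x) summable_on frobenius_pairs"
  proof (rule summable_on_comparison_test)
    show "(\<lambda>(A, B). norm s ^ (\<Sum>A + \<Sum>B)) summable_on frobenius_pairs"
      by (rule summable_on_subset_banach[OF summable_on_finite_subset_pairs])
        (use assms in \<open>auto simp: frobenius_pairs_def\<close>)
    show "norm s ^ frobenius_size x \<le> (case x of (A, B) \<Rightarrow> norm s ^ (\<Sum>A + \<Sum>B))" for x
      using assms by (auto simp: frobenius_size_def split: prod.splits intro!: power_decreasing)
  qed auto
  thus ?thesis by (simp add: norm_power)
qed

text \<open>
  The pairs are grouped by their size.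
\<close>

lemma has_sum_partition_gf:
  fixes s :: complex
  assumes "norm s < 1"
  shows "((\<lambda>x. s ^ frobenius_size x) has_sum partition_gf s) frobenius_pairs"
proof -
  let ?X = "\<lambda>m. {x \<in> frobenius_pairs. frobenius_size x = m}"
  have "((\<lambda>x. s ^ frobenius_size x) has_sum infsum (\<lambda>x. s ^ frobenius_size x) frobenius_pairs) frobenius_pairs"
    using abs_summable_summable[OF abs_summable_frobenius[OF assms]] by (rule has_sum_infsum)
  moreover have "bij_betw snd (SIGMA m:UNIV. ?X m) frobenius_pairs"
    by (rule bij_betw_byWitness[where f' = "\<lambda>x. (frobenius_size x, x)"]) auto
  ultimately have *: "((\<lambda>p. s ^ frobenius_size (snd p)) has_sum infsum (\<lambda>x. s ^ frobenius_size x) frobenius_pairs) (SIGMA m:UNIV. ?X m)"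
    by (subst has_sum_reindex_bij_betw) auto
  have "((\<lambda>m. of_nat (num_partitions m) * s ^ m) has_sum infsum (\<lambda>x. s ^ frobenius_size x) frobenius_pairs) UNIV"
  proof (rule has_sum_SigmaD[OF *])
    fix m
    have "finite (?X m)"
      by (rule finite_subset[of _ "Pow {..<m} \<times> Pow {..<m}"]) (use frobenius_size_bound[OF _ refl] in fastforce, simp)
    hence "((\<lambda>x. s ^ m) has_sum (\<Sum>x\<in>?X m. s ^ m)) (?X m)" by (rule has_sum_finite)
    hence "((\<lambda>x. s ^ frobenius_size x) has_sum (\<Sum>x\<in>?X m. s ^ m)) (?X m)"
      by (subst has_sum_cong[where g = "\<lambda>x. s ^ m"]) auto
    thus "((\<lambda>y. s ^ frobenius_size (snd (m, y))) has_sum of_nat (num_partitions m) * s ^ m) (?X m)"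
      by (simp add: card_frobenius_pairs)
  qed
  hence "infsum (\<lambda>x. s ^ frobenius_size x) frobenius_pairs = partition_gf s"
    unfolding partition_gf_def by (metis has_sum_imp_sums sums_unique)
  thus ?thesis using abs_summable_summable[OF abs_summable_frobenius[OF assms]] has_sum_infsum by metis
qed

text \<open>
  The dominating series makes the partial sums converge uniformly in \<open>n\<close>, so
  the two limits may be interchanged.
\<close>

lemma infsum_dominated_convergence:
  fixes f :: "nat \<Rightarrow> 'a \<Rightarrow> complex"
  assumes lim: "\<And>x. x \<in> X \<Longrightarrow> (\<lambda>n. f n x) \<longlonglongrightarrow> g x"
    and bound: "\<forall>\<^sub>F n in sequentially. \<forall>x\<in>X. norm (f n x) \<le> M x"
    and M: "M summable_on X" and g: "(g has_sum S) X"
  shows "(\<lambda>n. infsum (f n) X) \<longlonglongrightarrow> S"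
proof -
  obtain n0 where n0: "\<And>n x. n \<ge> n0 \<Longrightarrow> x \<in> X \<Longrightarrow> norm (f n x) \<le> M x"
    using bound by (auto simp: eventually_sequentially)
  show ?thesis
  proof (rule swap_uniform_limit')
    show "uniform_limit {n0..} (\<lambda>F n. \<Sum>x\<in>F. f n x) (\<lambda>n. infsum (f n) X) (finite_subsets_at_top X)"
      using Weierstrass_m_test_general[of X "{n0..}" "\<lambda>x n. f n x" M] n0 M by auto
    show "\<forall>\<^sub>F F in finite_subsets_at_top X. (\<lambda>n. \<Sum>x\<in>F. f n x) \<longlonglongrightarrow> (\<Sum>x\<in>F. g x)"
      using lim by (intro eventually_finite_subsets_at_top_weakI tendsto_sum) auto
    show "(sum g \<longlongrightarrow> S) (finite_subsets_at_top X)" using g by (simp add: has_sum_def)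
    show "\<forall>\<^sub>F n in sequentially. n \<in> {n0..}" by (simp add: eventually_ge_at_top)
  qed simp
qed

section \<open>Two limits\<close>

lemma wallis_product_closed_form:
  "(\<Prod>k=1..n. (4 * real k ^ 2) / (4 * real k ^ 2 - 1)) =
     2 ^ (4 * n) * fact n ^ 4 / (fact (2 * n) ^ 2 * (2 * real n + 1))"
proof (induction n)
  case (Suc n)
  have f: "fact (2 * Suc n) = 2 * (real n + 1) * (2 * real n + 1) * fact (2 * n)"
    "fact (Suc n) = (real n + 1) * fact n" "2 * real (Suc n) + 1 = 2 * real n + 3"
    "(2::real) ^ (4 * Suc n) = 16 * 2 ^ (4 * n)"
    by (simp_all add: algebra_simps power_add)
  have nz: "2 * real n + 1 \<noteq> 0" "2 * real n + 3 \<noteq> 0" "real n + 1 \<noteq> 0"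
    by linarith+
  have d: "4 * real (Suc n) ^ 2 / (4 * real (Suc n) ^ 2 - 1) =
      4 * (real n + 1) ^ 2 / ((2 * real n + 1) * (2 * real n + 3))"
    by (simp add: power2_eq_square algebra_simps)
  have alg: "W * F ^ 4 / (G ^ 2 * c) * (4 * a ^ 2 / (c * d)) = 16 * W * (a * F) ^ 4 / ((2 * a * c * G) ^ 2 * d)"
    if "a \<noteq> 0" "c \<noteq> 0" "d \<noteq> 0" "G \<noteq> 0" for W F G a c d :: real
    using that by (simp add: divide_simps power2_eq_square power4_eq_xxxx)
  have "(\<Prod>k=1..Suc n. (4 * real k ^ 2) / (4 * real k ^ 2 - 1)) =
      2 ^ (4 * n) * fact n ^ 4 / (fact (2 * n) ^ 2 * (2 * real n + 1)) *
        (4 * (real n + 1) ^ 2 / ((2 * real n + 1) * (2 * real n + 3)))"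
    using Suc d by (simp add: mult.commute del: of_nat_Suc)
  also have "\<dots> = 2 ^ (4 * Suc n) * fact (Suc n) ^ 4 / (fact (2 * Suc n) ^ 2 * (2 * real (Suc n) + 1))"
    unfolding f by (rule alg) (use nz in auto)
  finally show ?case .
qed simp

text \<open>
  The differences of consecutive terms are of order \<open>1 / n\<^sup>2\<close>.
\<close>

lemma convergent_stirling:
  "convergent (\<lambda>n. ln (fact n) - (real n + 1/2) * ln (real n) + real n)"
proof -
  define a where "a = (\<lambda>n. ln (fact (Suc n)) - (real (Suc n) + 1/2) * ln (real (Suc n)) + real (Suc n) :: real)"
  have diff: "a (Suc n) - a n = 1 - (real n + 3/2) * ln (1 + 1 / (real n + 1))" for n
  proof -
    have "ln (fact (Suc (Suc n)) :: real) = ln (real n + 2) + ln (fact (Suc n))"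
      by (subst fact_Suc) (simp add: ln_mult add.commute del: fact_Suc)
    hence "a (Suc n) = ln (real n + 2) + ln (fact (Suc n)) - (real n + 5/2) * ln (real n + 2) + (real n + 2)"
      by (simp add: a_def algebra_simps del: fact_Suc)
    moreover have "a n = ln (fact (Suc n)) - (real n + 3/2) * ln (real n + 1) + (real n + 1)"
      by (simp add: a_def algebra_simps del: fact_Suc)
    moreover have "ln (1 + 1 / (real n + 1)) = ln (real n + 2) - ln (real n + 1)"
    proof -
      have "1 + 1 / (real n + 1) = (real n + 2) / (real n + 1)" by (simp add: field_simps)
      thus ?thesis by (simp add: ln_div)
    qed
    moreover have "y + f - (m + 5/2) * y + (m + 2) - (f - (m + 3/2) * x + (m + 1)) = 1 - (m + 3/2) * (y - x)"
      for y f m x :: real by (simp add: field_simps)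
    ultimately show ?thesis by (simp only:)
  qed
  have "summable (\<lambda>n. a (Suc n) - a n)"
    unfolding diff
  proof (rule summable_comparison_test_bigo)
    show "summable (\<lambda>n. norm (1 / real (Suc n) ^ 2))"
    proof -
      have "summable (\<lambda>n. inverse (real n ^ 2))" by (rule inverse_power_summable) simp
      hence "summable (\<lambda>n. inverse (real (Suc n) ^ 2))" by (subst summable_Suc_iff)
      thus ?thesis by (simp add: divide_inverse)
    qed
    show "(\<lambda>n. 1 - (real n + 3/2) * ln (1 + 1 / (real n + 1))) \<in> O(\<lambda>n. 1 / real (Suc n) ^ 2)"
      by real_asymp
  qed
  hence "convergent (\<lambda>N. \<Sum>n<N. a (Suc n) - a n)" by (simp add: summable_iff_convergent)
  hence "convergent (\<lambda>N. (a N - a 0) + a 0)" unfolding sum_lessThan_telescope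
    by (intro convergent_add convergent_const)
  hence "convergent a" by simp
  thus ?thesis unfolding a_def by (subst (asm) convergent_Suc_iff)
qed

text \<open>
  The limit is some positive constant \<open>c\<close>. Writing \<open>b\<close> for the
  sequence, \<open>(b n)\<^sup>2 / b (2 * n)\<close> has the same limit \<open>c\<close>,
  and its square is the Wallis product up to the factor \<open>2 * (2 * n + 1) / n\<close>.
\<close>

theorem stirling_formula: "(\<lambda>n. fact n / (sqrt (real n) * (real n / exp 1) ^ n)) \<longlonglongrightarrow> sqrt (2 * pi)"
proof -
  define b where "b = (\<lambda>n. fact n / (sqrt (real n) * (real n / exp 1) ^ n))"
  obtain L where L: "(\<lambda>n. ln (fact n) - (real n + 1/2) * ln (real n) + real n) \<longlonglongrightarrow> L"
    using convergent_stirling by (auto simp: convergent_def)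
  have b_exp: "exp (ln (fact n) - (real n + 1/2) * ln (real n) + real n) = b n" if "n > 0" for n
  proof -
    have "exp (ln (fact n) - (real n + 1/2) * ln (real n) + real n) =
        fact n * exp (real n) / (exp (real n * ln (real n)) * exp (ln (real n) / 2))"
      by (simp add: exp_add exp_diff algebra_simps)
    also have "exp (real n * ln (real n)) = real n ^ n" using that by (simp add: exp_of_nat_mult)
    also have "exp (ln (real n) / 2) = sqrt (real n)" using that
      by (simp flip: ln_sqrt)
    also have "exp (real n) = exp 1 ^ n" using exp_of_nat_mult[of n "1 :: real"] by simp
    finally show ?thesis by (simp add: b_def power_divide field_simps)
  qed
  have b: "b \<longlonglongrightarrow> exp L"
  proof (rule Lim_transform_eventually[OF tendsto_exp[OF L]])
    show "\<forall>\<^sub>F n in sequentially. exp (ln (fact n) - (real n + 1/2) * ln (real n) + real n) = b n"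
      using eventually_gt_at_top[of 0] by eventually_elim (rule b_exp)
  qed
  have b2: "(\<lambda>n. b (2 * n)) \<longlonglongrightarrow> exp L"
    using LIMSEQ_subseq_LIMSEQ[OF b, of "\<lambda>n. 2 * n"] by (simp add: strict_mono_def comp_def)
  have "(\<lambda>n. (b n ^ 2 / b (2 * n)) ^ 2) \<longlonglongrightarrow> (exp L ^ 2 / exp L) ^ 2"
    by (intro tendsto_intros b b2) simp
  moreover have "(\<lambda>n. (b n ^ 2 / b (2 * n)) ^ 2) \<longlonglongrightarrow> pi / 2 * 4"
  proof (rule Lim_transform_eventually)
    show "(\<lambda>n. (\<Prod>k=1..n. (4 * real k ^ 2) / (4 * real k ^ 2 - 1)) * (2 * (2 * real n + 1) / real n)) \<longlonglongrightarrow> pi / 2 * 4"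
    proof (intro tendsto_mult wallis)
      show "(\<lambda>n. 2 * (2 * real n + 1) / real n) \<longlonglongrightarrow> 4" by real_asymp
    qed
    show "\<forall>\<^sub>F n in sequentially. (\<Prod>k=1..n. (4 * real k ^ 2) / (4 * real k ^ 2 - 1)) * (2 * (2 * real n + 1) / real n) = (b n ^ 2 / b (2 * n)) ^ 2"
      using eventually_gt_at_top[of 0]
    proof eventually_elim
      case (elim n)
      define F G s e where "F = (fact n :: real)" and "G = (fact (2 * n) :: real)"
        and "s = sqrt (real n)" and "e = (real n / exp 1) ^ n"
      have pos: "F > 0" "G > 0" "s > 0" "e > 0" "real n > 0" using elim by (auto simp: F_def G_def s_def e_def)
      have ss: "s ^ 2 = real n" by (simp add: s_def)
      have bn: "b n = F / (s * e)" by (simp add: b_def F_def s_def e_def)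
      have b2n: "b (2 * n) = G / (sqrt 2 * s * (4 ^ n * e ^ 2))"
      proof -
        have "(real (2 * n) / exp 1) ^ (2 * n) = 2 ^ (2 * n) * (real n / exp 1) ^ (2 * n)"
          unfolding power_mult_distrib[symmetric] by simp
        also have "\<dots> = 4 ^ n * e ^ 2" unfolding e_def power_even_eq[symmetric] by (simp add: power_mult)
        finally show ?thesis by (simp add: b_def G_def s_def real_sqrt_mult)
      qed
      have "b n ^ 2 / b (2 * n) = F ^ 2 * sqrt 2 * 4 ^ n / (s * G)"
        unfolding bn b2n using pos by (simp add: field_simps power2_eq_square)
      hence "(b n ^ 2 / b (2 * n)) ^ 2 = F ^ 4 * 2 * (4 ^ n) ^ 2 / (real n * G ^ 2)"
        by (simp add: power_divide power_mult_distrib ss flip: power_mult)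
      also have "(4 ^ n) ^ 2 = ((2 :: real) ^ (2 * n)) ^ 2" by (simp add: power_mult)
      also have "\<dots> = 2 ^ (4 * n)" unfolding power_mult[symmetric] by (simp add: mult.commute)
      finally have sq: "(b n ^ 2 / b (2 * n)) ^ 2 = F ^ 4 * 2 * 2 ^ (4 * n) / (real n * G ^ 2)" .
      have gen: "W * u / (v * c) * (2 * c / m) = u * 2 * W / (m * v)" if "c \<noteq> 0" for W u v c m :: real
        using that by (simp add: mult_ac)
      show ?case unfolding wallis_product_closed_form F_def[symmetric] G_def[symmetric] sq
        by (rule gen) (use pos(5) in linarith)
    qed
  qed
  ultimately have "(exp L ^ 2 / exp L) ^ 2 = 2 * pi" using LIMSEQ_unique by fastforce
  hence "exp L ^ 2 = 2 * pi" by (simp add: power2_eq_square)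
  hence "exp L = sqrt (2 * pi)" by (metis exp_ge_zero real_sqrt_unique)
  thus ?thesis using b by (simp add: b_def)
qed

text \<open>
  The power is the exponential of \<open>N m * x m\<close> times \<open>Ln (1 + x m) / x
  m\<close>, and the last quotient tends to the derivative of the logarithm at 1.
\<close>

lemma tendsto_one_plus_power_exp:
  fixes x :: "nat \<Rightarrow> complex"
  assumes x: "x \<longlonglongrightarrow> 0" and L: "(\<lambda>m. of_nat (N m) * x m) \<longlonglongrightarrow> L"
  shows "(\<lambda>m. (1 + x m) ^ N m) \<longlonglongrightarrow> exp L"
proof -
  define g where "g z = (if z = 0 then 1 else Ln (1 + z) / z)" for z :: complex
  have "(Ln has_field_derivative 1) (at 1)"
    using has_field_derivative_Ln[of 1] by simp
  hence "((\<lambda>h. (Ln (1 + h) - Ln 1) / h) \<longlongrightarrow> 1) (at 0)" by (simp add: DERIV_def)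
  hence "(g \<longlongrightarrow> 1) (at 0)"
    by (rule Lim_transform_eventually) (auto simp: g_def eventually_at_filter)
  hence "isCont g 0" by (simp add: isCont_def g_def[of 0])
  hence "(\<lambda>m. g (x m)) \<longlonglongrightarrow> g 0" using x by (rule isCont_tendsto_compose)
  hence "(\<lambda>m. exp (of_nat (N m) * x m * g (x m))) \<longlonglongrightarrow> exp (L * 1)"
    unfolding g_def[of 0] if_P[OF refl] by (intro tendsto_exp tendsto_mult L)
  moreover have "\<forall>\<^sub>F m in sequentially. norm (x m) < 1"
    using tendstoD[OF x, of 1] by simp
  hence "\<forall>\<^sub>F m in sequentially. exp (of_nat (N m) * x m * g (x m)) = (1 + x m) ^ N m"
  proof eventually_elim
    case (elim m)
    hence nz: "1 + x m \<noteq> 0" by (metis add_eq_0_iff norm_minus_cancel norm_one less_irrefl)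
    have "of_nat (N m) * x m * g (x m) = of_nat (N m) * Ln (1 + x m)" by (simp add: g_def)
    hence "exp (of_nat (N m) * x m * g (x m)) = exp (of_nat (N m) * Ln (1 + x m))" by (rule arg_cong)
    also have "\<dots> = (1 + x m) ^ N m" using nz by (simp add: exp_of_nat_mult)
    finally show ?case .
  qed
  ultimately show ?thesis using Lim_transform_eventually by force
qed

section \<open>Rotating sets of nodes\<close>

text \<open>
  One of the two bounding rays is excluded, so that the rotations of the sector by multiples
  of \<open>2 * \<pi> / n\<close> partition the punctured plane.
\<close>

definition sector :: "nat \<Rightarrow> complex set" where
  "sector n = {of_real \<rho> * cis \<phi> | \<rho> \<phi>. \<rho> > 0 \<and> - pi / n < \<phi> \<and> \<phi> \<le> pi / n}"

definition rotate_set :: "nat \<Rightarrow> nat \<Rightarrow> nat set \<Rightarrow> nat set" where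
  "rotate_set n r I = (\<lambda>j. (j + r) mod n) ` I"

lemma cis_2pi_int: "cis (2 * pi * of_int m) = 1"
  by (rule cis_multiple_2pi) auto

lemma node_add_mod:
  assumes "n \<ge> 1"
  shows "node n l ((j + r) mod n) = cis (2 * pi * real r / n) * node n l j"
proof -
  define q where "q = (j + r) div n"
  have jr: "real ((j + r) mod n) = real j + real r - real n * real q"
    by (metis add_diff_cancel_left' mult_div_mod_eq of_nat_add of_nat_mult q_def)
  have "node n l ((j + r) mod n) = cis (2 * pi * real r / n + pi * (2 * real j - real l + 1) / n - 2 * pi * of_int (int q))"
    unfolding node_def jr using assms by (intro arg_cong[where f=cis]) (simp add: field_simps)
  also have "\<dots> = cis (2 * pi * real r / n + pi * (2 * real j - real l + 1) / n) / cis (2 * pi * of_int (int q))"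
    by (simp only: cis_divide)
  also have "\<dots> = cis (2 * pi * real r / n) * node n l j"
    unfolding cis_2pi_int node_def cis_mult by simp
  finally show ?thesis .
qed

lemma rotate_back:
  fixes j n :: nat
  assumes "j < n" "a + b = n"
  shows "((j + a) mod n + b) mod n = j"
proof -
  have "((j + a) mod n + b) mod n = (j + a + b) mod n" by (rule mod_add_left_eq)
  also have "j + a + b = j + n" using assms by simp
  finally show ?thesis using assms by simp
qed

lemma rotate_set_inverse:
  assumes "I \<subseteq> {..<n}" "r < n"
  shows "rotate_set n (n - r) (rotate_set n r I) = I" "rotate_set n r (rotate_set n (n - r) I) = I"
proof -
  have 1: "((j + r) mod n + (n - r)) mod n = j" if "j \<in> I" for j
    by (rule rotate_back) (use that assms in auto)
  have 2: "((j + (n - r)) mod n + r) mod n = j" if "j \<in> I" for j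
    by (rule rotate_back) (use that assms in auto)
  have "rotate_set n (n - r) (rotate_set n r I) = (\<lambda>j. j) ` I"
    unfolding rotate_set_def image_image by (rule image_cong[OF refl 1])
  moreover have "rotate_set n r (rotate_set n (n - r) I) = (\<lambda>j. j) ` I"
    unfolding rotate_set_def image_image by (rule image_cong[OF refl 2])
  ultimately show "rotate_set n (n - r) (rotate_set n r I) = I" "rotate_set n r (rotate_set n (n - r) I) = I"
    by simp_all
qed

lemma rotate_set_subset: "n \<ge> 1 \<Longrightarrow> rotate_set n r I \<subseteq> {..<n}"
  by (auto simp: rotate_set_def)

lemma inj_on_rotate:
  fixes n :: nat
  assumes "r < n" "I \<subseteq> {..<n}"
  shows "inj_on (\<lambda>j. (j + r) mod n) I"
proof (rule inj_on_inverseI[of _ "\<lambda>j. (j + (n - r)) mod n"])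
  show "((j + r) mod n + (n - r)) mod n = j" if "j \<in> I" for j
    by (rule rotate_back) (use that assms in auto)
qed

lemma card_rotate_set: "r < n \<Longrightarrow> I \<subseteq> {..<n} \<Longrightarrow> card (rotate_set n r I) = card I"
  unfolding rotate_set_def by (intro card_image inj_on_rotate)

lemma sum_node_rotate_set:
  assumes "n \<ge> 1" "r < n" "I \<subseteq> {..<n}"
  shows "(\<Sum>j\<in>rotate_set n r I. node n l j) = cis (2 * pi * real r / n) * (\<Sum>j\<in>I. node n l j)"
  unfolding rotate_set_def using assms
  by (simp add: sum.reindex inj_on_rotate node_add_mod sum_distrib_left)

lemma zero_not_in_sector: "0 \<notin> sector n"
  by (auto simp: sector_def)

lemma sector_cover:
  assumes "n \<ge> 1" "w \<noteq> 0"
  shows "\<exists>r<n. \<exists>v\<in>sector n. w = cis (2 * pi * real r / n) * v"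
proof -
  \<comment> \<open>The rotation is the integer nearest to the argument, in units of the angle between nodes; a tie is rounded down.\<close>
  define x where "x = Arg w * n / (2 * pi)"
  define m where "m = \<lceil>x - 1/2\<rceil>"
  define \<phi> where "\<phi> = Arg w - 2 * pi * of_int m / n"
  define r where "r = nat (m mod int n)"
  have n0: "real n > 0" using assms by simp
  have m: "of_int m \<ge> x - 1/2" "of_int m < x + 1/2" unfolding m_def by linarith+
  have \<phi>: "\<phi> = (x - of_int m) * (2 * pi / n)" using n0 by (simp add: \<phi>_def x_def field_simps)
  have p: "2 * pi / n > 0" using n0 by simp
  have "\<phi> \<le> 1/2 * (2 * pi / n)" unfolding \<phi> using m p by (intro mult_right_mono) auto
  moreover have "-1/2 * (2 * pi / n) < \<phi>" unfolding \<phi> using m p by (intro mult_strict_right_mono) auto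
  moreover have "norm w > 0" using assms by simp
  ultimately have "of_real (norm w) * cis \<phi> \<in> sector n" unfolding sector_def by force
  moreover have "r < n" using assms by (simp add: r_def nat_less_iff)
  moreover have "w = cis (2 * pi * real r / n) * (of_real (norm w) * cis \<phi>)"
  proof -
    have "real r = of_int (m mod int n)" using assms by (simp add: r_def)
    also have "\<dots> = of_int m - real n * of_int (m div int n)"
      by (metis minus_div_mult_eq_mod mult.commute of_int_diff of_int_mult of_int_of_nat_eq)
    finally have r: "real r = of_int m - real n * of_int (m div int n)" .
    have "cis (2 * pi * real r / n) * cis \<phi> = cis (Arg w - 2 * pi * of_int (m div int n))"
      unfolding cis_mult r \<phi>_def using n0 by (intro arg_cong[where f=cis]) (simp add: field_simps)
    also have "\<dots> = cis (Arg w)" unfolding cis_divide[symmetric] cis_2pi_int by simp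
    finally have *: "cis (2 * pi * real r / n) * cis \<phi> = cis (Arg w)" .
    have "w = of_real (norm w) * cis (Arg w)" using rcis_cmod_Arg[of w] by (simp add: rcis_def)
    thus ?thesis unfolding *[symmetric] by (simp only: mult_ac)
  qed
  ultimately show ?thesis by blast
qed

lemma sector_disjoint:
  assumes "n \<ge> 1" "v \<in> sector n" "v' \<in> sector n" "r < n" "s < n"
    and eq: "cis (2 * pi * real r / n) * v = cis (2 * pi * real s / n) * v'"
  shows "r = s"
proof -
  obtain \<rho> \<phi> where v: "v = of_real \<rho> * cis \<phi>" "\<rho> > 0" "- pi / n < \<phi>" "\<phi> \<le> pi / n"
    using assms(2) by (auto simp: sector_def)
  obtain \<rho>' \<phi>' where v': "v' = of_real \<rho>' * cis \<phi>'" "\<rho>' > 0" "- pi / n < \<phi>'" "\<phi>' \<le> pi / n"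
    using assms(3) by (auto simp: sector_def)
  have n0: "real n > 0" using assms by simp
  have "norm v = norm v'" using arg_cong[OF eq, of norm] by (simp add: norm_mult)
  hence "\<rho> = \<rho>'" using v v' by (simp add: norm_mult)
  hence "of_real \<rho> * cis (2 * pi * real r / n + \<phi>) = of_real \<rho> * cis (2 * pi * real s / n + \<phi>')"
    using eq unfolding v v' cis_mult[symmetric] by (simp add: mult_ac)
  hence "cis (2 * pi * real r / n + \<phi>) = cis (2 * pi * real s / n + \<phi>')" using v(2) by simp
  then obtain m :: int where "2 * pi * real r / n + \<phi> = 2 * pi * real s / n + \<phi>' + 2 * pi * of_int m"
    by (auto simp: complex_eq_iff dest!: sin_cos_eq_iff[THEN iffD1, OF conjI, rotated])
  hence "2 * pi * real r + \<phi> * n = 2 * pi * real s + \<phi>' * n + 2 * pi * of_int m * n"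
    using n0 by (simp add: field_simps)
  hence "\<phi> * n - \<phi>' * n = 2 * pi * of_int (int s + m * int n - int r)" by (simp add: algebra_simps)
  moreover have "\<phi> * n \<le> pi" "- pi < \<phi> * n" "\<phi>' * n \<le> pi" "- pi < \<phi>' * n"
    using v(3,4) v'(3,4) n0 by (simp_all add: field_simps)
  ultimately have "2 * pi * of_int (int s + m * int n - int r) < 2 * pi * 1"
     "2 * pi * (-1) < 2 * pi * of_int (int s + m * int n - int r)" by linarith+
  hence "of_int (int s + m * int n - int r) < (1::real)" "(-1::real) < of_int (int s + m * int n - int r)"
    by (simp_all only: mult_less_cancel_left_pos[of "2 * pi"] pi_gt_zero zero_less_mult_iff zero_less_numeral simp_thms)
  hence z: "int s + m * int n - int r = 0" by linarith
  have "m = 0"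
  proof (rule ccontr)
    assume "m \<noteq> 0"
    hence "\<bar>m\<bar> * int n \<ge> 1 * int n" by (intro mult_right_mono) auto
    hence "\<bar>m * int n\<bar> \<ge> int n" by (simp add: abs_mult)
    thus False using z assms by linarith
  qed
  thus ?thesis using z by simp
qed

text \<open>
  Shifting the labels of the nodes by \<open>r\<close> rotates their sum by \<open>2 * \<pi>
  * r / n\<close>, which does not change its \<open>N\<close>-th power. If the sum is not 0,
  exactly one of the \<open>n\<close> shifts brings it into the sector.
\<close>

lemma sum_powers_eq_sector_sum:
  assumes n: "n \<ge> 1" and N: "n dvd N" "N > 0"
  shows "(\<Sum>I | I \<subseteq> {..<n} \<and> card I = l. (\<Sum>j\<in>I. node n l j) ^ N) =
    of_nat n * (\<Sum>I | I \<subseteq> {..<n} \<and> card I = l \<and> (\<Sum>j\<in>I. node n l j) \<in> sector n. (\<Sum>j\<in>I. node n l j) ^ N)"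
proof -
  let ?E = "\<lambda>I. \<Sum>j\<in>I. node n l j"
  let ?L = "{I. I \<subseteq> {..<n} \<and> card I = l}" and ?D = "{I. I \<subseteq> {..<n} \<and> card I = l \<and> ?E I \<in> sector n}"
  have finL: "finite ?L" by (rule finite_subset[of _ "Pow {..<n}"]) auto
  have pow1: "cis (2 * pi * real r / n) ^ N = 1" for r
  proof -
    obtain c where c: "N = n * c" using N by blast
    have "cis (2 * pi * real r / n) ^ N = cis (2 * pi * of_int (int (r * c)))"
      unfolding Complex.DeMoivre c using n by (intro arg_cong[where f=cis]) (simp add: field_simps)
    thus ?thesis by (simp only: cis_2pi_int)
  qed
  \<comment> \<open>Sets whose sum vanishes lie in no rotated sector, but they contribute nothing either.\<close>
  have "bij_betw (\<lambda>(r, I). rotate_set n r I) ({..<n} \<times> ?D) {I \<in> ?L. ?E I \<noteq> 0}"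
    unfolding bij_betw_def
  proof
    show "inj_on (\<lambda>(r, I). rotate_set n r I) ({..<n} \<times> ?D)"
    proof (rule inj_onI)
      fix p q assume pq: "p \<in> {..<n} \<times> ?D" "q \<in> {..<n} \<times> ?D"
        "(case p of (r, I) \<Rightarrow> rotate_set n r I) = (case q of (r, I) \<Rightarrow> rotate_set n r I)"
      obtain r I s J where p: "p = (r, I)" "q = (s, J)" by fastforce
      have I: "r < n" "I \<subseteq> {..<n}" "?E I \<in> sector n" and J: "s < n" "J \<subseteq> {..<n}" "?E J \<in> sector n"
        and eq: "rotate_set n r I = rotate_set n s J" using pq p by auto
      have "cis (2 * pi * real r / n) * ?E I = cis (2 * pi * real s / n) * ?E J"
        using sum_node_rotate_set[OF n I(1,2)] sum_node_rotate_set[OF n J(1,2)] eq by simp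
      hence rs: "r = s" using sector_disjoint[OF n I(3) J(3) I(1) J(1)] by simp
      have "I = J" using rotate_set_inverse(1)[OF I(2,1)] rotate_set_inverse(1)[OF J(2,1)] eq rs by metis
      thus "p = q" using p rs by simp
    qed
    show "(\<lambda>(r, I). rotate_set n r I) ` ({..<n} \<times> ?D) = {I \<in> ?L. ?E I \<noteq> 0}"
    proof (intro set_eqI iffI)
      fix K assume "K \<in> (\<lambda>(r, I). rotate_set n r I) ` ({..<n} \<times> ?D)"
      then obtain r I where K: "K = rotate_set n r I" "r < n" "I \<subseteq> {..<n}" "card I = l" "?E I \<in> sector n" by auto
      hence "?E I \<noteq> 0" using zero_not_in_sector by metis
      hence "?E K \<noteq> 0" using sum_node_rotate_set[OF n K(2,3), of l] K(1) by simp
      thus "K \<in> {I \<in> ?L. ?E I \<noteq> 0}" using K card_rotate_set[OF K(2,3)] rotate_set_subset[OF n] by simp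
    next
      fix K assume K: "K \<in> {I \<in> ?L. ?E I \<noteq> 0}"
      obtain r v where r: "r < n" "v \<in> sector n" "?E K = cis (2 * pi * real r / n) * v"
        using sector_cover[OF n, of "?E K"] K by auto
      define I where "I = rotate_set n (n - r) K"
      have KI: "rotate_set n r I = K" using rotate_set_inverse(2)[of K n r] r K by (simp add: I_def)
      have I: "I \<subseteq> {..<n}" using rotate_set_subset[OF n] by (simp add: I_def)
      have "card I = l" using card_rotate_set[OF r(1) I] KI K by simp
      moreover have "?E I = v" using sum_node_rotate_set[OF n r(1) I, of l] KI r(3) by simp
      ultimately have "(r, I) \<in> {..<n} \<times> ?D" using I r by simp
      thus "K \<in> (\<lambda>(r, I). rotate_set n r I) ` ({..<n} \<times> ?D)" using KI by force
    qed
  qed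
  hence "(\<Sum>I | I \<in> ?L \<and> ?E I \<noteq> 0. ?E I ^ N) = (\<Sum>(r, I)\<in>{..<n} \<times> ?D. ?E (rotate_set n r I) ^ N)"
    by (subst sum.reindex_bij_betw[symmetric, where g = "\<lambda>I. ?E I ^ N"]) (auto simp: case_prod_unfold)
  also have "\<dots> = (\<Sum>(r, I)\<in>{..<n} \<times> ?D. ?E I ^ N)"
    using sum_node_rotate_set[OF n] pow1 by (intro sum.cong refl) (auto simp: power_mult_distrib)
  also have "\<dots> = of_nat n * (\<Sum>I\<in>?D. ?E I ^ N)"
    by (simp add: sum.cartesian_product[symmetric])
  also have "(\<Sum>I | I \<in> ?L \<and> ?E I \<noteq> 0. ?E I ^ N) = (\<Sum>I\<in>?L. ?E I ^ N)"
    using finL N by (intro sum.mono_neutral_left) auto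
  finally show ?thesis .
qed

section \<open>Particles and holes\<close>

text \<open>
  In \<open>((A, B), (A', B'))\<close> the sets \<open>A\<close> and \<open>B\<close>
  describe the particles outside and the holes inside the arc of nodes \<open>{..<l}\<close>
  that belong to its upper end, and \<open>A'\<close> and \<open>B'\<close> those that
  belong to its lower end; all are given by their distances from that end.
\<close>

type_synonym excitation = "(nat set \<times> nat set) \<times> (nat set \<times> nat set)"

definition excite :: "nat \<Rightarrow> nat \<Rightarrow> excitation \<Rightarrow> nat set" where
  "excite n l = (\<lambda>((A, B), (A', B')). ({..<l} - ((\<lambda>b. l - 1 - b) ` B \<union> B')) \<union>
     ((\<lambda>a. l + a) ` A \<union> (\<lambda>a. n - 1 - a) ` A'))"

text \<open>
  The arc and its complement are cut into halves, so that every node belongs to one of the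
  two ends and no set of nodes is described twice. The last condition keeps the number of
  nodes equal to \<open>l\<close>.
\<close>

definition admissible :: "nat \<Rightarrow> nat \<Rightarrow> excitation \<Rightarrow> bool" where
  "admissible n l = (\<lambda>((A, B), (A', B')).
     A \<subseteq> {..<(n - l + 1) div 2} \<and> A' \<subseteq> {..<(n - l) div 2} \<and> B \<subseteq> {..<(l + 1) div 2} \<and> B' \<subseteq> {..<l div 2} \<and>
     card A + card A' = card B + card B')"

context
  fixes n l Ra La Rb Lb :: nat
  assumes ln: "l < n"
    and h: "Ra = (n - l + 1) div 2" "La = (n - l) div 2" "Rb = (l + 1) div 2" "Lb = l div 2"
begin

private lemma halves: "Ra + La = n - l" "Rb + Lb = l"
  using h by presburger+

lemma sum_excite:
  fixes v :: "nat \<Rightarrow> 'a :: ab_group_add"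
  assumes "A \<subseteq> {..<Ra}" "A' \<subseteq> {..<La}" "B \<subseteq> {..<Rb}" "B' \<subseteq> {..<Lb}"
  shows "(\<Sum>j\<in>excite n l ((A, B), (A', B')). v j) = (\<Sum>j<l. v j)
     + ((\<Sum>a\<in>A. v (l + a)) - (\<Sum>b\<in>B. v (l - 1 - b))) + ((\<Sum>a\<in>A'. v (n - 1 - a)) - (\<Sum>b\<in>B'. v b))"
proof -
  let ?H1 = "(\<lambda>b. l - 1 - b) ` B" and ?P1 = "(\<lambda>a. l + a) ` A" and ?P2 = "(\<lambda>a. n - 1 - a) ` A'"
  have fin: "finite A" "finite A'" "finite B" "finite B'" using assms finite_subset by blast+
  have Hsub: "?H1 \<union> B' \<subseteq> {..<l}" using assms halves by force
  have Hdisj: "?H1 \<inter> B' = {}"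
  proof -
    have "l - 1 - b \<noteq> b'" if "b \<in> B" "b' \<in> B'" for b b'
    proof -
      have "b < Rb" "b' < Lb" using that assms by auto
      thus ?thesis using halves by linarith
    qed
    thus ?thesis by auto
  qed
  have Pdisj: "?P1 \<inter> ?P2 = {}"
  proof -
    have "l + a \<noteq> n - 1 - a'" if "a \<in> A" "a' \<in> A'" for a a'
    proof -
      have "a < Ra" "a' < La" using that assms by auto
      thus ?thesis using halves ln by linarith
    qed
    thus ?thesis by auto
  qed
  have HP: "({..<l} - (?H1 \<union> B')) \<inter> (?P1 \<union> ?P2) = {}"
  proof -
    have "n - 1 - a' \<ge> l" if "a' \<in> A'" for a'
    proof -
      have "a' < La" using that assms by auto
      thus ?thesis using halves ln by linarith
    qed
    thus ?thesis by fastforce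
  qed
  have injB: "inj_on (\<lambda>b. l - 1 - b) B"
  proof (rule inj_onI)
    fix x y assume xy: "x \<in> B" "y \<in> B" "l - 1 - x = l - 1 - y"
    have "x < Rb" "y < Rb" using xy assms by auto
    thus "x = y" using xy(3) halves by linarith
  qed
  have injA': "inj_on (\<lambda>a. n - 1 - a) A'"
  proof (rule inj_onI)
    fix x y assume xy: "x \<in> A'" "y \<in> A'" "n - 1 - x = n - 1 - y"
    have "x < La" "y < La" using xy assms by auto
    thus "x = y" using xy(3) halves by linarith
  qed
  have "(\<Sum>j\<in>excite n l ((A, B), (A', B')). v j) = (\<Sum>j\<in>{..<l} - (?H1 \<union> B'). v j) + (\<Sum>j\<in>?P1 \<union> ?P2. v j)"
    unfolding excite_def prod.case using fin HP by (intro sum.union_disjoint) auto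
  also have "(\<Sum>j\<in>{..<l} - (?H1 \<union> B'). v j) = (\<Sum>j<l. v j) - (\<Sum>j\<in>?H1 \<union> B'. v j)"
    using Hsub by (intro sum_diff) auto
  also have "(\<Sum>j\<in>?H1 \<union> B'. v j) = (\<Sum>j\<in>?H1. v j) + (\<Sum>b\<in>B'. v b)"
    using fin Hdisj by (intro sum.union_disjoint) auto
  also have "(\<Sum>j\<in>?P1 \<union> ?P2. v j) = (\<Sum>j\<in>?P1. v j) + (\<Sum>j\<in>?P2. v j)"
    using fin Pdisj by (intro sum.union_disjoint) auto
  also have "(\<Sum>j\<in>?H1. v j) = (\<Sum>b\<in>B. v (l - 1 - b))" by (simp only: sum.reindex[OF injB] comp_def)
  also have "(\<Sum>j\<in>?P2. v j) = (\<Sum>a\<in>A'. v (n - 1 - a))" by (simp only: sum.reindex[OF injA'] comp_def)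
  also have "(\<Sum>j\<in>?P1. v j) = (\<Sum>a\<in>A. v (l + a))" by (simp add: sum.reindex)
  finally show ?thesis by (simp add: algebra_simps)
qed

lemma mem_excite:
  assumes "A \<subseteq> {..<Ra}" "A' \<subseteq> {..<La}" "B \<subseteq> {..<Rb}" "B' \<subseteq> {..<Lb}"
  shows "a < Ra \<Longrightarrow> l + a \<in> excite n l ((A, B), (A', B')) \<longleftrightarrow> a \<in> A"
    and "a < La \<Longrightarrow> n - 1 - a \<in> excite n l ((A, B), (A', B')) \<longleftrightarrow> a \<in> A'"
    and "a < Rb \<Longrightarrow> l - 1 - a \<in> excite n l ((A, B), (A', B')) \<longleftrightarrow> a \<notin> B"
    and "a < Lb \<Longrightarrow> a \<in> excite n l ((A, B), (A', B')) \<longleftrightarrow> a \<notin> B'"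
proof -
  have lt: "b < Ra" if "b \<in> A" for b using assms that by auto
  have lt2: "b < La" if "b \<in> A'" for b using assms that by auto
  have lt3: "b < Rb" if "b \<in> B" for b using assms that by auto
  have lt4: "b < Lb" if "b \<in> B'" for b using assms that by auto
  show "l + a \<in> excite n l ((A, B), (A', B')) \<longleftrightarrow> a \<in> A" if a: "a < Ra"
  proof -
    have "l + a \<noteq> n - 1 - b" if "b \<in> A'" for b using lt2[OF that] a halves ln by linarith
    thus ?thesis by (auto simp: excite_def)
  qed
  show "n - 1 - a \<in> excite n l ((A, B), (A', B')) \<longleftrightarrow> a \<in> A'" if a: "a < La"
  proof -
    have "n - 1 - a \<noteq> l + b" if "b \<in> A" for b using lt[OF that] a halves ln by linarith
    moreover have "\<not> n - 1 - a < l" using a halves ln by linarith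
    moreover have "a = b" if "b \<in> A'" "n - 1 - a = n - 1 - b" for b
      using lt2[OF that(1)] that(2) a halves by linarith
    ultimately show ?thesis unfolding excite_def by (auto simp del: diff_diff_left One_nat_def)
  qed
  show "l - 1 - a \<in> excite n l ((A, B), (A', B')) \<longleftrightarrow> a \<notin> B" if a: "a < Rb"
  proof -
    have "l - 1 - a < l" using a halves by linarith
    moreover have "l - 1 - a \<noteq> b" if "b \<in> B'" for b using lt4[OF that] a halves by linarith
    moreover have "l - 1 - a \<noteq> l + b" for b using a halves by linarith
    moreover have "l - 1 - a \<noteq> n - 1 - b" if "b \<in> A'" for b using lt2[OF that] a halves ln by linarith
    moreover have "a = b" if "b \<in> B" "l - 1 - a = l - 1 - b" for b
      using lt3[OF that(1)] that(2) a halves by linarith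
    ultimately show ?thesis unfolding excite_def by (auto simp del: diff_diff_left One_nat_def)
  qed
  show "a \<in> excite n l ((A, B), (A', B')) \<longleftrightarrow> a \<notin> B'" if a: "a < Lb"
  proof -
    have "a < l" using a halves by linarith
    moreover have "a \<noteq> l - 1 - b" if "b \<in> B" for b using lt3[OF that] a halves by linarith
    moreover have "a \<noteq> l + b" for b using a halves by linarith
    moreover have "a \<noteq> n - 1 - b" if "b \<in> A'" for b using lt2[OF that] a halves ln by linarith
    ultimately show ?thesis unfolding excite_def by (auto simp del: diff_diff_left One_nat_def)
  qed
qed

lemma bij_betw_excite: "bij_betw (excite n l) {Q. admissible n l Q} {I. I \<subseteq> {..<n} \<and> card I = l}"
proof -
  define g where "g I = (({a. a < Ra \<and> l + a \<in> I}, {b. b < Rb \<and> l - 1 - b \<notin> I}),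
      ({a. a < La \<and> n - 1 - a \<in> I}, {b. b < Lb \<and> b \<notin> I}))" for I
  have adm: "admissible n l ((A, B), (A', B')) \<longleftrightarrow> A \<subseteq> {..<Ra} \<and> A' \<subseteq> {..<La} \<and> B \<subseteq> {..<Rb} \<and> B' \<subseteq> {..<Lb} \<and>
      card A + card A' = card B + card B'" for A B A' B'
    by (simp only: admissible_def prod.case h)
  have sub: "excite n l ((A, B), (A', B')) \<subseteq> {..<n}" if "A \<subseteq> {..<Ra}" for A B A' B'
    using that halves ln by (auto simp: excite_def)
  have card: "int (card (excite n l ((A, B), (A', B')))) = int l + (int (card A) - int (card B)) + (int (card A') - int (card B'))"
    if "A \<subseteq> {..<Ra}" "A' \<subseteq> {..<La}" "B \<subseteq> {..<Rb}" "B' \<subseteq> {..<Lb}" for A B A' B'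
    using sum_excite[OF that, of "\<lambda>_. 1 :: int"] by simp
  have eg: "excite n l (g I) = I" if I: "I \<subseteq> {..<n}" for I
  proof -
    let ?A = "{a. a < Ra \<and> l + a \<in> I}" and ?B = "{b. b < Rb \<and> l - 1 - b \<notin> I}"
      and ?A' = "{a. a < La \<and> n - 1 - a \<in> I}" and ?B' = "{b. b < Lb \<and> b \<notin> I}"
    have s: "?A \<subseteq> {..<Ra}" "?A' \<subseteq> {..<La}" "?B \<subseteq> {..<Rb}" "?B' \<subseteq> {..<Lb}" by auto
    note m = mem_excite[OF s]
    have "x \<in> excite n l ((?A, ?B), (?A', ?B')) \<longleftrightarrow> x \<in> I" for x
    proof -
      consider "x < Lb" | "Lb \<le> x" "x < l" | "l \<le> x" "x < l + Ra" | "l + Ra \<le> x" "x < n" | "n \<le> x" by linarith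
      thus ?thesis
      proof cases
        case 1 thus ?thesis using m(4)[of x] by simp
      next
        case 2
        define b where "b = l - 1 - x"
        have b: "b < Rb" "x = l - 1 - b" using 2 halves unfolding b_def by linarith+
        show ?thesis using m(3)[OF b(1)] b by simp
      next
        case 3
        define a where "a = x - l"
        have a: "a < Ra" "x = l + a" using 3 unfolding a_def by linarith+
        show ?thesis using m(1)[OF a(1)] a by simp
      next
        case 4
        define a where "a = n - 1 - x"
        have a: "a < La" "x = n - 1 - a" using 4 halves ln unfolding a_def by linarith+
        show ?thesis using m(2)[OF a(1)] a by simp
      next
        case 5
        hence "x \<notin> I" using I by auto
        moreover have "x \<notin> excite n l ((?A, ?B), (?A', ?B'))" using sub[OF s(1)] 5 by (meson lessThan_iff not_le subsetD)
        ultimately show ?thesis by simp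
      qed
    qed
    thus ?thesis unfolding g_def by blast
  qed
  show ?thesis
  proof (rule bij_betw_byWitness[where f' = g])
    show "\<forall>Q\<in>{Q. admissible n l Q}. g (excite n l Q) = Q"
    proof
      fix Q assume Q: "Q \<in> {Q. admissible n l Q}"
      obtain A B A' B' where Qe: "Q = ((A, B), (A', B'))" by (metis prod.exhaust)
      have s: "A \<subseteq> {..<Ra}" "A' \<subseteq> {..<La}" "B \<subseteq> {..<Rb}" "B' \<subseteq> {..<Lb}"
        using Q unfolding Qe mem_Collect_eq adm by auto
      have "{a. a < Ra \<and> l + a \<in> excite n l Q} = A" "{b. b < Rb \<and> l - 1 - b \<notin> excite n l Q} = B"
        "{a. a < La \<and> n - 1 - a \<in> excite n l Q} = A'" "{b. b < Lb \<and> b \<notin> excite n l Q} = B'"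
        unfolding Qe using mem_excite[OF s] s by blast+
      thus "g (excite n l Q) = Q" by (simp only: g_def Qe)
    qed
    show "\<forall>I\<in>{I. I \<subseteq> {..<n} \<and> card I = l}. excite n l (g I) = I" using eg by blast
    show "excite n l ` {Q. admissible n l Q} \<subseteq> {I. I \<subseteq> {..<n} \<and> card I = l}"
    proof
      fix I assume "I \<in> excite n l ` {Q. admissible n l Q}"
      then obtain Q where Q: "I = excite n l Q" "admissible n l Q" by auto
      obtain A B A' B' where Qe: "Q = ((A, B), (A', B'))" by (metis prod.exhaust)
      have s: "A \<subseteq> {..<Ra}" "A' \<subseteq> {..<La}" "B \<subseteq> {..<Rb}" "B' \<subseteq> {..<Lb}" "card A + card A' = card B + card B'"
        using Q(2) unfolding Qe adm by auto
      show "I \<in> {I. I \<subseteq> {..<n} \<and> card I = l}"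
        using sub[OF s(1)] card[OF s(1-4)] s(5) unfolding Q(1) Qe by simp
    qed
    show "g ` {I. I \<subseteq> {..<n} \<and> card I = l} \<subseteq> {Q. admissible n l Q}"
    proof
      fix Q assume "Q \<in> g ` {I. I \<subseteq> {..<n} \<and> card I = l}"
      then obtain I where I: "Q = g I" "I \<subseteq> {..<n}" "card I = l" by auto
      obtain A B A' B' where Qe: "Q = ((A, B), (A', B'))" by (metis prod.exhaust)
      have s: "A \<subseteq> {..<Ra}" "A' \<subseteq> {..<La}" "B \<subseteq> {..<Rb}" "B' \<subseteq> {..<Lb}"
        using I(1) unfolding Qe g_def by auto
      have "excite n l Q = I" using eg I by simp
      thus "Q \<in> {Q. admissible n l Q}"
        using card[OF s] I(3) s unfolding Qe mem_Collect_eq adm by simp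
    qed
  qed
qed

end

section \<open>The cost of an excitation\<close>

text \<open>
  The sine is concave on this interval and the left side is the chord.
\<close>

lemma jordan_sin_bound:
  assumes "0 \<le> x" "x \<le> pi / 2"
  shows "2 * x / pi \<le> sin x"
proof -
  have "concave_on {0..pi/2} sin"
    by (rule f''_le0_imp_concave[where f' = cos and f'' = "\<lambda>x. - sin x"])
       (auto intro!: derivative_eq_intros sin_ge_zero)
  hence "(1 - 2 * x / pi) * sin 0 + 2 * x / pi * sin (pi / 2) \<le> sin ((1 - 2 * x / pi) *\<^sub>R 0 + (2 * x / pi) *\<^sub>R (pi / 2))"
    by (rule concave_onD) (use assms in \<open>auto simp: field_simps\<close>)
  thus ?thesis by simp
qed

lemma sin_ge_sin_margin:
  assumes "0 \<le> c" "c \<le> x" "x \<le> pi - c"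
  shows "sin c \<le> sin x"
proof (cases "x \<le> pi / 2")
  case True thus ?thesis using assms by (intro sin_monotone_2pi_le) auto
next
  case False
  have "sin c \<le> sin (pi - x)" using assms False by (intro sin_monotone_2pi_le) auto
  thus ?thesis by simp
qed

text \<open>
  The difference of the cosines is \<open>2 * sin (t + y / 2) * sin (y / 2)\<close>. The
  argument of the first factor stays at distance \<open>\<delta> / 4\<close> from 0 and
  \<open>\<pi>\<close>, and the second factor is bounded below by the chord.
\<close>

lemma cos_drop:
  assumes "0 < \<delta>" "\<delta> \<le> t" "t \<le> pi - \<delta>" "0 \<le> y" "y / 2 \<le> (pi - t) / 2 + \<delta> / 4"
  shows "sin (\<delta> / 4) * (2 * y / pi) \<le> cos t - cos (t + y)"
proof -
  have d: "\<delta> / 4 \<le> pi / 2" using assms by linarith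
  have s0: "sin (\<delta> / 4) \<ge> 0" using assms d by (intro sin_ge_zero) auto
  have "cos t - cos (t + y) = 2 * sin (t + y / 2) * sin (y / 2)"
    unfolding cos_diff_cos by (simp add: add_divide_distrib)
  moreover have "sin (\<delta> / 4) \<le> sin (t + y / 2)"
    by (rule sin_ge_sin_margin) (use assms in \<open>auto simp: field_simps\<close>)
  moreover have "2 * (y / 2) / pi \<le> sin (y / 2)"
    by (rule jordan_sin_bound) (use assms in \<open>auto simp: field_simps\<close>)
  ultimately show ?thesis
    using mult_mono[of "sin (\<delta> / 4)" "sin (t + y / 2)" "y / pi" "sin (y / 2)"] s0 assms
    by (simp add: mult.left_commute[of _ 2] mult.assoc)
qed

text \<open>
  The change of the sum of the nodes that is caused by the particles \<open>A\<close> and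
  the holes \<open>B\<close> at the upper end of the arc; at the lower end the complex
  conjugate appears.
\<close>

definition edge_sum :: "nat \<Rightarrow> nat \<Rightarrow> nat set \<Rightarrow> nat set \<Rightarrow> complex" where
  "edge_sum n l A B = (\<Sum>a\<in>A. cis (pi * real l / n + (2 * real a + 1) * pi / n)) -
     (\<Sum>b\<in>B. cis (pi * real l / n - (2 * real b + 1) * pi / n))"

text \<open>
  Multiplied by \<open>2 * \<i> * sin (\<pi> / n)\<close>, the sum telescopes.
\<close>

lemma sum_node_ground:
  assumes "n \<ge> 2"
  shows "(\<Sum>j<l. node n l j) = of_real (sin (pi * real l / n) / sin (pi / n))"
proof -
  have s: "sin (pi / n) > 0" using assms by (intro sin_gt_zero) (auto simp: field_simps)
  have n0: "real n \<noteq> 0" using assms by simp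
  \<comment> \<open>These points lie halfway between consecutive nodes.\<close>
  define u where "u j = cis (pi * (2 * real j - real l) / n)" for j
  have two: "cis x - cis (- x) = 2 * \<i> * of_real (sin x)" for x by (simp add: complex_eq_iff)
  have step: "2 * \<i> * of_real (sin (pi / n)) * node n l j = u (Suc j) - u j" for j
  proof -
    have "2 * \<i> * of_real (sin (pi / n)) * node n l j = (cis (pi / n) - cis (- (pi / n))) * node n l j" by (simp only: two)
    also have "\<dots> = cis (pi / n + pi * (2 * real j - real l + 1) / n) - cis (- (pi / n) + pi * (2 * real j - real l + 1) / n)"
      by (simp only: node_def left_diff_distrib cis_mult)
    also have "pi / n + pi * (2 * real j - real l + 1) / n = pi * (2 * real (Suc j) - real l) / n"
      using n0 by (simp add: field_simps)
    also have "- (pi / n) + pi * (2 * real j - real l + 1) / n = pi * (2 * real j - real l) / n"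
      using n0 by (simp add: field_simps)
    finally show ?thesis by (simp only: u_def)
  qed
  have "2 * \<i> * of_real (sin (pi / n)) * (\<Sum>j<l. node n l j) = u l - u 0"
    unfolding sum_distrib_left step by (rule sum_lessThan_telescope)
  also have "u l - u 0 = 2 * \<i> * of_real (sin (pi * real l / n))"
    unfolding two[symmetric] u_def by (simp add: field_simps)
  finally have "of_real (sin (pi / n)) * (\<Sum>j<l. node n l j) = of_real (sin (pi * real l / n))"
    by (simp add: mult.assoc)
  thus ?thesis using s by (simp add: field_simps)
qed

lemma node_edges:
  assumes "n \<ge> 1"
  shows "node n l (l + a) = cis (pi * real l / n + (2 * real a + 1) * pi / n)"
    and "b < l \<Longrightarrow> node n l (l - 1 - b) = cis (pi * real l / n - (2 * real b + 1) * pi / n)"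
    and "a < n \<Longrightarrow> node n l (n - 1 - a) = cnj (cis (pi * real l / n + (2 * real a + 1) * pi / n))"
    and "node n l b = cnj (cis (pi * real l / n - (2 * real b + 1) * pi / n))"
proof -
  show "node n l (l + a) = cis (pi * real l / n + (2 * real a + 1) * pi / n)"
    unfolding node_def using assms by (intro arg_cong[where f=cis]) (simp add: field_simps)
  show "node n l (l - 1 - b) = cis (pi * real l / n - (2 * real b + 1) * pi / n)" if "b < l"
  proof -
    have "real (l - 1 - b) = real l - 1 - real b" using that by (simp add: of_nat_diff)
    thus ?thesis unfolding node_def using assms by (intro arg_cong[where f=cis]) (simp add: field_simps)
  qed
  show "node n l (n - 1 - a) = cnj (cis (pi * real l / n + (2 * real a + 1) * pi / n))" if "a < n"
  proof -
    have "real (n - 1 - a) = real n - 1 - real a" using that by (simp add: of_nat_diff)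
    hence "node n l (n - 1 - a) = cis (- (pi * real l / n + (2 * real a + 1) * pi / n) + 2 * pi)"
      unfolding node_def using assms by (intro arg_cong[where f=cis]) (simp add: field_simps)
    also have "\<dots> = cis (- (pi * real l / n + (2 * real a + 1) * pi / n))"
      by (simp only: cis_mult[symmetric] cis_2pi mult_1_right)
    finally show ?thesis by (simp only: cis_cnj)
  qed
  show "node n l b = cnj (cis (pi * real l / n - (2 * real b + 1) * pi / n))"
    unfolding node_def cis_cnj using assms by (intro arg_cong[where f=cis]) (simp add: field_simps)
qed

lemma sum_node_excite:
  assumes "n \<ge> 2" "l < n" and adm: "admissible n l ((A, B), (A', B'))"
  shows "(\<Sum>j\<in>excite n l ((A, B), (A', B')). node n l j) =
    of_real (sin (pi * real l / n) / sin (pi / n)) + edge_sum n l A B + cnj (edge_sum n l A' B')"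
proof -
  have s: "A \<subseteq> {..<(n - l + 1) div 2}" "A' \<subseteq> {..<(n - l) div 2}" "B \<subseteq> {..<(l + 1) div 2}" "B' \<subseteq> {..<l div 2}"
    using adm by (auto simp: admissible_def)
  have n1: "n \<ge> 1" using assms by simp
  have "(\<Sum>b\<in>B. node n l (l - 1 - b)) = (\<Sum>b\<in>B. cis (pi * real l / n - (2 * real b + 1) * pi / n))"
    using s(3) by (intro sum.cong refl node_edges(2)[OF n1]) auto
  moreover have "(\<Sum>a\<in>A'. node n l (n - 1 - a)) = (\<Sum>a\<in>A'. cnj (cis (pi * real l / n + (2 * real a + 1) * pi / n)))"
    using s(2) by (intro sum.cong refl node_edges(3)[OF n1]) auto
  moreover have "(\<Sum>b\<in>B'. node n l b) = (\<Sum>b\<in>B'. cnj (cis (pi * real l / n - (2 * real b + 1) * pi / n)))"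
    by (intro sum.cong refl node_edges(4)[OF n1])
  moreover have "(\<Sum>a\<in>A. node n l (l + a)) = (\<Sum>a\<in>A. cis (pi * real l / n + (2 * real a + 1) * pi / n))"
    by (intro sum.cong refl node_edges(1)[OF n1])
  ultimately show ?thesis
    unfolding sum_excite[OF assms(2) refl refl refl refl s] sum_node_ground[OF assms(1)] edge_sum_def
    by (simp only: complex_cnj_diff cnj_sum)
qed

text \<open>
  The component of a node in the direction \<open>\<phi>\<close> is the cosine of their
  angle. It is compared with the value \<open>cos (\<pi> l / n)\<close> at the end of the
  arc: a particle at distance \<open>a\<close> falls short of it and a hole at distance
  \<open>b\<close> exceeds it, by at least a constant times \<open>a / n\<close> or \<open>b
  / n\<close>. A deviation of the direction by \<open>\<pi> / n\<close> costs at most half a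
  step between nodes, which the half-integral distances \<open>a + 1/2\<close> and \<open>b
  + 1/2\<close> absorb.
\<close>

lemma edge_sum_bound:
  assumes n: "n \<ge> 1" and \<delta>: "0 < \<delta>" "\<delta> \<le> pi * real l / n" "pi * real l / n \<le> pi - \<delta>" "pi / (2 * n) \<le> \<delta> / 4"
    and \<phi>: "\<bar>\<phi>\<bar> \<le> pi / n" and l: "l < n"
    and A: "A \<subseteq> {..<(n - l + 1) div 2}" and B: "B \<subseteq> {..<(l + 1) div 2}"
  shows "Re (edge_sum n l A B * cis (- \<phi>)) \<le>
    (real (card A) - real (card B)) * cos (pi * real l / n) - 4 * sin (\<delta> / 4) / n * real (\<Sum>A + \<Sum>B)"
proof -
  define \<theta> where "\<theta> = pi * real l / n"
  define c where "c = 4 * sin (\<delta> / 4) / n"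
  have n0: "real n > 0" using n by simp
  have fin: "finite A" "finite B" using A B finite_subset by blast+
  have s0: "sin (\<delta> / 4) \<ge> 0" using \<delta> by (intro sin_ge_zero) auto
  have nl: "pi - \<theta> = pi * real (n - l) / n" using n l by (simp add: \<theta>_def of_nat_diff field_simps)
  have half: "x / 2 \<le> z / 2 + pi / real (2 * n)" if "x \<le> z + pi / n" for x z
    using divide_right_mono[OF that, of 2] by (simp add: add_divide_distrib)
  have lower: "c * real a \<le> sin (\<delta> / 4) * (2 * y / pi)" if "2 * real a * pi / n \<le> y" for a y
  proof -
    have "sin (\<delta> / 4) * (2 * (2 * real a * pi / n) / pi) \<le> sin (\<delta> / 4) * (2 * y / pi)"
      using that s0 by (intro mult_left_mono divide_right_mono) auto
    thus ?thesis by (simp add: c_def mult_ac)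
  qed
  have part: "cos (\<theta> + (2 * real a + 1) * pi / n - \<phi>) \<le> cos \<theta> - c * real a" if "a \<in> A" for a
  proof -
    define y where "y = (2 * real a + 1) * pi / n - \<phi>"
    have split: "(2 * real a + 1) * pi / n = 2 * real a * pi / n + pi / n"
      "(2 * real a + 2) * (pi / n) = 2 * real a * pi / n + 2 * (pi / n)"
      by (simp_all add: add_divide_distrib ring_distribs)
    have y1: "2 * real a * pi / n \<le> y" using \<phi> unfolding y_def split by linarith
    have "2 * a + 2 \<le> n - l + 1" using that A by auto
    hence "2 * real a + 2 \<le> real (n - l) + 1" by linarith
    hence "(2 * real a + 2) * (pi / n) \<le> (real (n - l) + 1) * (pi / n)" by (intro mult_right_mono) auto
    moreover have "y \<le> (2 * real a + 2) * (pi / n)" using \<phi> unfolding y_def split by linarith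
    ultimately have "y \<le> (real (n - l) + 1) * (pi / n)" by linarith
    also have "\<dots> = pi * real (n - l) / n + pi / n" by (simp add: algebra_simps add_divide_distrib)
    also have "pi * real (n - l) / n = (pi - \<theta>)" unfolding nl by simp
    finally have "y / 2 \<le> (pi - \<theta>) / 2 + pi / (2 * n)" by (rule half)
    hence y2: "y / 2 \<le> (pi - \<theta>) / 2 + \<delta> / 4" using \<delta> by linarith
    have "0 \<le> y" using y1 by (meson divide_nonneg_nonneg mult_nonneg_nonneg of_nat_0_le_iff order_trans pi_ge_zero zero_le_numeral)
    from cos_drop[OF \<delta>(1) _ _ this y2] lower[OF y1] \<delta> show ?thesis
      unfolding \<theta>_def[symmetric] by (simp add: y_def add_diff_eq)
  qed
  \<comment> \<open>A hole is a particle for the complementary arc, with the angle \<open>\<theta>\<close> replaced by \<open>\<pi> - \<theta>\<close>.\<close>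
  have hole: "cos \<theta> + c * real b \<le> cos (\<theta> - (2 * real b + 1) * pi / n - \<phi>)" if "b \<in> B" for b
  proof -
    define y where "y = (2 * real b + 1) * pi / n + \<phi>"
    have split: "(2 * real b + 1) * pi / n = 2 * real b * pi / n + pi / n"
      "(2 * real b + 2) * (pi / n) = 2 * real b * pi / n + 2 * (pi / n)"
      by (simp_all add: add_divide_distrib ring_distribs)
    have y1: "2 * real b * pi / n \<le> y" using \<phi> unfolding y_def split by linarith
    have "2 * b + 2 \<le> l + 1" using that B by auto
    hence "2 * real b + 2 \<le> real l + 1" by linarith
    hence "(2 * real b + 2) * (pi / n) \<le> (real l + 1) * (pi / n)" by (intro mult_right_mono) auto
    moreover have "y \<le> (2 * real b + 2) * (pi / n)" using \<phi> unfolding y_def split by linarith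
    ultimately have "y \<le> (real l + 1) * (pi / n)" by linarith
    also have "\<dots> = pi * real l / n + pi / n" by (simp add: algebra_simps add_divide_distrib)
    also have "pi * real l / n = (pi - (pi - \<theta>))" unfolding \<theta>_def by simp
    finally have "y / 2 \<le> (pi - (pi - \<theta>)) / 2 + pi / (2 * n)" by (rule half)
    hence y2: "y / 2 \<le> (pi - (pi - \<theta>)) / 2 + \<delta> / 4" using \<delta> by linarith
    have "0 \<le> y" using y1 by (meson divide_nonneg_nonneg mult_nonneg_nonneg of_nat_0_le_iff order_trans pi_ge_zero zero_le_numeral)
    from cos_drop[OF \<delta>(1) _ _ this y2] lower[OF y1] \<delta>
    have "c * real b \<le> cos (pi - \<theta>) - cos (pi - \<theta> + y)" unfolding \<theta>_def[symmetric] by simp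
    also have "pi - \<theta> + y = pi - (\<theta> - y)" by simp
    finally have "c * real b \<le> cos (\<theta> - y) - cos \<theta>" by (simp only: cos_pi_minus)
    thus ?thesis by (simp add: y_def diff_diff_eq)
  qed
  have "Re (edge_sum n l A B * cis (- \<phi>)) =
     (\<Sum>a\<in>A. cos (\<theta> + (2 * real a + 1) * pi / n - \<phi>)) - (\<Sum>b\<in>B. cos (\<theta> - (2 * real b + 1) * pi / n - \<phi>))"
    unfolding edge_sum_def \<theta>_def[symmetric] left_diff_distrib sum_distrib_right cis_mult
    by simp
  also have "\<dots> \<le> (\<Sum>a\<in>A. cos \<theta> - c * real a) - (\<Sum>b\<in>B. cos \<theta> + c * real b)"
    using part hole by (intro diff_mono sum_mono) auto
  also have "\<dots> = (real (card A) - real (card B)) * cos \<theta> - c * real (\<Sum>A + \<Sum>B)"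
    by (simp add: sum_subtractf sum.distrib sum_distrib_left algebra_simps)
  finally show ?thesis by (simp only: \<theta>_def c_def)
qed

text \<open>
  The modulus of the sum is its component in its own direction, which is known up to
  \<open>\<pi> / n\<close>. The values \<open>cos (\<pi> l / n)\<close> cancel because there
  are as many particles as holes.
\<close>

lemma sector_excite_bound:
  assumes n: "n \<ge> 2" and \<delta>: "0 < \<delta>" "\<delta> \<le> pi * real l / n" "pi * real l / n \<le> pi - \<delta>" "pi / (2 * n) \<le> \<delta> / 4"
    and l: "l < n" and adm: "admissible n l ((A, B), (A', B'))"
    and E: "(\<Sum>j\<in>excite n l ((A, B), (A', B')). node n l j) \<in> sector n"
  shows "norm (\<Sum>j\<in>excite n l ((A, B), (A', B')). node n l j) \<le>
    sin (pi * real l / n) / sin (pi / n) - 4 * sin (\<delta> / 4) / n * real (\<Sum>A + \<Sum>B + (\<Sum>A' + \<Sum>B'))"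
proof -
  let ?E = "\<Sum>j\<in>excite n l ((A, B), (A', B')). node n l j"
  define M where "M = sin (pi * real l / n) / sin (pi / n)"
  define c where "c = 4 * sin (\<delta> / 4) / n"
  define x where "x = cos (pi * real l / n)"
  have n1: "n \<ge> 1" using n by simp
  obtain \<rho> \<phi> where E': "?E = of_real \<rho> * cis \<phi>" "\<rho> > 0" "- pi / n < \<phi>" "\<phi> \<le> pi / n"
    using E unfolding sector_def by auto
  have \<phi>: "\<bar>\<phi>\<bar> \<le> pi / n" "\<bar>- \<phi>\<bar> \<le> pi / n" using E' by auto
  have s: "A \<subseteq> {..<(n - l + 1) div 2}" "A' \<subseteq> {..<(n - l + 1) div 2}" "B \<subseteq> {..<(l + 1) div 2}" "B' \<subseteq> {..<(l + 1) div 2}"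
    and c4: "card A + card A' = card B + card B'"
    using adm by (auto simp: admissible_def)
  have "0 \<le> sin (pi * real l / n)" by (intro sin_ge_zero) (use \<delta> in linarith)+
  moreover have "0 \<le> sin (pi / n)" using n by simp
  ultimately have M0: "M \<ge> 0" unfolding M_def by (rule divide_nonneg_nonneg)
  have "norm ?E = \<rho>" using E' by (simp add: norm_mult)
  also have "\<dots> = Re (?E * cis (- \<phi>))" unfolding E'(1) by (simp add: mult.assoc cis_mult)
  also have "\<dots> = M * cos \<phi> + Re (edge_sum n l A B * cis (- \<phi>)) + Re (cnj (edge_sum n l A' B') * cis (- \<phi>))"
    unfolding sum_node_excite[OF n l adm] M_def[symmetric] by (simp add: distrib_right)
  also have "Re (cnj (edge_sum n l A' B') * cis (- \<phi>)) = Re (edge_sum n l A' B' * cis (- (- \<phi>)))"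
    by simp
  also have "M * cos \<phi> + Re (edge_sum n l A B * cis (- \<phi>)) + Re (edge_sum n l A' B' * cis (- (- \<phi>))) \<le>
     M * 1 + ((real (card A) - real (card B)) * x - c * real (\<Sum>A + \<Sum>B)) +
     ((real (card A') - real (card B')) * x - c * real (\<Sum>A' + \<Sum>B'))"
    unfolding x_def c_def
    by (intro add_mono mult_left_mono M0 edge_sum_bound[OF n1 \<delta> \<phi>(1) l s(1,3)] edge_sum_bound[OF n1 \<delta> \<phi>(2) l s(2,4)]) simp
  also have "\<dots> = M + (real (card A + card A') - real (card B + card B')) * x - c * real (\<Sum>A + \<Sum>B + (\<Sum>A' + \<Sum>B'))"
    by (simp add: algebra_simps)
  also have "\<dots> = M - c * real (\<Sum>A + \<Sum>B + (\<Sum>A' + \<Sum>B'))" unfolding c4 by simp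
  finally show ?thesis unfolding M_def c_def .
qed

section \<open>The limit of the number of closed walks\<close>

lemma in_sector_if_slope:
  assumes "Re w > 0" "\<bar>Im w / Re w\<bar> < pi / n"
  shows "w \<in> sector n"
proof -
  have "Arg w = arctan (Im w / Re w)" by (rule arg_conv_arctan[OF assms(1)])
  moreover have "\<bar>arctan (Im w / Re w)\<bar> \<le> \<bar>Im w / Re w\<bar>" by (rule abs_arctan_le)
  ultimately have "- pi / n < Arg w" "Arg w \<le> pi / n" using assms(2) by auto
  moreover have "w = of_real (norm w) * cis (Arg w)" using rcis_cmod_Arg[of w] by (simp add: rcis_def)
  moreover have "norm w > 0" using assms(1) by auto
  ultimately show ?thesis unfolding sector_def by blast
qed

text \<open>
  For \<open>n \<ge> 4\<close> the cosine of the angle is at least 2/3. The resulting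
  constant \<open>3/2 * \<pi>\<close> has to be smaller than the factor \<open>2 *
  \<pi>\<close> that \<open>n\<close> times the slope approaches, at least, if the particles
  and holes at one end do not balance.
\<close>

lemma sector_slope:
  assumes "n \<ge> 4" "w \<in> sector n"
  shows "n * \<bar>Im w\<bar> \<le> 3 / 2 * pi * Re w"
proof -
  obtain \<rho> \<phi> where w: "w = of_real \<rho> * cis \<phi>" "\<rho> > 0" "- pi / n < \<phi>" "\<phi> \<le> pi / n"
    using assms(2) by (auto simp: sector_def)
  have n0: "real n > 0" using assms by simp
  have \<phi>: "\<bar>\<phi>\<bar> \<le> pi / n" using w by auto
  have n4: "pi / n \<le> pi / 4" using assms by (intro divide_left_mono) auto
  have "\<bar>sin \<phi>\<bar> \<le> pi / n" using abs_sin_x_le_abs_x[of \<phi>] \<phi> by linarith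
  hence "n * \<bar>sin \<phi>\<bar> \<le> pi" using n0 by (simp add: field_simps)
  moreover have "cos \<phi> \<ge> 2 / 3"
  proof -
    have "(4 / 3) ^ 2 \<le> (2 :: real)" by (simp add: power2_eq_square)
    hence "4 / 3 \<le> sqrt 2" by (rule real_le_rsqrt)
    hence "2 / 3 \<le> cos (pi / 4)" by (simp add: cos_45)
    also have "\<dots> \<le> cos \<bar>\<phi>\<bar>" using order_trans[OF \<phi> n4] by (intro cos_monotone_0_pi_le) auto
    finally show ?thesis by simp
  qed
  hence "3 / 2 * pi * (2 / 3) \<le> 3 / 2 * pi * cos \<phi>" by (intro mult_left_mono) auto
  ultimately have "n * \<bar>sin \<phi>\<bar> \<le> 3 / 2 * pi * cos \<phi>" by linarith
  hence "\<rho> * (n * \<bar>sin \<phi>\<bar>) \<le> \<rho> * (3 / 2 * pi * cos \<phi>)" using w(2) by (intro mult_left_mono) auto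
  thus ?thesis using w(2) by (simp add: w(1) abs_mult mult_ac)
qed

lemma tendsto_cis: "(f \<longlongrightarrow> c) F \<Longrightarrow> ((\<lambda>x. cis (f x)) \<longlongrightarrow> cis c) F"
  unfolding cis_conv_exp by (intro tendsto_intros)

lemma tendsto_cis_difference_quotient:
  "(\<lambda>n. of_nat n * (cis (c / real n) - 1)) \<longlonglongrightarrow> \<i> * of_real c"
proof -
  have "(\<lambda>n. real n * (cos (c / real n) - 1)) \<longlonglongrightarrow> 0" by real_asymp
  moreover have "(\<lambda>n. real n * sin (c / real n)) \<longlonglongrightarrow> c" by real_asymp
  ultimately show ?thesis by (simp add: tendsto_complex_iff)
qed

context
  fixes l k :: "nat \<Rightarrow> nat" and p \<tau> :: real
  assumes p: "p > 0" and \<tau>: "0 < \<tau>" "\<tau> < 1"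
    and l_lim: "(\<lambda>n. real (l n) / n) \<longlonglongrightarrow> \<tau>"
    and k_lim: "(\<lambda>n. real (k n) / n) \<longlonglongrightarrow> p"
begin

lemma sin_pi_tau_pos: "sin (pi * \<tau>) > 0"
  using \<tau> by (intro sin_gt_zero) auto

lemma theta_lim: "(\<lambda>n. pi * real (l n) / n) \<longlonglongrightarrow> pi * \<tau>"
  using tendsto_mult_left[OF l_lim, of pi] by simp

lemma ground_lim: "(\<lambda>n. sin (pi * real (l n) / n) / sin (pi / n) / n) \<longlonglongrightarrow> sin (pi * \<tau>) / pi"
proof -
  have "(\<lambda>n. real n * sin (pi / n)) \<longlonglongrightarrow> pi" by real_asymp
  hence "(\<lambda>n. sin (pi * real (l n) / n) / (real n * sin (pi / n))) \<longlonglongrightarrow> sin (pi * \<tau>) / pi"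
    by (intro tendsto_divide tendsto_sin theta_lim) auto
  thus ?thesis by (simp add: mult.commute)
qed

text \<open>
  All nodes near the end of the arc tend to the same point, so only the charge \<open>card A
  - card B\<close> remains.
\<close>

lemma edge_sum_lim:
  "(\<lambda>n. edge_sum n (l n) A B) \<longlonglongrightarrow> of_real (real (card A) - real (card B)) * cis (pi * \<tau>)"
proof -
  have z: "(\<lambda>n. c * pi / real n) \<longlonglongrightarrow> 0" for c by real_asymp
  have "(\<lambda>n. cis (pi * real (l n) / n + (2 * real a + 1) * pi / n)) \<longlonglongrightarrow> cis (pi * \<tau> + 0)"
       "(\<lambda>n. cis (pi * real (l n) / n - (2 * real a + 1) * pi / n)) \<longlonglongrightarrow> cis (pi * \<tau> - 0)" for a
    by (intro tendsto_cis tendsto_add tendsto_diff theta_lim z)+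
  hence "(\<lambda>n. edge_sum n (l n) A B) \<longlonglongrightarrow> (\<Sum>a\<in>A. cis (pi * \<tau>)) - (\<Sum>b\<in>B. cis (pi * \<tau>))"
    unfolding edge_sum_def by (intro tendsto_diff tendsto_sum) auto
  thus ?thesis by (simp add: left_diff_distrib)
qed

text \<open>
  Without charge the limits of the nodes cancel and the first order in \<open>1 / n\<close>
  remains. The particle \<open>a\<close> is displaced by the angle \<open>(2 * a + 1) *
  \<pi> / n\<close> from the end of the arc, the hole \<open>b\<close> by \<open>(2 * b + 1)
  * \<pi> / n\<close> to the other side, and these odd numbers add up to twice the Frobenius
  size.
\<close>

lemma edge_sum_lim_neutral:
  assumes "(A, B) \<in> frobenius_pairs"
  shows "(\<lambda>n. of_nat n * edge_sum n (l n) A B) \<longlonglongrightarrow> 2 * pi * \<i> * cis (pi * \<tau>) * of_nat (frobenius_size (A, B))"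
proof -
  have c: "card A = card B" using assms by (simp add: frobenius_pairs_def)
  have eq: "of_nat n * edge_sum n (l n) A B = cis (pi * real (l n) / n) *
     ((\<Sum>a\<in>A. of_nat n * (cis ((2 * real a + 1) * pi / n) - 1)) - (\<Sum>b\<in>B. of_nat n * (cis (- ((2 * real b + 1) * pi) / n) - 1)))" for n
  proof -
    have "edge_sum n (l n) A B = cis (pi * real (l n) / n) *
      ((\<Sum>a\<in>A. cis ((2 * real a + 1) * pi / n)) - (\<Sum>b\<in>B. cis (- ((2 * real b + 1) * pi) / n)))"
      unfolding edge_sum_def right_diff_distrib sum_distrib_left cis_mult by simp
    also have "(\<Sum>a\<in>A. cis ((2 * real a + 1) * pi / n)) - (\<Sum>b\<in>B. cis (- ((2 * real b + 1) * pi) / n)) =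
       (\<Sum>a\<in>A. cis ((2 * real a + 1) * pi / n) - 1) - (\<Sum>b\<in>B. cis (- ((2 * real b + 1) * pi) / n) - 1)"
      using c by (simp add: sum_subtractf)
    finally show ?thesis by (simp add: sum_distrib_left right_diff_distrib mult_ac)
  qed
  have "(\<lambda>n. of_nat n * edge_sum n (l n) A B) \<longlonglongrightarrow> cis (pi * \<tau>) *
     ((\<Sum>a\<in>A. \<i> * of_real ((2 * real a + 1) * pi)) - (\<Sum>b\<in>B. \<i> * of_real (- ((2 * real b + 1) * pi))))"
    unfolding eq by (intro tendsto_mult tendsto_cis theta_lim tendsto_diff tendsto_sum tendsto_cis_difference_quotient)
  also have "cis (pi * \<tau>) * ((\<Sum>a\<in>A. \<i> * of_real ((2 * real a + 1) * pi)) - (\<Sum>b\<in>B. \<i> * of_real (- ((2 * real b + 1) * pi)))) =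
    2 * pi * \<i> * cis (pi * \<tau>) * of_nat (frobenius_size (A, B))"
  proof -
    have s: "(\<Sum>a\<in>A. (2 * real a + 1) * pi) = pi * (2 * real (\<Sum>A) + real (card A))" for A
      by (simp add: sum_distrib_left sum_distrib_right sum.distrib algebra_simps)
    have "(\<Sum>a\<in>A. \<i> * of_real ((2 * real a + 1) * pi)) - (\<Sum>b\<in>B. \<i> * of_real (- ((2 * real b + 1) * pi))) =
      \<i> * of_real ((\<Sum>a\<in>A. (2 * real a + 1) * pi) + (\<Sum>b\<in>B. (2 * real b + 1) * pi))"
      by (simp add: sum_distrib_left distrib_left sum_negf)
    also have "\<dots> = \<i> * of_real (2 * pi * real (frobenius_size (A, B)))"
      unfolding s using c by (simp add: frobenius_size_def algebra_simps)
    finally show ?thesis by (simp add: mult_ac)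
  qed
  finally show ?thesis .
qed

definition defect :: "nat \<Rightarrow> excitation \<Rightarrow> complex" where
  "defect n = (\<lambda>((A, B), (A', B')). edge_sum n (l n) A B + cnj (edge_sum n (l n) A' B'))"

definition ground :: "nat \<Rightarrow> real" where
  "ground n = sin (pi * real (l n) / n) / sin (pi / n)"

lemma ground_over_n_lim: "(\<lambda>n. ground n / n) \<longlonglongrightarrow> sin (pi * \<tau>) / pi"
  unfolding ground_def by (rule ground_lim)

lemma Re_excited_lim: "(\<lambda>n. Re (of_real (ground n) + defect n Q) / n) \<longlonglongrightarrow> sin (pi * \<tau>) / pi"
proof -
  obtain A B A' B' where Q: "Q = ((A, B), (A', B'))" by (metis prod.exhaust)
  obtain d where "(\<lambda>n. defect n Q) \<longlonglongrightarrow> d"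
    unfolding defect_def Q prod.case using tendsto_add[OF edge_sum_lim tendsto_cnj[OF edge_sum_lim]] by blast
  hence "(\<lambda>n. ground n / n + Re (defect n Q) * inverse (real n)) \<longlonglongrightarrow> sin (pi * \<tau>) / pi + Re d * 0"
    by (intro tendsto_add tendsto_mult ground_over_n_lim tendsto_Re lim_inverse_n)
  thus ?thesis by (simp add: divide_inverse distrib_right)
qed

lemma Im_defect_lim:
  assumes "card A + card A' = card B + card B'"
  shows "(\<lambda>n. Im (defect n ((A, B), (A', B')))) \<longlonglongrightarrow> 2 * (real (card A) - real (card B)) * sin (pi * \<tau>)"
proof -
  have "(\<lambda>n. defect n ((A, B), (A', B'))) \<longlonglongrightarrow> of_real (real (card A) - real (card B)) * cis (pi * \<tau>) +
      cnj (of_real (real (card A') - real (card B')) * cis (pi * \<tau>))"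
    unfolding defect_def prod.case by (intro tendsto_add tendsto_cnj edge_sum_lim)
  from tendsto_Im[OF this] have "(\<lambda>n. Im (defect n ((A, B), (A', B')))) \<longlonglongrightarrow>
      (real (card A) - real (card B)) * sin (pi * \<tau>) - (real (card A') - real (card B')) * sin (pi * \<tau>)" by simp
  moreover have "real (card A') - real (card B') = - (real (card A) - real (card B))" using assms by linarith
  ultimately show ?thesis by (simp add: algebra_simps)
qed

text \<open>
  A charge \<open>q\<close> at the upper end goes with the charge \<open>- q\<close> at the
  lower end. Together they change the sum by about \<open>2 * \<i> * q * sin (\<pi>
  \<tau>)\<close>, which turns it by about \<open>2 * \<pi> * q / n\<close>, more than the
  sector allows.
\<close>

lemma charged_not_in_sector:
  assumes "card A + card A' = card B + card B'" "card A \<noteq> card B"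
  shows "\<forall>\<^sub>F n in sequentially. of_real (ground n) + defect n ((A, B), (A', B')) \<notin> sector n"
proof -
  let ?Q = "((A, B), (A', B'))"
  have "(\<lambda>n. \<bar>Im (defect n ?Q)\<bar> - 3 / 2 * pi * (Re (of_real (ground n) + defect n ?Q) / n)) \<longlonglongrightarrow>
     \<bar>2 * (real (card A) - real (card B)) * sin (pi * \<tau>)\<bar> - 3 / 2 * pi * (sin (pi * \<tau>) / pi)"
    by (intro tendsto_diff tendsto_rabs tendsto_mult tendsto_const Im_defect_lim[OF assms(1)] Re_excited_lim)
  moreover have "\<bar>2 * (real (card A) - real (card B)) * sin (pi * \<tau>)\<bar> - 3 / 2 * pi * (sin (pi * \<tau>) / pi) > 0"
  proof -
    have "\<bar>real (card A) - real (card B)\<bar> \<ge> 1" using assms(2) by linarith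
    hence "1 * sin (pi * \<tau>) \<le> \<bar>real (card A) - real (card B)\<bar> * sin (pi * \<tau>)"
      using sin_pi_tau_pos by (intro mult_right_mono) auto
    moreover have "\<bar>2 * (real (card A) - real (card B)) * sin (pi * \<tau>)\<bar> = 2 * (\<bar>real (card A) - real (card B)\<bar> * sin (pi * \<tau>))"
      by (simp only: abs_mult abs_numeral mult.assoc abs_of_pos[OF sin_pi_tau_pos])
    moreover have "3 / 2 * pi * (sin (pi * \<tau>) / pi) = 3 / 2 * sin (pi * \<tau>)" by simp
    ultimately show ?thesis using sin_pi_tau_pos by linarith
  qed
  ultimately have "\<forall>\<^sub>F n in sequentially. \<bar>Im (defect n ?Q)\<bar> - 3 / 2 * pi * (Re (of_real (ground n) + defect n ?Q) / n) > 0"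
    by (rule order_tendstoD(1))
  thus ?thesis using eventually_ge_at_top[of 4]
  proof eventually_elim
    case (elim n)
    show ?case
    proof
      assume "of_real (ground n) + defect n ?Q \<in> sector n"
      from sector_slope[OF elim(2) this] have "n * \<bar>Im (defect n ?Q)\<bar> \<le> 3 / 2 * pi * Re (of_real (ground n) + defect n ?Q)"
        by simp
      thus False using elim by (simp add: field_simps)
    qed
  qed
qed

lemma neutral_in_sector:
  assumes "card A = card B" "card A' = card B'"
  shows "\<forall>\<^sub>F n in sequentially. of_real (ground n) + defect n ((A, B), (A', B')) \<in> sector n"
proof -
  let ?Q = "((A, B), (A', B'))"
  have Im0: "(\<lambda>n. \<bar>Im (defect n ?Q)\<bar>) \<longlonglongrightarrow> 0"
    using tendsto_rabs[OF Im_defect_lim[of A A' B B']] assms by simp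
  have pos: "sin (pi * \<tau>) / pi > 0" using sin_pi_tau_pos by simp
  have "(\<lambda>n. \<bar>Im (defect n ?Q)\<bar> / (Re (of_real (ground n) + defect n ?Q) / n)) \<longlonglongrightarrow> 0 / (sin (pi * \<tau>) / pi)"
    by (intro tendsto_divide Im0 Re_excited_lim) (use pos in linarith)
  hence "\<forall>\<^sub>F n in sequentially. \<bar>Im (defect n ?Q)\<bar> / (Re (of_real (ground n) + defect n ?Q) / n) < pi"
    by (rule order_tendstoD(2)) simp
  moreover have "\<forall>\<^sub>F n in sequentially. Re (of_real (ground n) + defect n ?Q) / n > 0"
    by (rule order_tendstoD(1)[OF Re_excited_lim pos])
  ultimately show ?thesis using eventually_gt_at_top[of 0]
  proof eventually_elim
    case (elim n)
    define R where "R = Re (of_real (ground n) + defect n ?Q)"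
    have R: "R > 0" using elim by (simp add: R_def zero_less_divide_iff)
    have "\<bar>Im (defect n ?Q)\<bar> / (R / n) < pi" using elim by (simp only: R_def)
    hence "\<bar>Im (defect n ?Q) / R\<bar> < pi / n" using R elim(3) by (simp add: abs_divide field_simps)
    thus ?case using R by (intro in_sector_if_slope) (simp_all add: R_def)
  qed
qed

text \<open>
  The defect is of order \<open>1 / n\<close> and the sum over the arc of order
  \<open>n\<close>, so the exponent \<open>n * k n\<close>, of order
  \<open>n\<^sup>2\<close>, gives an exponential limit. The factor \<open>2 * \<pi>\<^sup>2
  * p * \<i> * cis (\<pi> \<tau>) / sin (\<pi> \<tau>)\<close> that arises is \<open>- p *
  q_minus \<tau>\<close>, and its conjugate is \<open>- p * q_plus \<tau>\<close>.
\<close>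

lemma neutral_power_lim:
  assumes "(A, B) \<in> frobenius_pairs" "(A', B') \<in> frobenius_pairs"
  shows "(\<lambda>n. (1 + defect n ((A, B), (A', B')) / of_real (ground n)) ^ (n * k n)) \<longlonglongrightarrow>
     exp (- of_real p * q_minus \<tau>) ^ frobenius_size (A, B) * exp (- of_real p * q_plus \<tau>) ^ frobenius_size (A', B')"
proof -
  let ?Q = "((A, B), (A', B'))"
  let ?e = "frobenius_size (A, B)" and ?e' = "frobenius_size (A', B')"
  define D where "D = 2 * pi * \<i> * cis (pi * \<tau>) * of_nat ?e + cnj (2 * pi * \<i> * cis (pi * \<tau>) * of_nat ?e')"
  have D: "(\<lambda>n. of_nat n * defect n ?Q) \<longlonglongrightarrow> D"
  proof -
    have "of_nat n * defect n ?Q = of_nat n * edge_sum n (l n) A B + cnj (of_nat n * edge_sum n (l n) A' B')" for n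
      by (simp add: defect_def distrib_left)
    thus ?thesis unfolding D_def by (simp only:) (intro tendsto_add tendsto_cnj edge_sum_lim_neutral assms)
  qed
  have pos: "sin (pi * \<tau>) / pi > 0" using sin_pi_tau_pos by simp
  have G: "(\<lambda>n. complex_of_real (ground n / n)) \<longlonglongrightarrow> of_real (sin (pi * \<tau>) / pi)"
    by (intro tendsto_of_real ground_over_n_lim)
  have nz: "complex_of_real (sin (pi * \<tau>) / pi) \<noteq> 0" using sin_pi_tau_pos by simp
  define L where "L = D / of_real (sin (pi * \<tau>) / pi) * of_real p"
  have N: "(\<lambda>n. of_nat (n * k n) * (defect n ?Q / of_real (ground n))) \<longlonglongrightarrow> L"
  proof (rule Lim_transform_eventually)
    show "(\<lambda>n. of_nat n * defect n ?Q / of_real (ground n / n) * of_real (real (k n) / n)) \<longlonglongrightarrow> L"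
      unfolding L_def by (intro tendsto_mult tendsto_divide D G nz tendsto_of_real k_lim)
    show "\<forall>\<^sub>F n in sequentially. of_nat n * defect n ?Q / of_real (ground n / n) * of_real (real (k n) / n) =
       of_nat (n * k n) * (defect n ?Q / of_real (ground n))"
      using eventually_gt_at_top[of 0] by eventually_elim (simp add: field_simps)
  qed
  have x0: "(\<lambda>n. defect n ?Q / of_real (ground n)) \<longlonglongrightarrow> 0"
  proof (rule Lim_transform_eventually)
    have "(\<lambda>n. complex_of_real (inverse (real n))) \<longlonglongrightarrow> of_real 0" by (intro tendsto_of_real lim_inverse_n)
    hence "(\<lambda>n. of_nat n * defect n ?Q / of_real (ground n / n) * of_real (inverse (real n)) * of_real (inverse (real n))) \<longlonglongrightarrow>
       D / of_real (sin (pi * \<tau>) / pi) * of_real 0 * of_real 0"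
      by (intro tendsto_mult tendsto_divide D G nz)
    thus "(\<lambda>n. of_nat n * defect n ?Q / of_real (ground n / n) * of_real (inverse (real n)) * of_real (inverse (real n))) \<longlonglongrightarrow> 0"
      by simp
    show "\<forall>\<^sub>F n in sequentially. of_nat n * defect n ?Q / of_real (ground n / n) * of_real (inverse (real n)) * of_real (inverse (real n)) =
       defect n ?Q / of_real (ground n)"
      using eventually_gt_at_top[of 0] by eventually_elim (simp add: field_simps)
  qed
  have "(\<lambda>n. (1 + defect n ?Q / of_real (ground n)) ^ (n * k n)) \<longlonglongrightarrow> exp L"
    by (rule tendsto_one_plus_power_exp[OF x0 N])
  also have "L = of_nat ?e * (- of_real p * q_minus \<tau>) + of_nat ?e' * (- of_real p * q_plus \<tau>)"
    using sin_pi_tau_pos unfolding L_def D_def q_minus_def q_plus_def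
    by (auto simp: complex_eq_iff field_simps power2_eq_square)
  finally show ?thesis by (simp only: exp_add exp_of_nat_mult)
qed

text \<open>
  The contribution of an excitation relative to that of the arc. It is 0 outside the sector
  and for excitations that do not fit, so that all \<open>n\<close> share one index set.
\<close>

definition mode_weight :: "nat \<Rightarrow> excitation \<Rightarrow> complex" where
  "mode_weight n Q = (if admissible n (l n) Q \<and> of_real (ground n) + defect n Q \<in> sector n
     then (1 + defect n Q / of_real (ground n)) ^ (n * k n) else 0)"

definition excitations :: "excitation set" where
  "excitations = ({A. finite A} \<times> {A. finite A}) \<times> ({A. finite A} \<times> {A. finite A})"

lemma admissible_excitations: "admissible n m Q \<Longrightarrow> Q \<in> excitations"
  by (auto simp: admissible_def excitations_def split: prod.splits intro: finite_subset)

lemma ground_pos: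
  assumes "n \<ge> 2" "0 < l n" "l n < n"
  shows "ground n > 0"
proof -
  have "0 < sin (pi * real (l n) / n)" by (rule sin_gt_zero) (use assms in \<open>auto simp: field_simps\<close>)
  moreover have "0 < sin (pi / n)" by (rule sin_gt_zero) (use assms in \<open>auto simp: field_simps\<close>)
  ultimately show ?thesis unfolding ground_def by (rule divide_pos_pos)
qed

lemma sum_node_eq_ground:
  assumes "n \<ge> 2" "l n < n" "admissible n (l n) Q"
  shows "(\<Sum>j\<in>excite n (l n) Q. node n (l n) j) = of_real (ground n) + defect n Q"
proof -
  obtain A B A' B' where Q: "Q = ((A, B), (A', B'))" by (metis prod.exhaust)
  show ?thesis unfolding Q defect_def ground_def prod.case
    using sum_node_excite[OF assms(1,2) assms(3)[unfolded Q]] by (simp add: add.assoc)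
qed

lemma closed_walks_eq_infsum:
  assumes n: "n \<ge> 2" "0 < l n" "l n < n" "k n \<ge> 1"
  shows "of_nat (card (closed_walks n (l n) (n * k n))) / (of_nat n * of_real (ground n) ^ (n * k n)) =
    infsum (mode_weight n) excitations"
proof -
  let ?E = "\<lambda>I. \<Sum>j\<in>I. node n (l n) j" and ?N = "n * k n"
  let ?P = "{Q. admissible n (l n) Q}" and ?S = "{Q. admissible n (l n) Q \<and> of_real (ground n) + defect n Q \<in> sector n}"
  have g: "ground n > 0" by (rule ground_pos[OF n(1-3)])
  have bij: "bij_betw (excite n (l n)) ?P {I. I \<subseteq> {..<n} \<and> card I = l n}"
    by (rule bij_betw_excite[OF n(3) refl refl refl refl])
  have "finite {I. I \<subseteq> {..<n} \<and> card I = l n}" by (rule finite_subset[of _ "Pow {..<n}"]) auto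
  hence finP: "finite ?P" using bij bij_betw_finite by blast
  have bijS: "bij_betw (excite n (l n)) ?S {I. I \<subseteq> {..<n} \<and> card I = l n \<and> ?E I \<in> sector n}"
  proof -
    have "bij_betw (excite n (l n)) {Q \<in> ?P. ?E (excite n (l n) Q) \<in> sector n}
        {I \<in> {I. I \<subseteq> {..<n} \<and> card I = l n}. ?E I \<in> sector n}"
      by (rule bij_betw_Collect[OF bij]) (rule refl)
    moreover have "{Q \<in> ?P. ?E (excite n (l n) Q) \<in> sector n} = ?S"
      using sum_node_eq_ground[OF n(1,3)] by auto
    ultimately show ?thesis by (simp add: conj_assoc)
  qed
  have "of_nat (card (closed_walks n (l n) ?N)) = of_nat n * (\<Sum>I | I \<subseteq> {..<n} \<and> card I = l n \<and> ?E I \<in> sector n. ?E I ^ ?N)"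
    unfolding card_closed_walks[OF n(1)] using n by (intro sum_powers_eq_sector_sum) auto
  also have "(\<Sum>I | I \<subseteq> {..<n} \<and> card I = l n \<and> ?E I \<in> sector n. ?E I ^ ?N) = (\<Sum>Q\<in>?S. ?E (excite n (l n) Q) ^ ?N)"
    by (rule sum.reindex_bij_betw[OF bijS, symmetric])
  also have "\<dots> = (\<Sum>Q\<in>?S. of_real (ground n) ^ ?N * mode_weight n Q)"
  proof (rule sum.cong[OF refl])
    fix Q assume Q: "Q \<in> ?S"
    have "?E (excite n (l n) Q) = of_real (ground n) * (1 + defect n Q / of_real (ground n))"
      using sum_node_eq_ground[OF n(1,3)] Q g by (simp add: field_simps)
    thus "?E (excite n (l n) Q) ^ ?N = of_real (ground n) ^ ?N * mode_weight n Q"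
      using Q by (simp add: mode_weight_def power_mult_distrib)
  qed
  also have "\<dots> = of_real (ground n) ^ ?N * (\<Sum>Q\<in>?S. mode_weight n Q)" by (rule sum_distrib_left[symmetric])
  also have "(\<Sum>Q\<in>?S. mode_weight n Q) = infsum (mode_weight n) ?S"
    using finP by (intro infsum_finite[symmetric]) (auto intro: finite_subset)
  also have "infsum (mode_weight n) ?S = infsum (mode_weight n) excitations"
    by (rule infsum_cong_neutral) (auto simp: mode_weight_def admissible_excitations)
  finally show ?thesis using g n by simp
qed

text \<open>
  By the bound for the sum in the sector, the modulus of the base is at most \<open>1 - 4 *
  s * T / (n * ground n)\<close>, where \<open>s = sin (\<delta> / 4)\<close> and
  \<open>T\<close> is the sum of all distances. Since \<open>1 - x \<le> exp (- x)\<close>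
  and \<open>ground n \<le> n / 2\<close>, the power is at most \<open>exp (- 8 * s * T * k
  n / n)\<close>, and \<open>k n / n\<close> is at least \<open>p / 2\<close>.
\<close>

lemma mode_weight_bound:
  assumes "0 < \<delta>" and n: "n \<ge> 2" "0 < l n" "l n < n"
    and \<delta>: "\<delta> \<le> pi * real (l n) / n" "pi * real (l n) / n \<le> pi - \<delta>" "pi / (2 * real n) \<le> \<delta> / 4"
    and kn: "real (k n) / n \<ge> p / 2"
  shows "norm (mode_weight n ((A, B), (A', B'))) \<le>
    exp (- 4 * sin (\<delta> / 4) * p) ^ (\<Sum>A + \<Sum>B) * exp (- 4 * sin (\<delta> / 4) * p) ^ (\<Sum>A' + \<Sum>B')"
proof (cases "admissible n (l n) ((A, B), (A', B')) \<and> of_real (ground n) + defect n ((A, B), (A', B')) \<in> sector n")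
  case True
  let ?Q = "((A, B), (A', B'))"
  define s where "s = sin (\<delta> / 4)"
  define T where "T = \<Sum>A + \<Sum>B + (\<Sum>A' + \<Sum>B')"
  define N where "N = n * k n"
  have g: "ground n > 0" by (rule ground_pos[OF n])
  have n0: "real n > 0" using n by simp
  have s0: "s \<ge> 0" unfolding s_def using assms by (intro sin_ge_zero) auto
  have g2: "ground n \<le> real n / 2"
  proof -
    have "2 * (pi / n) / pi \<le> sin (pi / n)" using n by (intro jordan_sin_bound) (auto simp: field_simps)
    hence "2 / n \<le> sin (pi / n)" by simp
    hence "ground n \<le> 1 / (2 / n)" unfolding ground_def using n0 by (intro frac_le) auto
    thus ?thesis by simp
  qed
  have E: "(\<Sum>j\<in>excite n (l n) ?Q. node n (l n) j) = of_real (ground n) + defect n ?Q"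
    using sum_node_eq_ground[OF n(1,3)] True by blast
  have "norm (of_real (ground n) + defect n ?Q) \<le> ground n - 4 * s / n * real T"
    using sector_excite_bound[OF n(1) assms(1) \<delta> n(3), of A B A' B'] True unfolding E ground_def s_def T_def by blast
  moreover have "1 + defect n ?Q / of_real (ground n) = (of_real (ground n) + defect n ?Q) / of_real (ground n)"
    using g by (simp add: field_simps)
  ultimately have "norm (1 + defect n ?Q / of_real (ground n)) \<le> (ground n - 4 * s / n * real T) / ground n"
    using g by (simp add: norm_divide divide_right_mono)
  also have "\<dots> = 1 + - (4 * s * real T / (n * ground n))" using g n0 by (simp add: field_simps)
  also have "\<dots> \<le> exp (- (4 * s * real T / (n * ground n)))" by (rule exp_ge_add_one_self)
  finally have "norm (1 + defect n ?Q / of_real (ground n)) ^ N \<le> exp (- (4 * s * real T / (n * ground n))) ^ N"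
    by (intro power_mono) auto
  also have "\<dots> = exp (real N * - (4 * s * real T / (n * ground n)))" by (rule exp_of_nat_mult[symmetric])
  also have "\<dots> \<le> exp (real T * (- 4 * s * p))"
  proof -
    have "p \<le> real (k n) / ground n"
    proof -
      have "p = (p / 2 * n) / (n / 2)" using n0 by simp
      also have "\<dots> \<le> real (k n) / ground n"
        using kn n0 g g2 p by (intro frac_le) (auto simp: field_simps)
      finally show ?thesis .
    qed
    hence "4 * s * real T * p \<le> 4 * s * real T * (real (k n) / ground n)" using s0 by (intro mult_left_mono) auto
    also have "\<dots> = real N * (4 * s * real T / (n * ground n))" using n0 by (simp add: N_def)
    finally show ?thesis by (simp add: mult_ac)
  qed
  also have "\<dots> = exp (- 4 * s * p) ^ T" by (rule exp_of_nat_mult)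
  finally show ?thesis using True
    by (simp only: mode_weight_def if_True norm_power s_def T_def N_def power_add simp_thms)
next
  case False
  hence "mode_weight n ((A, B), (A', B')) = 0" by (simp only: mode_weight_def if_False)
  thus ?thesis by simp
qed

text \<open>
  Only excitations without charge at either end survive in the limit.
\<close>

definition limit_weight :: "excitation \<Rightarrow> complex" where
  "limit_weight = (\<lambda>(x, y). if x \<in> frobenius_pairs \<and> y \<in> frobenius_pairs
     then exp (- of_real p * q_minus \<tau>) ^ frobenius_size x * exp (- of_real p * q_plus \<tau>) ^ frobenius_size y else 0)"

lemma has_sum_limit_weight:
  "(limit_weight has_sum partition_gf (exp (- of_real p * q_minus \<tau>)) * partition_gf (exp (- of_real p * q_plus \<tau>))) excitations"
proof -
  have norm: "norm (exp (- of_real p * q_minus \<tau>)) < 1" "norm (exp (- of_real p * q_plus \<tau>)) < 1"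
    using p by (simp_all add: norm_exp_eq_Re q_minus_def q_plus_def)
  have "((\<lambda>(x, y). exp (- of_real p * q_minus \<tau>) ^ frobenius_size x * exp (- of_real p * q_plus \<tau>) ^ frobenius_size y) has_sum
      partition_gf (exp (- of_real p * q_minus \<tau>)) * partition_gf (exp (- of_real p * q_plus \<tau>))) (frobenius_pairs \<times> frobenius_pairs)"
    using norm by (intro has_sum_product has_sum_partition_gf abs_summable_frobenius)
  thus ?thesis
    by (rule has_sum_cong_neutral[THEN iffD1, rotated -1])
      (auto simp: limit_weight_def excitations_def frobenius_pairs_def split: if_splits)
qed

lemma eventually_parameters:
  "\<forall>\<^sub>F n in sequentially. n \<ge> 2 \<and> m < l n \<and> m + l n < n \<and> k n \<ge> 1"
proof -
  have t2: "\<tau> / 2 > 0" "\<tau> / 2 < \<tau>" "\<tau> < (1 + \<tau>) / 2" "p / 2 < p" using \<tau> p by auto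
  have "\<forall>\<^sub>F n in sequentially. real m + 1 \<le> \<tau> / 2 * real n" using t2(1) by real_asymp
  moreover have "\<forall>\<^sub>F n in sequentially. real m + 1 \<le> (1 - \<tau>) / 2 * real n" using \<tau> by real_asymp
  moreover have "\<forall>\<^sub>F n in sequentially. 1 \<le> p / 2 * real n" using p by real_asymp
  ultimately show ?thesis
    using order_tendstoD(1)[OF l_lim t2(2)] order_tendstoD(2)[OF l_lim t2(3)] order_tendstoD(1)[OF k_lim t2(4)]
      eventually_ge_at_top[of 2]
  proof eventually_elim
    case (elim n)
    have n0: "real n > 0" using elim by simp
    have 1: "\<tau> / 2 * n < l n" using elim(4) unfolding pos_less_divide_eq[OF n0] .
    have 2: "l n < (1 + \<tau>) / 2 * n" using elim(5) unfolding pos_divide_less_eq[OF n0] .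
    have 3: "p / 2 * n < k n" using elim(6) unfolding pos_less_divide_eq[OF n0] .
    have 4: "(1 + \<tau>) / 2 * n + (1 - \<tau>) / 2 * n = n" by (simp add: field_simps)
    have "real m < l n" using 1 elim(1) by linarith
    moreover have "real m + l n < n" using 2 4 elim(2) by linarith
    moreover have "1 < real (k n)" using 3 elim(3) by linarith
    ultimately show ?case using elim(7) by simp
  qed
qed

lemma eventually_admissible:
  assumes "Q \<in> excitations" "Q = ((A, B), (A', B'))" "card A + card A' = card B + card B'"
  shows "\<forall>\<^sub>F n in sequentially. admissible n (l n) Q"
proof -
  have "finite (A \<union> A' \<union> (B \<union> B'))" using assms by (auto simp: excitations_def)
  from finite_nat_bounded[OF this] obtain m where "A \<union> A' \<union> (B \<union> B') \<subseteq> {..<m}" ..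
  hence m: "A \<subseteq> {..<m}" "A' \<subseteq> {..<m}" "B \<subseteq> {..<m}" "B' \<subseteq> {..<m}" by simp_all
  have sub: "X \<subseteq> {..<j}" if "X \<subseteq> {..<m}" "m \<le> j" for X j
    using that(1) by (rule subset_trans) (use that(2) in simp)
  show ?thesis using eventually_parameters[of "2 * m"]
  proof eventually_elim
    case (elim n)
    hence d: "m \<le> (n - l n) div 2" "m \<le> l n div 2" "m \<le> (n - l n + 1) div 2" "m \<le> (l n + 1) div 2" by auto
    show ?case unfolding assms(2) admissible_def prod.case
      by (rule conjI sub[OF m(1) d(3)] sub[OF m(2) d(1)] sub[OF m(3) d(4)] sub[OF m(4) d(2)] assms(3))+
  qed
qed

lemma mode_weight_lim:
  assumes Q: "Q \<in> excitations"
  shows "(\<lambda>n. mode_weight n Q) \<longlonglongrightarrow> limit_weight Q"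
proof -
  obtain A B A' B' where Qe: "Q = ((A, B), (A', B'))" by (metis prod.exhaust)
  have fin: "finite A" "finite B" "finite A'" "finite B'" using Q by (auto simp: Qe excitations_def)
  consider "card A + card A' \<noteq> card B + card B'" | "card A + card A' = card B + card B'" "card A \<noteq> card B"
    | "card A = card B" "card A' = card B'" by linarith
  thus ?thesis
  proof cases
    case 1
    hence "mode_weight n Q = 0" for n by (simp add: mode_weight_def Qe admissible_def)
    moreover have "limit_weight Q = 0" using 1 by (auto simp: limit_weight_def Qe frobenius_pairs_def)
    ultimately show ?thesis by simp
  next
    case 2
    have "limit_weight Q = 0" using 2 by (auto simp: limit_weight_def Qe frobenius_pairs_def)
    moreover have "\<forall>\<^sub>F n in sequentially. mode_weight n Q = 0"
      using charged_not_in_sector[OF 2] by eventually_elim (simp add: mode_weight_def Qe)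
    ultimately show ?thesis by (simp add: tendsto_eventually)
  next
    case 3
    have F: "(A, B) \<in> frobenius_pairs" "(A', B') \<in> frobenius_pairs" using 3 fin by (auto simp: frobenius_pairs_def)
    have "limit_weight Q = exp (- of_real p * q_minus \<tau>) ^ frobenius_size (A, B) * exp (- of_real p * q_plus \<tau>) ^ frobenius_size (A', B')"
      using F by (simp add: limit_weight_def Qe)
    moreover have adm: "\<forall>\<^sub>F n in sequentially. admissible n (l n) ((A, B), (A', B'))"
      using eventually_admissible[OF Q Qe] 3 by (simp add: Qe)
    have "\<forall>\<^sub>F n in sequentially. (1 + defect n Q / of_real (ground n)) ^ (n * k n) = mode_weight n Q"
      using neutral_in_sector[OF 3] adm by eventually_elim (simp add: mode_weight_def Qe)
    ultimately show ?thesis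
      using Lim_transform_eventually[OF neutral_power_lim[OF F]] by (simp add: Qe)
  qed
qed

text \<open>
  Dominated convergence over all excitations; \<open>\<delta>\<close> keeps the angle
  \<open>\<pi> l / n\<close> away from 0 and \<open>\<pi>\<close>, uniformly in large
  \<open>n\<close>.
\<close>

lemma closed_walks_lim:
  "(\<lambda>n. of_nat (card (closed_walks n (l n) (n * k n))) / (of_nat n * of_real (ground n) ^ (n * k n))) \<longlonglongrightarrow>
    partition_gf (exp (- of_real p * q_minus \<tau>)) * partition_gf (exp (- of_real p * q_plus \<tau>))"
proof (rule Lim_transform_eventually)
  define \<delta> where "\<delta> = min (pi * \<tau>) (pi - pi * \<tau>) / 2"
  have \<delta>0: "0 < \<delta>" "\<delta> < pi * \<tau>" "pi * \<tau> < pi - \<delta>"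
  proof -
    have "pi * \<tau> > 0" "pi - pi * \<tau> > 0" using \<tau> by auto
    moreover have "\<delta> * 2 \<le> pi * \<tau>" "\<delta> * 2 \<le> pi - pi * \<tau>" "0 < \<delta>"
      using calculation by (auto simp: \<delta>_def)
    ultimately show "0 < \<delta>" "\<delta> < pi * \<tau>" "pi * \<tau> < pi - \<delta>" by linarith+
  qed
  define r where "r = exp (- 4 * sin (\<delta> / 4) * p)"
  have "0 < sin (\<delta> / 4)" using \<delta>0 by (intro sin_gt_zero) linarith+
  hence r: "0 \<le> r" "r < 1" using p by (simp_all add: r_def)
  have ev: "\<forall>\<^sub>F n in sequentially. \<forall>Q\<in>excitations. norm (mode_weight n Q) \<le>
     (case Q of (x, y) \<Rightarrow> (case x of (A, B) \<Rightarrow> r ^ (\<Sum>A + \<Sum>B)) * (case y of (A, B) \<Rightarrow> r ^ (\<Sum>A + \<Sum>B)))"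
  proof -
    have p2: "p / 2 < p" using p by simp
    have "\<forall>\<^sub>F n in sequentially. pi / (2 * real n) \<le> \<delta> / 4" using \<delta>0(1) by real_asymp
    thus ?thesis
      using order_tendstoD(1)[OF theta_lim \<delta>0(2)] order_tendstoD(2)[OF theta_lim \<delta>0(3)]
        order_tendstoD(1)[OF k_lim p2] eventually_parameters[of 0]
    proof eventually_elim
      case (elim n)
      show ?case
      proof
        fix Q :: excitation
        obtain A B A' B' where Qe: "Q = ((A, B), (A', B'))" by (metis prod.exhaust)
        show "norm (mode_weight n Q) \<le>
          (case Q of (x, y) \<Rightarrow> (case x of (A, B) \<Rightarrow> r ^ (\<Sum>A + \<Sum>B)) * (case y of (A, B) \<Rightarrow> r ^ (\<Sum>A + \<Sum>B)))"
          unfolding Qe prod.case r_def by (rule mode_weight_bound) (use elim \<delta>0 in auto)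
      qed
    qed
  qed
  show "(\<lambda>n. infsum (mode_weight n) excitations) \<longlonglongrightarrow>
      partition_gf (exp (- of_real p * q_minus \<tau>)) * partition_gf (exp (- of_real p * q_plus \<tau>))"
  proof (rule infsum_dominated_convergence[OF mode_weight_lim ev _ has_sum_limit_weight])
    show "(\<lambda>(x, y). (case x of (A, B) \<Rightarrow> r ^ (\<Sum>A + \<Sum>B)) * (case y of (A, B) \<Rightarrow> r ^ (\<Sum>A + \<Sum>B))) summable_on excitations"
      unfolding excitations_def using r
      by (intro summable_on_product_nonneg summable_on_finite_subset_pairs) auto
  qed
  show "\<forall>\<^sub>F n in sequentially. infsum (mode_weight n) excitations =
      of_nat (card (closed_walks n (l n) (n * k n))) / (of_nat n * of_real (ground n) ^ (n * k n))"
    using eventually_parameters[of 0] by eventually_elim (rule closed_walks_eq_infsum[symmetric]; simp)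
qed

end

section \<open>The limit of the volume\<close>

lemma floor_ratio_lim:
  fixes c :: real
  assumes "c > 0"
  shows "(\<lambda>n. real (nat \<lfloor>c * real n\<rfloor>) / real n) \<longlonglongrightarrow> c"
proof (rule tendsto_sandwich)
  show "\<forall>\<^sub>F n in sequentially. c - 1 / real n \<le> real (nat \<lfloor>c * real n\<rfloor>) / real n"
    using eventually_gt_at_top[of 0]
  proof eventually_elim
    case (elim n)
    have "c * real n - 1 \<le> real (nat \<lfloor>c * real n\<rfloor>)" by linarith
    hence "(c * real n - 1) / real n \<le> real (nat \<lfloor>c * real n\<rfloor>) / real n" by (rule divide_right_mono) simp
    thus ?case using elim by (simp add: diff_divide_distrib)
  qed
  show "\<forall>\<^sub>F n in sequentially. real (nat \<lfloor>c * real n\<rfloor>) / real n \<le> c"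
    using eventually_gt_at_top[of 0]
  proof eventually_elim
    case (elim n)
    have "0 \<le> c * real n" using assms by simp
    hence "real (nat \<lfloor>c * real n\<rfloor>) \<le> c * real n" by linarith
    thus ?case using elim by (simp add: field_simps)
  qed
  show "(\<lambda>n. c - 1 / real n) \<longlonglongrightarrow> c" by real_asymp
qed simp

text \<open>
  The logarithm of the base is \<open>\<pi>\<^sup>2 / (6 * n\<^sup>2)\<close> to leading
  order, and the exponent is about \<open>p * n\<^sup>2\<close>.
\<close>

lemma sinc_power_lim:
  fixes k :: "nat \<Rightarrow> nat"
  assumes "(\<lambda>n. real (k n) / n) \<longlonglongrightarrow> p"
  shows "(\<lambda>n. ((pi / n) / sin (pi / n)) ^ (n * k n)) \<longlonglongrightarrow> exp (p * pi\<^sup>2 / 6)"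
proof (rule Lim_transform_eventually)
  have "(\<lambda>n. real n ^ 2 * ln ((pi / real n) / sin (pi / real n))) \<longlonglongrightarrow> pi\<^sup>2 / 6"
    by real_asymp (simp add: power2_eq_square field_simps)
  hence "(\<lambda>n. exp (real (k n) / n * (real n ^ 2 * ln ((pi / real n) / sin (pi / real n))))) \<longlonglongrightarrow> exp (p * (pi\<^sup>2 / 6))"
    by (intro tendsto_exp tendsto_mult assms)
  thus "(\<lambda>n. exp (real (k n) / n * (real n ^ 2 * ln ((pi / real n) / sin (pi / real n))))) \<longlonglongrightarrow> exp (p * pi\<^sup>2 / 6)"
    by simp
  show "\<forall>\<^sub>F n in sequentially. exp (real (k n) / n * (real n ^ 2 * ln ((pi / real n) / sin (pi / real n)))) =
      ((pi / n) / sin (pi / n)) ^ (n * k n)"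
    using eventually_ge_at_top[of 2]
  proof eventually_elim
    case (elim n)
    have "0 < sin (pi / n)" by (rule sin_gt_zero) (use elim in \<open>auto simp: field_simps\<close>)
    hence pos: "(pi / n) / sin (pi / n) > 0" using elim by simp
    have "real (k n) / n * (real n ^ 2 * ln ((pi / real n) / sin (pi / real n))) = real (n * k n) * ln ((pi / n) / sin (pi / n))"
      using elim by (simp add: power2_eq_square)
    hence "exp (real (k n) / n * (real n ^ 2 * ln ((pi / real n) / sin (pi / real n)))) =
        exp (real (n * k n) * ln ((pi / n) / sin (pi / n)))" by (rule arg_cong)
    also have "\<dots> = exp (ln ((pi / n) / sin (pi / n))) ^ (n * k n)" by (rule exp_of_nat_mult)
    finally show ?case using pos by (simp only: exp_ln)
  qed
qed

theorem theorem1p4: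
  fixes p \<tau> :: real and k l :: "nat \<Rightarrow> nat"
  assumes "p > 0" and "0 < \<tau>" and "\<tau> < 1"
    and "\<And>n. k n = nat \<lfloor>p * real n\<rfloor>"
    and "\<And>n. l n = nat \<lfloor>\<tau> * real n\<rfloor>"
  shows "(\<lambda>n. complex_of_real
            ((exp 1 * sin (pi * real (l n) / real n) / pi) powi (- int (n * k n))
              * real (k n) ^ (n * k n) * bead_vol n (k n) (l n)))
         \<longlonglongrightarrow>
           complex_of_real (exp (p * pi\<^sup>2 / 6) / sqrt (2 * pi * p))
             * partition_gf (exp (- of_real p * q_plus \<tau>))
             * partition_gf (exp (- of_real p * q_minus \<tau>))"
proof -
  have k_lim: "(\<lambda>n. real (k n) / n) \<longlonglongrightarrow> p" unfolding assms(4) by (rule floor_ratio_lim[OF assms(1)])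
  have l_lim: "(\<lambda>n. real (l n) / n) \<longlonglongrightarrow> \<tau>" unfolding assms(5) by (rule floor_ratio_lim[OF assms(2)])
  note params = eventually_parameters[OF assms(1-3) l_lim k_lim]
  \<comment> \<open>This is the factor between the volume term and the normalised number of closed walks.\<close>
  define pre where "pre n = inverse (fact (n * k n) / (sqrt (real (n * k n)) * (real (n * k n) / exp 1) ^ (n * k n))) *
    inverse (sqrt (real (k n) / n)) * ((pi / n) / sin (pi / n)) ^ (n * k n)" for n
  have N_lim: "filterlim (\<lambda>n. n * k n) at_top sequentially"
  proof (rule filterlim_at_top_mono[OF filterlim_ident])
    show "\<forall>\<^sub>F n in sequentially. n \<le> n * k n"
      using params[of 0]
    proof eventually_elim
      case (elim n) thus ?case by (cases "k n") auto
    qed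
  qed
  have pre_lim: "pre \<longlonglongrightarrow> inverse (sqrt (2 * pi)) * inverse (sqrt p) * exp (p * pi\<^sup>2 / 6)"
    unfolding pre_def using assms(1)
    by (intro tendsto_mult tendsto_inverse filterlim_compose[OF stirling_formula N_lim] tendsto_real_sqrt k_lim
          sinc_power_lim[OF k_lim]) simp_all
  have const: "inverse (sqrt (2 * pi)) * inverse (sqrt p) * exp (p * pi\<^sup>2 / 6) = exp (p * pi\<^sup>2 / 6) / sqrt (2 * pi * p)"
    by (simp add: real_sqrt_mult field_simps)
  have "(\<lambda>n. complex_of_real (pre n) * (of_nat (card (closed_walks n (l n) (n * k n))) / (of_nat n * of_real (ground l n) ^ (n * k n)))) \<longlonglongrightarrow>
     complex_of_real (inverse (sqrt (2 * pi)) * inverse (sqrt p) * exp (p * pi\<^sup>2 / 6)) *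
      (partition_gf (exp (- of_real p * q_minus \<tau>)) * partition_gf (exp (- of_real p * q_plus \<tau>)))"
    by (intro tendsto_mult tendsto_of_real pre_lim closed_walks_lim[OF assms(1-3) l_lim k_lim])
  also have "complex_of_real (inverse (sqrt (2 * pi)) * inverse (sqrt p) * exp (p * pi\<^sup>2 / 6)) *
      (partition_gf (exp (- of_real p * q_minus \<tau>)) * partition_gf (exp (- of_real p * q_plus \<tau>))) =
    complex_of_real (exp (p * pi\<^sup>2 / 6) / sqrt (2 * pi * p))
             * partition_gf (exp (- of_real p * q_plus \<tau>))
             * partition_gf (exp (- of_real p * q_minus \<tau>))"
    unfolding const by (simp only: mult_ac)
  finally show ?thesis
  proof (rule Lim_transform_eventually)
    show "\<forall>\<^sub>F n in sequentially. complex_of_real (pre n) *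
         (of_nat (card (closed_walks n (l n) (n * k n))) / (of_nat n * of_real (ground l n) ^ (n * k n))) =
       complex_of_real ((exp 1 * sin (pi * real (l n) / real n) / pi) powi (- int (n * k n))
              * real (k n) ^ (n * k n) * bead_vol n (k n) (l n))"
      using params[of 0]
    proof eventually_elim
      case (elim n)
      define N C s S where "N = n * k n" and "C = real (card (closed_walks n (l n) (n * k n)))"
        and "s = sin (pi / n)" and "S = sin (pi * real (l n) / n)"
      have pos: "real n > 0" "real (k n) > 0" "s > 0" "S > 0"
      proof -
        show "s > 0" unfolding s_def by (rule sin_gt_zero) (use elim in \<open>auto simp: field_simps\<close>)
        show "S > 0" unfolding S_def by (rule sin_gt_zero) (use elim in \<open>auto simp: field_simps\<close>)
      qed (use elim in auto)
      have vol: "bead_vol n (k n) (l n) = C / fact N"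
        using bead_vol_eq_card_closed_walks[of n "k n" "l n"] elim by (simp add: C_def N_def)
      have g: "ground l n = S / s" by (simp add: ground_def[OF assms(1-3) l_lim k_lim] S_def s_def)
      \<comment> \<open>The factor \<open>n\<close> in the normalisation is split between the Stirling quotient and \<open>sqrt (k n / n)\<close>.\<close>
      have root: "sqrt (real N) * inverse (sqrt (real (k n) / n)) = n"
        using pos by (simp add: N_def real_sqrt_mult real_sqrt_divide)
      have pow: "(real N / exp 1) ^ N * ((pi / n) / s) ^ N = (exp 1 * S / pi) powi (- int N) * real (k n) ^ N * (S / s) ^ N"
      proof -
        have "(exp 1 * S / pi) powi (- int N) = (pi / (exp 1 * S)) ^ N"
          by (simp add: power_int_minus power_inverse inverse_eq_divide power_divide)
        moreover have "real N / exp 1 * ((pi / n) / s) = pi / (exp 1 * S) * real (k n) * (S / s)"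
          using pos by (simp add: N_def field_simps)
        ultimately show ?thesis by (simp only: power_mult_distrib[symmetric])
      qed
      have "pre n = (sqrt (real N) * inverse (sqrt (real (k n) / n))) * ((real N / exp 1) ^ N * ((pi / n) / s) ^ N) / fact N"
        unfolding pre_def N_def[symmetric] s_def[symmetric] by (simp add: field_simps)
      also have "\<dots> = n * ((exp 1 * S / pi) powi (- int N) * real (k n) ^ N * (S / s) ^ N) / fact N"
        unfolding root pow ..
      finally have pre_eq: "pre n = n * ((exp 1 * S / pi) powi (- int N) * real (k n) ^ N * (S / s) ^ N) / fact N" .
      have cancel: "x * (a * b * G) / f * (c / (x * G)) = a * b * (c / f)" if "x \<noteq> 0" "G \<noteq> 0" for x a b G f c :: real
        using that by simp
      have "pre n * (C / (n * (S / s) ^ N)) = (exp 1 * S / pi) powi (- int N) * real (k n) ^ N * (C / fact N)"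
        unfolding pre_eq by (rule cancel) (use pos in simp_all)
      moreover have "complex_of_real (pre n) * (of_nat (card (closed_walks n (l n) (n * k n))) / (of_nat n * of_real (ground l n) ^ (n * k n))) =
          complex_of_real (pre n * (C / (n * (S / s) ^ N)))"
        unfolding g C_def N_def
        by (simp only: of_real_mult of_real_divide of_real_power of_real_of_nat_eq)
      ultimately show ?case unfolding vol S_def N_def by (simp only:)
    qed
  qed
qed

end
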